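(* Let $k$ be a field with $\operatorname{char}k\neq2$ and $M\supseteq k$ an infinite field. For $\mathbf a=(a,b),\mathbf a'=(a',b')\in M^2$ with $D_{\mathbf a}D_{\mathbf a'}\neq0$, assume $f_{\mathbf a}(X)=X^4+aX^2+b$ and $f_{\mathbf a'}(X)=X^4+a'X^2+b'$ are irreducible over $M$ and $\#G_{\mathbf a}\ge\#G_{\mathbf a'}$. If $G_{\mathbf a}\cong\mathcal D_4$ (resp. $\mathcal C_4$ or $\mathcal V_4$), then for the given pair $(G_{\mathbf a},G_{\mathbf a'})$ the tuple (isomorphism type of $G_{\mathbf a,\mathbf a'}$, relation between $L_{\mathbf a},L_{\mathbf a'}$, $\mathrm{DT}(\mathcal R^1_{\mathbf a,\mathbf a'})$, $\mathrm{DT}(\mathcal R_{\mathbf a,\mathbf a'})$) is one of the rows listed for that pair below (GAP IDs in brackets; "$n$" abbreviates $[L_{\mathbf a}\cap L_{\mathbf a'}:M]=n$; "$=M$" abbreviates $L_{\mathbf a}\cap L_{\mathbf a'}=M$). $(\mathcal D_4,\mathcal D_4)$: (II-1) $[64,226]$ $\mathcal D_4\times\mathcal D_4$, $=M$, $8$; $16,8$. (II-2) $[32,27]$ $(\mathcal V_4\times\mathcal V_4)\rtimes\mathcal C_2$, $2$, $8$; $16,8$. (II-3) $[32,27]$ same, $2$, $4,4$; $16,4,4$. (II-4) $[32,27]$ same, $2$, $4,4$; $8,8,4,4$. (II-5) $[32,28]$ $(\mathcal C_4\times\mathcal V_4)\rtimes\mathcal C_2$, $2$, $8$; $16,8$.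 (II-6) $[32,34]$ $(\mathcal C_4\times\mathcal C_4)\rtimes\mathcal C_2$, $2$, $4,4$; $16,4,4$. (II-7) $[16,3]$ $(\mathcal C_4\times\mathcal C_2)\rtimes\mathcal C_2$, $4$, $8$; $16,8$. (II-8) $[16,3]$ same, $4$, $4,4$; $16,4,4$. (II-9) $[16,3]$ same, $4$, $4,4$; $8,8,4,4$. (II-10) $[16,11]$ $\mathcal D_4\times\mathcal C_2$, $4$, $4,4$; $16,4,4$. (II-11) $[16,11]$ $\mathcal D_4\times\mathcal C_2$, $4$, $2,2,2,2$; $8^2,2^4$. (II-12) $[8,3]$ $\mathcal D_4$, $L_{\mathbf a}=L_{\mathbf a'}$, $4,2,2$; $8,8,4,2,2$. (II-13) $[8,3]$ $\mathcal D_4$, $L_{\mathbf a}=L_{\mathbf a'}$, $2,2,2,1,1$; $8,4^2,2^3,1^2$. $(\mathcal D_4,\mathcal C_4)$: (II-14) $[32,25]$ $\mathcal D_4\times\mathcal C_4$, $=M$, $8$; $16,8$. (II-15) $[16,3]$ $(\mathcal C_4\times\mathcal C_2)\rtimes\mathcal C_2$, $2$, $4,4$; $16,4,4$. (II-16) $[16,3]$ same, $2$, $4,4$; $8,8,4,4$. (II-17) $[16,4]$ $\mathcal C_4\rtimes\mathcal C_4$, $2$, $8$; $16,8$. $(\mathcal D_4,\mathcal V_4)$: (II-18) $[32,46]$ $\mathcal D_4\times\mathcal V_4$, $=M$, $8$; $8,8,8$. (II-19) $[16,11]$ $\mathcal D_4\times\mathcal C_2$, $2$, $8$; $8,8,8$.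 (II-20) $[16,11]$ same, $2$, $8$; $8,8,4,4$. (II-21) $[16,11]$ same, $2$, $4,4$; $8,8,4,4$. (II-22) $[8,3]$ $\mathcal D_4$, $L_{\mathbf a}\supset L_{\mathbf a'}$, $8$; $8,4,4,4,4$. (II-23) $[8,3]$ $\mathcal D_4$, $L_{\mathbf a}\supset L_{\mathbf a'}$, $4,4$; $8,4,4,4,4$. $(\mathcal C_4,\mathcal C_4)$: (III-1) $[16,2]$ $\mathcal C_4\times\mathcal C_4$, $=M$, $4,4$; $16,4,4$. (III-2) $[8,2]$ $\mathcal C_4\times\mathcal C_2$, $2$, $2,2,2,2$; $8^2,2^4$. (III-3) $[4,1]$ $\mathcal C_4$, $L_{\mathbf a}=L_{\mathbf a'}$, $2^2,1^4$; $4^4,2^2,1^4$. $(\mathcal C_4,\mathcal V_4)$: (III-4) $[16,10]$ $\mathcal C_4\times\mathcal V_4$, $=M$, $8$; $8,8,8$. (III-5) $[8,2]$ $\mathcal C_4\times\mathcal C_2$, $2$, $8$; $8,8,4,4$. (III-6) $[8,2]$ same, $2$, $4,4$; $8,8,4,4$. $(\mathcal V_4,\mathcal C_4)$: (III-7) $[16,10]$ $\mathcal V_4\times\mathcal C_4$, $=M$, $8$; $8,8,8$. (III-8) $[8,2]$ $\mathcal C_2\times\mathcal C_4$, $2$, $8$; $8,8,4,4$. (III-9) $[8,2]$ same, $2$, $4,4$; $8,8,4,4$. $(\mathcal V_4,\mathcal V_4)$: (III-10) $[16,14]$ $\mathcal V_4\times\mathcal V_4$, $=M$, $4,4$; $4^6$.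 (III-11) $[8,5]$ $\mathcal V_4\times\mathcal C_2$, $2$, $4,4$; $4^4,2^4$. (III-12) $[8,5]$ same, $2$, $4,2,2$; $4^4,2^4$. (III-13) $[8,5]$ same, $2$, $2,2,2,2$; $4^4,2^4$. (III-14) $[4,2]$ $\mathcal V_4$, $L_{\mathbf a}=L_{\mathbf a'}$, $4,2,2$; $4^2,2^6,1^4$. (III-15) $[4,2]$ $\mathcal V_4$, $L_{\mathbf a}=L_{\mathbf a'}$, $2^2,1^4$; $4^2,2^6,1^4$.
   Context: $D_{\mathbf a}=16b(a^2-4b)^2$ is the discriminant of $X^4+aX^2+b$. $L_{\mathbf a}$ is the splitting field of $f_{\mathbf a}$ over $M$, $G_{\mathbf a}=\mathrm{Gal}(f_{\mathbf a}/M)$, $G_{\mathbf a,\mathbf a'}=\mathrm{Gal}(L_{\mathbf a}L_{\mathbf a'}/M)$; $\mathcal D_n,\mathcal C_n$ are dihedral of order $2n$ and cyclic of order $n$, $\mathcal V_4=\mathcal C_2\times\mathcal C_2$. Order the roots as $\alpha_1,\alpha_2,\alpha_3=-\alpha_1,\alpha_4=-\alpha_2$ of $f_{\mathbf a}$ and $\beta_1,\beta_2,\beta_3=-\beta_1,\beta_4=-\beta_2$ of $f_{\mathbf a'}$. Define $\mathcal R_{\mathbf a,\mathbf a'}(X)=\prod_{\pi\in\mathcal S_4}(X-\sum_{i}\alpha_i\beta_{\pi(i)})$ and $\mathcal R^1_{\mathbf a,\mathbf a'}(X)=\prod_{\pi\in D}(X-\sum_i\alpha_i\beta_{\pi(i)})$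 where $D=\langle(1234),(13)\rangle\le\mathcal S_4$. $G_{\mathbf a,\mathbf a'}$ acts on bijections $\varphi:\{\alpha_i\}\to\{\beta_j\}$ by $(\sigma\cdot\varphi)(\alpha)=\sigma(\varphi(\sigma^{-1}\alpha))$; the $8$ bijections $\alpha_i\mapsto\beta_{\pi(i)}$, $\pi\in D$ (those with $\varphi(-\alpha)=-\varphi(\alpha)$), form a stable subset. $\mathrm{DT}(\mathcal R_{\mathbf a,\mathbf a'})$ (resp. $\mathrm{DT}(\mathcal R^1_{\mathbf a,\mathbf a'})$) is the partition of $24$ (resp. $8$) given by orbit sizes on all $24$ bijections (resp. on these $8$); when the polynomial has no repeated factors it equals the multiset of degrees of its irreducible factors over $M$. Exponents denote repetition. *)

theory Defs
  imports "HOL-Algebra.Algebra"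
begin

section \<open>Model groups\<close>

text \<open>External semidirect product of N by H; \<theta> is meant to be a homomorphism from H into the
  automorphism group of N.\<close>

definition semidirect ::
    "('a, 'c) monoid_scheme \<Rightarrow> ('b, 'd) monoid_scheme \<Rightarrow> ('b \<Rightarrow> 'a \<Rightarrow> 'a) \<Rightarrow> ('a \<times> 'b) monoid" where
  "semidirect N H \<theta> =
     \<lparr>carrier = carrier N \<times> carrier H,
      monoid.mult = (\<lambda>(n, h) (n', h'). (n \<otimes>\<^bsub>N\<^esub> \<theta> h n', h \<otimes>\<^bsub>H\<^esub> h')),
      one = (\<one>\<^bsub>N\<^esub>, \<one>\<^bsub>H\<^esub>)\<rparr>"

text \<open>The action of a cyclic group of even order (elements are the residues \<open>0, 1, \<dots>\<close>) whose generator
  acts as the involution \<tau>.\<close>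

definition involution_action :: "('a \<Rightarrow> 'a) \<Rightarrow> int \<Rightarrow> 'a \<Rightarrow> 'a" where
  "involution_action \<tau> s x = (if even s then x else \<tau> x)"

abbreviation C2 :: "int monoid" where "C2 \<equiv> integer_mod_group 2"
abbreviation C4 :: "int monoid" where "C4 \<equiv> integer_mod_group 4"
abbreviation V4 :: "(int \<times> int) monoid" where "V4 \<equiv> C2 \<times>\<times> C2"

definition dihedral :: "nat \<Rightarrow> (int \<times> int) monoid" where
  "dihedral n = semidirect (integer_mod_group n) C2
     (involution_action (\<lambda>x. inv\<^bsub>integer_mod_group n\<^esub> x))"

abbreviation D4 :: "(int \<times> int) monoid" where "D4 \<equiv> dihedral 4"

text \<open>The name of a semidirect product does not determine the action. The following models are those
  with the GAP identifiers [32,27], [32,28], [32,34], [16,3] and [16,4]. The first is the wreath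
  product of V4 by C2 (exchange of the two factors); in the second, C2 inverts C4 and exchanges the
  two factors of V4; the third is the generalized dihedral group of \<open>C4 \<times> C4\<close>; the fourth is
  \<open>\<langle>x, y, c | x^4 = y^2 = c^2 = 1, xy = yx, cy = yc, cxc = xy\<rangle>\<close>.\<close>

definition SG_32_27 :: "(((int \<times> int) \<times> (int \<times> int)) \<times> int) monoid" where
  "SG_32_27 = semidirect (V4 \<times>\<times> V4) C2 (involution_action (\<lambda>(u, v). (v, u)))"

definition SG_32_28 :: "((int \<times> (int \<times> int)) \<times> int) monoid" where
  "SG_32_28 = semidirect (C4 \<times>\<times> V4) C2 (involution_action (\<lambda>(x, (y, z)). (inv\<^bsub>C4\<^esub> x, (z, y))))"

definition SG_32_34 :: "((int \<times> int) \<times> int) monoid" where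
  "SG_32_34 = semidirect (C4 \<times>\<times> C4) C2 (involution_action (\<lambda>(x, y). (inv\<^bsub>C4\<^esub> x, inv\<^bsub>C4\<^esub> y)))"

definition SG_16_3 :: "((int \<times> int) \<times> int) monoid" where
  "SG_16_3 = semidirect (C4 \<times>\<times> C2) C2 (involution_action (\<lambda>(x, y). (x, (x + y) mod 2)))"

definition SG_16_4 :: "(int \<times> int) monoid" where
  "SG_16_4 = semidirect C4 C4 (involution_action (\<lambda>x. inv\<^bsub>C4\<^esub> x))"


section \<open>Fields and Galois groups\<close>

text \<open>The additive order of the unit; \<^const>\<open>group.ord\<close> is 0 for elements of infinite order.\<close>

definition characteristic :: "('a, 'b) ring_scheme \<Rightarrow> nat" where
  "characteristic R = group.ord (add_monoid R) \<one>\<^bsub>R\<^esub>"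

text \<open>\<open>X^4 + a X^2 + b\<close>; polynomials are coefficient lists, leading coefficient first.\<close>

definition quartic :: "('a, 'b) ring_scheme \<Rightarrow> 'a \<Rightarrow> 'a \<Rightarrow> 'a list" where
  "quartic R a b = [\<one>\<^bsub>R\<^esub>, \<zero>\<^bsub>R\<^esub>, a, \<zero>\<^bsub>R\<^esub>, b]"

definition quartic_disc :: "('a, 'b) ring_scheme \<Rightarrow> 'a \<Rightarrow> 'a \<Rightarrow> 'a" where
  "quartic_disc R a b =
     ([(16::nat)] \<cdot>\<^bsub>R\<^esub> b) \<otimes>\<^bsub>R\<^esub> ((a [^]\<^bsub>R\<^esub> (2::nat)) \<ominus>\<^bsub>R\<^esub> ([(4::nat)] \<cdot>\<^bsub>R\<^esub> b)) [^]\<^bsub>R\<^esub> (2::nat)"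

definition root_set :: "('a, 'b) ring_scheme \<Rightarrow> 'a list \<Rightarrow> 'a set" where
  "root_set R f = {x. ring.is_root R f x}"

text \<open>The splitting field of f over the subfield M, formed inside a field R over which f splits.\<close>

definition splitting_field :: "('a, 'b) ring_scheme \<Rightarrow> 'a set \<Rightarrow> 'a list \<Rightarrow> 'a set" where
  "splitting_field R M f = generate_field R (M \<union> root_set R f)"

definition compositum :: "('a, 'b) ring_scheme \<Rightarrow> 'a set \<Rightarrow> 'a set \<Rightarrow> 'a set" where
  "compositum R E E' = generate_field R (E \<union> E')"

text \<open>The group of automorphisms of the subfield E of R that fix M pointwise. As in \<^const>\<open>BijGroup\<close>,
  automorphisms are taken to be \<^const>\<open>undefined\<close> outside E.\<close>

definition Gal :: "('a, 'b) ring_scheme \<Rightarrow> 'a set \<Rightarrow> 'a set \<Rightarrow> ('a \<Rightarrow> 'a) monoid" where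
  "Gal R E M = (BijGroup E)
     \<lparr>carrier := {\<sigma> \<in> Bij E. \<sigma> \<in> ring_iso (R\<lparr>carrier := E\<rparr>) (R\<lparr>carrier := E\<rparr>) \<and> (\<forall>x\<in>M. \<sigma> x = x)}\<rparr>"


section \<open>Decomposition types\<close>

text \<open>An ordering \<open>\<alpha> 1, \<alpha> 2, \<alpha> 3 = - \<alpha> 1, \<alpha> 4 = - \<alpha> 2\<close> of the roots of a quartic f. It requires four
  distinct roots in R, so it also says that f splits over R.\<close>

definition root_ordering :: "('a, 'b) ring_scheme \<Rightarrow> 'a list \<Rightarrow> (nat \<Rightarrow> 'a) \<Rightarrow> bool" where
  "root_ordering R f \<alpha> \<longleftrightarrow>
     bij_betw \<alpha> {1..4} (root_set R f) \<and> \<alpha> 3 = \<ominus>\<^bsub>R\<^esub> \<alpha> 1 \<and> \<alpha> 4 = \<ominus>\<^bsub>R\<^esub> \<alpha> 2"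

text \<open>The subgroup of the symmetric group on \<open>{1, 2, 3, 4}\<close> generated by \<open>(1234)\<close> and \<open>(13)\<close>.\<close>

definition dihedral_perms :: "(nat \<Rightarrow> nat) set" where
  "dihedral_perms = generate (sym_group 4) {cycle_of_list [1, 2, 3, 4], cycle_of_list [1, 3]}"

definition bijections :: "'a set \<Rightarrow> 'b set \<Rightarrow> ('a \<Rightarrow> 'b) set" where
  "bijections A B = {\<phi> \<in> A \<rightarrow>\<^sub>E B. bij_betw \<phi> A B}"

definition dihedral_bijections :: "(nat \<Rightarrow> 'a) \<Rightarrow> (nat \<Rightarrow> 'b) \<Rightarrow> ('a \<Rightarrow> 'b) set" where
  "dihedral_bijections \<alpha> \<beta> = {\<phi> \<in> bijections (\<alpha> ` {1..4}) (\<beta> ` {1..4}).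
     \<exists>\<pi>\<in>dihedral_perms. \<forall>i\<in>{1..4}. \<phi> (\<alpha> i) = \<beta> (\<pi> i)}"

text \<open>The action \<open>(\<sigma> \<cdot> \<phi>) x = \<sigma> (\<phi> (\<sigma>\<^sup>-\<^sup>1 x))\<close> on a set \<Phi> of functions with domain A.\<close>

definition conj_action ::
    "('a \<Rightarrow> 'a) monoid \<Rightarrow> 'a set \<Rightarrow> ('a \<Rightarrow> 'a) set \<Rightarrow> ('a \<Rightarrow> 'a) \<Rightarrow> ('a \<Rightarrow> 'a) \<Rightarrow> ('a \<Rightarrow> 'a)" where
  "conj_action G A \<Phi> = (\<lambda>\<sigma>. \<lambda>\<phi>\<in>\<Phi>. \<lambda>x\<in>A. \<sigma> (\<phi> ((inv\<^bsub>G\<^esub> \<sigma>) x)))"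

definition orbit_type ::
    "('a \<Rightarrow> 'a) monoid \<Rightarrow> 'a set \<Rightarrow> ('a \<Rightarrow> 'a) set \<Rightarrow> nat multiset" where
  "orbit_type G A \<Phi> = image_mset card (mset_set (orbits G \<Phi> (conj_action G A \<Phi>)))"

text \<open>The decomposition types of the resolvents \<open>\<R>\<close> (all 24 bijections of the roots) and \<open>\<R>\<^sup>1\<close>
  (the 8 bijections coming from \<^const>\<open>dihedral_perms\<close>).\<close>

definition DT_R :: "('a \<Rightarrow> 'a) monoid \<Rightarrow> (nat \<Rightarrow> 'a) \<Rightarrow> (nat \<Rightarrow> 'a) \<Rightarrow> nat multiset" where
  "DT_R G \<alpha> \<beta> = orbit_type G (\<alpha> ` {1..4}) (bijections (\<alpha> ` {1..4}) (\<beta> ` {1..4}))"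

definition DT_R1 :: "('a \<Rightarrow> 'a) monoid \<Rightarrow> (nat \<Rightarrow> 'a) \<Rightarrow> (nat \<Rightarrow> 'a) \<Rightarrow> nat multiset" where
  "DT_R1 G \<alpha> \<beta> = orbit_type G (\<alpha> ` {1..4}) (dihedral_bijections \<alpha> \<beta>)"

end

theory Submission
  imports Defs
begin

text \<open>Both quartics have roots \<open>x, y, -x, -y\<close>, so the Galois group of the compositum E embeds into pairs of
  signed permutations of two letters, a group of order 64. Its image H acts transitively on the roots of
  either quartic, because the quartics are irreducible. A subgroup H with these properties is determined
  by its first projection (one of three groups), by lifts of generators of this projection, and by its
  intersection with the second factor; there are only 72 possibilities with the required orders, and for
  each of them the isomorphism type and the orbits are computed. Since E is a tower of square roots,
  automorphisms extend step by step and every intermediate field of the tower is a fixed field; hence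
  the intersection of the splitting fields is the fixed field of a subgroup of H that can be read off,
  and Dedekind's theorem gives its degree along a chain of subgroups of index 2.\<close>

text \<open>Behind the enumeration is Goursat's lemma: H is given by the homomorphism from its first
  projection that sends g to the coset of its lifts modulo the kernel {q. (1, q) in H}. The abstract
  group does not determine the orbits: one and the same group occurs with several decomposition
  types, depending on how it sits among the pairs. Hence concrete subgroups are listed. The
  intersection of the two splitting fields is no member of the tower, so the tower does not give its
  degree. It is the fixed field of the product of the kernels of the two projections, and each step
  of index 2 above that subgroup doubles the degree; independence of homomorphisms supplies the
  element that is moved in such a step. Two devices keep the rest computable. Every element
  satisfies p^4 = 1, so cubes replace inverses. The bijection \<open>\<alpha> i\<close> to
  \<open>\<beta> (p i)\<close> is encoded by p, and the pair (g, h) sends p to h p g^-1.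
  Irreducibility enters as the fact that \<open>\<alpha> 1\<close> is not a root of a monic
  quadratic over M; as M is the fixed field of the whole group, this forces transitivity.\<close>

section \<open>Pairs of permutations of the roots\<close>

text \<open>\<open>I1, I2, I3, I4\<close> index the roots in the order \<open>x, y, -x, -y\<close>; a permutation is the list of its values.\<close>

datatype ix = I1 | I2 | I3 | I4
datatype perm4 = Perm4 ix ix ix ix

primrec perm_app :: "perm4 \<Rightarrow> ix \<Rightarrow> ix" where
  "perm_app (Perm4 a b c d) i = (case i of I1 \<Rightarrow> a | I2 \<Rightarrow> b | I3 \<Rightarrow> c | I4 \<Rightarrow> d)"

primrec perm_mult :: "perm4 \<Rightarrow> perm4 \<Rightarrow> perm4" where
  "perm_mult p (Perm4 a b c d) = Perm4 (perm_app p a) (perm_app p b) (perm_app p c) (perm_app p d)"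

abbreviation "r0 \<equiv> Perm4 I1 I2 I3 I4"

lemma perm_app_mult [simp]: "perm_app (perm_mult p q) i = perm_app p (perm_app q i)"
  by (cases q; cases i) simp_all

lemma perm_eqI: "(\<And>i. perm_app p i = perm_app q i) \<Longrightarrow> p = q"
  by (cases p; cases q) (metis ix.simps(13-16) perm_app.simps)

lemma perm_app_one [simp]: "perm_app r0 i = i"
  by (cases i) simp_all

lemma perm_mult_assoc: "perm_mult (perm_mult p q) r = perm_mult p (perm_mult q r)"
  by (rule perm_eqI) simp

lemma perm_mult_one [simp]: "perm_mult r0 p = p" "perm_mult p r0 = p"
  by (rule perm_eqI, simp only: perm_app_mult perm_app_one)+

type_synonym perm_pair = "perm4 \<times> perm4"

definition pp_mult :: "perm_pair \<Rightarrow> perm_pair \<Rightarrow> perm_pair" where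
  "pp_mult x y = (perm_mult (fst x) (fst y), perm_mult (snd x) (snd y))"

abbreviation "pp_one \<equiv> (r0, r0)"

lemma pp_mult_assoc: "pp_mult (pp_mult x y) z = pp_mult x (pp_mult y z)"
  by (simp add: pp_mult_def perm_mult_assoc)

lemma pp_mult_one [simp]: "pp_mult pp_one x = x" "pp_mult x pp_one = x"
  by (simp_all only: pp_mult_def fst_conv snd_conv perm_mult_one prod.collapse)

definition pp_group :: "perm_pair set \<Rightarrow> perm_pair monoid" where
  "pp_group H = \<lparr>carrier = H, monoid.mult = pp_mult, one = pp_one\<rparr>"

text \<open>The products \<open>g\<^sub>1^i\<^sub>1 \<cdot> \<dots> \<cdot> g\<^sub>r^i\<^sub>r\<close> with \<open>i\<^sub>j < n\<^sub>j\<close>, bracketed to the right.\<close>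

primrec translates :: "('b \<Rightarrow> 'b) \<Rightarrow> nat \<Rightarrow> 'b list \<Rightarrow> 'b list" where
  "translates f 0 w = []"
| "translates f (Suc n) w = w @ translates f n (map f w)"

fun normal_forms :: "('b \<Rightarrow> 'b \<Rightarrow> 'b) \<Rightarrow> 'b \<Rightarrow> ('b \<times> nat) list \<Rightarrow> 'b list" where
  "normal_forms f e [] = [e]"
| "normal_forms f e ((g, n) # gs) = translates (f g) n (normal_forms f e gs)"

lemma translates_invariant:
  assumes "\<And>x. P x \<Longrightarrow> P (h x)" and "\<forall>x\<in>set w. P x"
  shows "\<forall>x\<in>set (translates h n w). P x"
  using assms(2)
proof (induction n arbitrary: w)
  case (Suc n)
  have "\<forall>x\<in>set (map h w). P x" using Suc.prems assms(1) by auto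
  from Suc.IH[OF this] Suc.prems show ?case by auto
qed simp

text \<open>The induction principle for such lists: only left multiplication by a generator has to
  preserve P. Membership in a group or carrier and the existence of preimages are proved this
  way.\<close>

lemma normal_forms_invariant:
  assumes "\<And>g n x. (g, n) \<in> set gs \<Longrightarrow> P x \<Longrightarrow> P (f g x)" and "P e"
  shows "\<forall>x\<in>set (normal_forms f e gs). P x"
  using assms(1)
proof (induction gs)
  case Nil
  then show ?case by (simp add: assms(2))
next
  case (Cons a gs)
  obtain g n where a: "a = (g, n)" by (cases a)
  have "\<forall>x\<in>set (normal_forms f e gs). P x" using Cons by auto
  then show ?case unfolding a normal_forms.simps
    by (rule translates_invariant[rotated]) (use Cons.prems[of g n] a in auto)
qed

lemma map_translates:
  assumes "\<And>x. k (h x) = h' (k x)"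
  shows "map k (translates h n w) = translates h' n (map k w)"
proof (induction n arbitrary: w)
  case (Suc n)
  have "map k (map h w) = map h' (map k w)" by (simp add: assms)
  then show ?case by (simp only: translates.simps map_append Suc \<open>map k (map h w) = map h' (map k w)\<close>)
qed simp

text \<open>Applied with \<open>k = fst\<close>: the normal forms of lifted generators project to
  the normal forms of the generators.\<close>

lemma map_normal_forms:
  assumes "\<And>x y. k (f x y) = f' (k x) (k y)"
  shows "map k (normal_forms f e gs) = normal_forms f' (k e) (map (\<lambda>(g, n). (k g, n)) gs)"
proof (induction gs)
  case (Cons a gs)
  obtain g n where a: "a = (g, n)" by (cases a)
  show ?case using map_translates[of k "f g" "f' (k g)", OF assms] Cons by (simp add: a)
qed simp

section \<open>Certificates for isomorphisms with the model groups\<close>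

definition pair_mult :: "('b \<Rightarrow> 'b \<Rightarrow> 'b) \<Rightarrow> perm_pair \<times> 'b \<Rightarrow> perm_pair \<times> 'b \<Rightarrow> perm_pair \<times> 'b" where
  "pair_mult f x y = (pp_mult (fst x) (fst y), f (snd x) (snd y))"

text \<open>The graph of the prospective isomorphism: normal forms taken in the product of both
  groups pair elements that have the same exponents.\<close>

definition iso_graph ::
    "('b \<Rightarrow> 'b \<Rightarrow> 'b) \<Rightarrow> 'b \<Rightarrow> ('b \<times> nat) list \<Rightarrow> perm_pair list \<Rightarrow> (perm_pair \<times> 'b) list" where
  "iso_graph f e ms hs = normal_forms (pair_mult f) (pp_one, e) (map (\<lambda>(h, m, n). ((h, m), n)) (zip hs ms))"

text \<open>Here \<open>ms\<close> contains generators of the model with their exponent bounds and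
  \<open>hs\<close> their images. Multiplicativity is tested only with a generator as left factor,
  which keeps the evaluation short; distinct columns of the right length make the graph a
  bijection.\<close>

definition iso_check ::
    "('b \<Rightarrow> 'b \<Rightarrow> 'b) \<Rightarrow> 'b \<Rightarrow> ('b \<times> nat) list \<Rightarrow> perm_pair list \<Rightarrow> perm_pair list \<Rightarrow> bool" where
  "iso_check f e ms hs H \<longleftrightarrow> (let R = iso_graph f e ms hs; R1 = map fst R in
     distinct (map snd R) \<and> distinct R1 \<and> length R = prod_list (map snd ms) \<and>
     list_all (\<lambda>h. List.member H h) R1 \<and> list_all (\<lambda>h. List.member R1 h) H \<and>
     list_all (\<lambda>(h, m, n). list_all (\<lambda>(h', m'). map_of R (pp_mult h h') = Some (f m m')) R) (zip hs ms))"

text \<open>Products with a generator on the left determine all products: the right factor is fixed,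
  and the left factor is built up along its normal form by associativity on both sides. The check
  thereby also shows that H is closed under products.\<close>

lemma iso_check_correct:
  fixes K :: "'b monoid"
  assumes "monoid K" and f: "\<And>x y. x \<in> carrier K \<Longrightarrow> y \<in> carrier K \<Longrightarrow> x \<otimes>\<^bsub>K\<^esub> y = f x y"
    and e: "e = \<one>\<^bsub>K\<^esub>" and ms: "\<forall>(m, n)\<in>set ms. m \<in> carrier K"
    and card: "finite (carrier K)" "card (carrier K) = prod_list (map snd ms)"
    and check: "iso_check f e ms hs H"
  shows "pp_group (set H) \<cong> K"
proof -
  interpret K: monoid K by fact
  define R where "R = iso_graph f e ms hs"
  have c: "distinct (map snd R)" "distinct (map fst R)" "length R = card (carrier K)"
    "fst ` set R = set H"
    using check by (auto simp: iso_check_def R_def Let_def card list_all_iff)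
  have step: "map_of R (pp_mult h h') = Some (f m m')" if "(h, m, n) \<in> set (zip hs ms)" "(h', m') \<in> set R"
    for h h' m m' n
  proof -
    have "\<forall>(h, m, n)\<in>set (zip hs ms). \<forall>(h', m')\<in>set R. map_of R (pp_mult h h') = Some (f m m')"
      by (rule check[unfolded iso_check_def Let_def list_all_iff, folded R_def,
            THEN conjunct2, THEN conjunct2, THEN conjunct2, THEN conjunct2, THEN conjunct2])
    from bspec[OF bspec[OF this that(1), unfolded prod.case] that(2)] show ?thesis by simp
  qed
  have gens: "m \<in> carrier K" if "(h, m, n) \<in> set (zip hs ms)" for h m n
    using that ms by (auto dest: set_zip_rightD)
  have "\<forall>x\<in>set R. snd x \<in> carrier K"
    unfolding R_def iso_graph_def
  proof (rule normal_forms_invariant)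
    fix g n and x :: "perm_pair \<times> 'b"
    assume g: "(g, n) \<in> set (map (\<lambda>(h, m, n). ((h, m), n)) (zip hs ms))" and x: "snd x \<in> carrier K"
    then have "snd g \<in> carrier K" using gens by auto
    then show "snd (pair_mult f g x) \<in> carrier K"
      using K.m_closed[OF _ x] f[OF _ x] by (simp add: pair_mult_def)
  qed (simp add: e)
  moreover have "card (snd ` set R) = card (carrier K)"
    using c by (metis distinct_card length_map set_map)
  ultimately have carr: "snd ` set R = carrier K"
    using card(1) by (metis card_subset_eq image_subsetI)
  have RK: "m \<in> carrier K" if "(h, m) \<in> set R" for h m
    using that carr by force
  have prod: "(pp_mult h h', f m m') \<in> set R" if "(h, m) \<in> set R" "(h', m') \<in> set R" for h m h' m'
  proof -
    have "\<forall>x\<in>set R. x \<in> set R \<and> (pp_mult (fst x) h', f (snd x) m') \<in> set R"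
      unfolding R_def[unfolded iso_graph_def] 
    proof (rule normal_forms_invariant, unfold R_def[unfolded iso_graph_def, symmetric])
      fix g n x
      assume g: "(g, n) \<in> set (map (\<lambda>(h, m, n). ((h, m), n)) (zip hs ms))"
        and x: "x \<in> set R \<and> (pp_mult (fst x) h', f (snd x) m') \<in> set R"
      obtain h1 m1 where g1: "g = (h1, m1)" by (cases g)
      have z: "(h1, m1, n) \<in> set (zip hs ms)" using g g1 by auto
      have 1: "(pp_mult h1 (fst x), f m1 (snd x)) \<in> set R"
        by (rule map_of_SomeD, rule step[OF z]) (use x in simp)
      have 2: "(pp_mult h1 (pp_mult (fst x) h'), f m1 (f (snd x) m')) \<in> set R"
        by (rule map_of_SomeD, rule step[OF z]) (use x in simp)
      have "snd x \<in> carrier K" using x RK by (metis prod.collapse)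
      then have "f m1 (f (snd x) m') = f (f m1 (snd x)) m'"
        using gens[OF z] RK[OF that(2)] by (metis K.m_assoc K.m_closed f)
      then show "pair_mult f g x \<in> set R \<and>
         (pp_mult (fst (pair_mult f g x)) h', f (snd (pair_mult f g x)) m') \<in> set R"
        using 1 2 by (simp add: pair_mult_def g1 pp_mult_assoc)
    next
      have nn: "carrier K \<noteq> {}" using K.one_closed by blast
      then have "R \<noteq> []" using carr by auto
      \<comment> \<open>A single bound 0 would empty the whole list. The model is nonempty, so all
        bounds are positive, and the product with all exponents 0 is in the list; it starts the
        induction.\<close>
      have pos: "b \<in> set (normal_forms a b l)" if "normal_forms a b l \<noteq> []" for a :: "perm_pair \<times> 'b \<Rightarrow> perm_pair \<times> 'b \<Rightarrow> perm_pair \<times> 'b" and b l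
        using that
      proof (induction l)
        case (Cons c l)
        obtain g n where c: "c = (g, n)" by (cases c)
        have e1: "translates h n ([] :: (perm_pair \<times> 'b) list) = []" for h n by (induction n) auto
        obtain n' where n: "n = Suc n'" using Cons.prems c by (cases n) auto
        have "normal_forms a b l \<noteq> []" using Cons.prems e1[of "a g" n] unfolding c by force
        then have "b \<in> set (normal_forms a b l)" by (rule Cons.IH)
        then show ?case by (simp add: c n)
      qed simp
      have "(pp_one, e) \<in> set R"
        using pos \<open>R \<noteq> []\<close> unfolding R_def iso_graph_def by blast
      moreover have "f e m' = m'" using RK[OF that(2)] e f by (metis K.l_one K.one_closed)
      ultimately show "(pp_one, e) \<in> set R \<and> (pp_mult (fst (pp_one, e)) h', f (snd (pp_one, e)) m') \<in> set R"
        using that by simp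
    qed
    from bspec[OF this that(1)] show ?thesis by simp
  qed
  define \<phi> where "\<phi> h = the (map_of R h)" for h
  have \<phi>: "\<phi> h = m" if "(h, m) \<in> set R" for h m
    using that c(2) by (simp add: \<phi>_def)
  have "bij_betw \<phi> (set H) (carrier K)"
  proof -
    have "\<phi> ` fst ` set R = snd ` set R"
      unfolding image_image by (rule image_cong) (auto dest: \<phi>)
    moreover have "inj_on \<phi> (fst ` set R)"
    proof (rule inj_onI)
      fix x y assume "x \<in> fst ` set R" "y \<in> fst ` set R" and eq: "\<phi> x = \<phi> y"
      then obtain m m' where m: "(x, m) \<in> set R" "(y, m') \<in> set R" by force
      then have "m = m'" using eq \<phi> by blast
      then show "x = y" using m c(1) by (metis distinct_map inj_on_eq_iff prod.inject snd_conv)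
    qed
    ultimately show ?thesis by (simp add: bij_betw_def c(4)[symmetric] carr)
  qed
  moreover have "\<phi> \<in> hom (pp_group (set H)) K"
  proof (rule homI)
    fix x assume "x \<in> carrier (pp_group (set H))"
    then have "x \<in> fst ` set R" unfolding c(4) by (simp add: pp_group_def)
    then obtain m where "(x, m) \<in> set R" by auto
    then show "\<phi> x \<in> carrier K" using RK \<phi> by simp
  next
    fix x y assume "x \<in> carrier (pp_group (set H))" "y \<in> carrier (pp_group (set H))"
    then have "x \<in> fst ` set R" "y \<in> fst ` set R" unfolding c(4) by (simp_all add: pp_group_def)
    then obtain m m' where m: "(x, m) \<in> set R" "(y, m') \<in> set R" by auto
    show "\<phi> (x \<otimes>\<^bsub>pp_group (set H)\<^esub> y) = \<phi> x \<otimes>\<^bsub>K\<^esub> \<phi> y"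
      using \<phi>[OF m(1)] \<phi>[OF m(2)] \<phi>[OF prod[OF m]] f[OF RK[OF m(1)] RK[OF m(2)]]
      by (simp add: pp_group_def)
  qed
  ultimately show ?thesis by (auto simp: is_iso_def iso_def pp_group_def)
qed

section \<open>Model groups with computable multiplication\<close>

text \<open>The cyclic group acts through parity. Parity is well defined modulo an even n, and since
  \<tau> is an involution, sums of residues act by composition; associativity follows.\<close>

lemma semidirect_monoid:
  assumes "monoid N" and "\<tau> \<in> carrier N \<rightarrow> carrier N" and "\<tau> \<one>\<^bsub>N\<^esub> = \<one>\<^bsub>N\<^esub>"
    and hom: "\<And>x y. x \<in> carrier N \<Longrightarrow> y \<in> carrier N \<Longrightarrow> \<tau> (x \<otimes>\<^bsub>N\<^esub> y) = \<tau> x \<otimes>\<^bsub>N\<^esub> \<tau> y"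
    and inv: "\<And>x. x \<in> carrier N \<Longrightarrow> \<tau> (\<tau> x) = x"
    and n: "even n" "n > 0"
  shows "monoid (semidirect N (integer_mod_group n) (involution_action \<tau>))"
proof -
  interpret N: monoid N by fact
  interpret Z: group "integer_mod_group n" by simp
  have n0: "n \<noteq> 0" using n by simp
  have cl: "\<tau> x \<in> carrier N" if "x \<in> carrier N" for x using assms(2) that by auto
  have ev: "even ((x + y) mod int n) = (even x = even y)" for x y
    using n by (simp add: dvd_mod_iff)
  have act: "involution_action \<tau> s x \<in> carrier N" if "x \<in> carrier N" for s x
    using that cl by (simp add: involution_action_def)
  have comp: "involution_action \<tau> ((s + t) mod int n) x = involution_action \<tau> s (involution_action \<tau> t x)"
    if "x \<in> carrier N" for s t x
    using that by (auto simp: involution_action_def ev inv)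
  have mult: "involution_action \<tau> s (x \<otimes>\<^bsub>N\<^esub> y) = involution_action \<tau> s x \<otimes>\<^bsub>N\<^esub> involution_action \<tau> s y"
    if "x \<in> carrier N" "y \<in> carrier N" for s x y
    using that by (simp add: involution_action_def hom)
  show ?thesis
  proof (rule monoidI)
    fix x y z
    assume "x \<in> carrier (semidirect N (integer_mod_group n) (involution_action \<tau>))"
      "y \<in> carrier (semidirect N (integer_mod_group n) (involution_action \<tau>))"
      "z \<in> carrier (semidirect N (integer_mod_group n) (involution_action \<tau>))"
    then show "x \<otimes>\<^bsub>semidirect N (integer_mod_group n) (involution_action \<tau>)\<^esub> y \<otimes>\<^bsub>semidirect N (integer_mod_group n) (involution_action \<tau>)\<^esub> z =
      x \<otimes>\<^bsub>semidirect N (integer_mod_group n) (involution_action \<tau>)\<^esub> (y \<otimes>\<^bsub>semidirect N (integer_mod_group n) (involution_action \<tau>)\<^esub> z)"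
      by (cases x; cases y; cases z)
        (simp add: semidirect_def act comp mult N.m_assoc mod_add_left_eq mod_add_right_eq add.assoc)
  qed (auto simp: semidirect_def cl involution_action_def carrier_integer_mod_group n0 n(2) assms(3))
qed

text \<open>These three operations can be evaluated by \<open>code_simp\<close>, unlike the inverses
  in the definitions of the models. \<open>model_spec\<close> asks for agreement on the carriers,
  where the inverse in \<open>C4\<close> is - x mod 4.\<close>

definition cyclic_mult :: "int \<Rightarrow> int \<Rightarrow> int \<Rightarrow> int" where
  "cyclic_mult n x y = (x + y) mod n"

definition direct_mult :: "('x \<Rightarrow> 'x \<Rightarrow> 'x) \<Rightarrow> ('y \<Rightarrow> 'y \<Rightarrow> 'y) \<Rightarrow> 'x \<times> 'y \<Rightarrow> 'x \<times> 'y \<Rightarrow> 'x \<times> 'y" where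
  "direct_mult f g x y = (f (fst x) (fst y), g (snd x) (snd y))"

definition semidirect_mult ::
    "('x \<Rightarrow> 'x \<Rightarrow> 'x) \<Rightarrow> int \<Rightarrow> ('x \<Rightarrow> 'x) \<Rightarrow> 'x \<times> int \<Rightarrow> 'x \<times> int \<Rightarrow> 'x \<times> int" where
  "semidirect_mult f n \<tau> x y =
     (f (fst x) (if even (snd x) then fst y else \<tau> (fst y)), (snd x + snd y) mod n)"

definition model_spec :: "'x monoid \<Rightarrow> ('x \<Rightarrow> 'x \<Rightarrow> 'x) \<Rightarrow> 'x \<Rightarrow> nat \<Rightarrow> bool" where
  "model_spec K f e c \<longleftrightarrow> monoid K \<and> (\<forall>x\<in>carrier K. \<forall>y\<in>carrier K. x \<otimes>\<^bsub>K\<^esub> y = f x y) \<and>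
     e = \<one>\<^bsub>K\<^esub> \<and> finite (carrier K) \<and> card (carrier K) = c"

lemma model_cyclic:
  assumes "n > 0"
  shows "model_spec (integer_mod_group n) (cyclic_mult (int n)) 0 n"
  using assms by (simp add: model_spec_def cyclic_mult_def group.is_monoid carrier_integer_mod_group)

lemma model_direct:
  assumes "model_spec K f e c" and "model_spec K' f' e' c'"
  shows "model_spec (K \<times>\<times> K') (direct_mult f f') (e, e') (c * c')"
  using assms by (auto simp: model_spec_def direct_mult_def DirProd_monoid card_cartesian_product)

text \<open>The automorphism appears twice: \<open>\<tau>'\<close> as written in the definition of
  the model, \<tau> as a function that can be evaluated.\<close>

lemma model_semidirect:
  assumes N: "model_spec N f e c" and n: "even n" "n > 0"
    and \<tau>: "\<And>x. x \<in> carrier N \<Longrightarrow> \<tau> x \<in> carrier N" "\<tau> e = e"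
      "\<And>x y. x \<in> carrier N \<Longrightarrow> y \<in> carrier N \<Longrightarrow> \<tau> (f x y) = f (\<tau> x) (\<tau> y)"
      "\<And>x. x \<in> carrier N \<Longrightarrow> \<tau> (\<tau> x) = x" 
    and \<tau>': "\<And>x. x \<in> carrier N \<Longrightarrow> \<tau>' x = \<tau> x" 
  shows "model_spec (semidirect N (integer_mod_group n) (involution_action \<tau>'))
    (semidirect_mult f (int n) \<tau>) (e, 0) (c * n)"
proof -
  interpret N: monoid N using N by (simp add: model_spec_def)
  have "\<one>\<^bsub>N\<^esub> = e" using N by (simp add: model_spec_def)
  then have e: "e \<in> carrier N" using N.one_closed by simp
  have f: "x \<otimes>\<^bsub>N\<^esub> y = f x y" if "x \<in> carrier N" "y \<in> carrier N" for x y
    using that N by (simp add: model_spec_def)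
  have "monoid (semidirect N (integer_mod_group n) (involution_action \<tau>'))"
  proof (rule semidirect_monoid)
    show "monoid N" by unfold_locales
    fix x y assume "x \<in> carrier N" "y \<in> carrier N"
    then show "\<tau>' (x \<otimes>\<^bsub>N\<^esub> y) = \<tau>' x \<otimes>\<^bsub>N\<^esub> \<tau>' y"
      using N.m_closed[of x y] by (simp add: \<tau> \<tau>' f)
  qed (auto simp: \<open>\<one>\<^bsub>N\<^esub> = e\<close> \<tau> \<tau>' n e)
  moreover have "carrier (semidirect N (integer_mod_group n) (involution_action \<tau>')) =
      carrier N \<times> {0..<int n}"
    using n by (simp add: semidirect_def carrier_integer_mod_group)
  ultimately show ?thesis
    using N by (auto simp: model_spec_def semidirect_def semidirect_mult_def involution_action_def
        f \<tau> \<tau>' card_cartesian_product)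
qed

abbreviation "c2m \<equiv> cyclic_mult 2"
abbreviation "c4m \<equiv> cyclic_mult 4"
abbreviation "v4m \<equiv> direct_mult c2m c2m"
abbreviation "d4m \<equiv> semidirect_mult c4m 2 (\<lambda>x. - x mod 4)"

lemma model_C2: "model_spec C2 c2m 0 2" and model_C4: "model_spec C4 c4m 0 4"
  using model_cyclic[of 2] model_cyclic[of 4] by simp_all

lemma model_V4: "model_spec V4 v4m (0, 0) 4"
  using model_direct[OF model_C2 model_C2] by simp

lemma inv_C4: "x \<in> carrier C4 \<Longrightarrow> inv\<^bsub>C4\<^esub> x = - x mod 4"
  by simp

lemma minus_mod4: "- (- x mod 4) mod 4 = x" if "0 \<le> x" "x < 4" for x :: int
  using that by (simp add: mod_minus_eq)

lemma minus_add_mod4: "- ((x + y) mod 4) mod 4 = (- x mod 4 + - y mod 4) mod 4" for x y :: int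
  by (simp add: mod_minus_eq mod_add_eq)

lemma model_D4: "model_spec D4 d4m (0, 0) 8"
  using model_semidirect[OF model_C4, of 2 "\<lambda>x. - x mod 4" "\<lambda>x. inv\<^bsub>C4\<^esub> x"]
  unfolding dihedral_def
  by (simp add: inv_C4 cyclic_mult_def carrier_integer_mod_group minus_mod4 minus_add_mod4)

lemma model_SG_16_4: "model_spec SG_16_4 (semidirect_mult c4m 4 (\<lambda>x. - x mod 4)) (0, 0) 16"
  using model_semidirect[OF model_C4, of 4 "\<lambda>x. - x mod 4" "\<lambda>x. inv\<^bsub>C4\<^esub> x"]
  unfolding SG_16_4_def
  by (simp add: inv_C4 cyclic_mult_def carrier_integer_mod_group minus_mod4 minus_add_mod4)

lemma model_SG_32_34: "model_spec SG_32_34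
    (semidirect_mult (direct_mult c4m c4m) 2 (\<lambda>x. (- fst x mod 4, - snd x mod 4))) ((0, 0), 0) 32"
  using model_semidirect[OF model_direct[OF model_C4 model_C4], of 2
      "\<lambda>x. (- fst x mod 4, - snd x mod 4)" "\<lambda>(x, y). (inv\<^bsub>C4\<^esub> x, inv\<^bsub>C4\<^esub> y)"]
  unfolding SG_32_34_def
  by (simp add: case_prod_beta inv_C4 cyclic_mult_def direct_mult_def carrier_integer_mod_group
      minus_mod4 minus_add_mod4 mem_Times_iff)

lemma model_SG_32_28: "model_spec SG_32_28 (semidirect_mult (direct_mult c4m v4m) 2
      (\<lambda>x. (- fst x mod 4, snd (snd x), fst (snd x)))) ((0, 0, 0), 0) 32"
  using model_semidirect[OF model_direct[OF model_C4 model_V4], of 2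
      "\<lambda>x. (- fst x mod 4, snd (snd x), fst (snd x))" "\<lambda>(x, (y, z)). (inv\<^bsub>C4\<^esub> x, (z, y))"]
  unfolding SG_32_28_def
  by (simp add: case_prod_beta inv_C4 cyclic_mult_def direct_mult_def carrier_integer_mod_group
      minus_mod4 minus_add_mod4 mem_Times_iff)

lemma model_SG_32_27: "model_spec SG_32_27 (semidirect_mult (direct_mult v4m v4m) 2
      (\<lambda>x. (snd x, fst x))) (((0, 0), (0, 0)), 0) 32"
  using model_semidirect[OF model_direct[OF model_V4 model_V4], of 2
      "\<lambda>x. (snd x, fst x)" "\<lambda>(x, y). (y, x)"]
  unfolding SG_32_27_def
  by (simp add: case_prod_beta cyclic_mult_def direct_mult_def carrier_integer_mod_group mem_Times_iff)

text \<open>The twist adds the parity of the \<open>C4\<close> coordinate to the \<open>C2\<close>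
  coordinate. It respects addition because reduction modulo 4 preserves parity, and it is an
  involution because the parity is added twice.\<close>

lemma model_SG_16_3: "model_spec SG_16_3 (semidirect_mult (direct_mult c4m c2m) 2
      (\<lambda>x. (fst x, (fst x + snd x) mod 2))) ((0, 0), 0) 16"
proof -
  have "model_spec (semidirect (C4 \<times>\<times> C2) (integer_mod_group 2) (involution_action (\<lambda>(x, y). (x, (x + y) mod 2))))
      (semidirect_mult (direct_mult c4m c2m) (int 2) (\<lambda>x. (fst x, (fst x + snd x) mod 2))) ((0, 0), 0) (4 * 2 * 2)"
  proof (rule model_semidirect[OF model_direct[OF model_C4 model_C2]])
    fix x y :: "int \<times> int"
    have "((x1 + y1) mod 4 + (x2 + y2) mod 2) mod 2 = ((x1 + x2) mod 2 + (y1 + y2) mod 2) mod 2"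
      for x1 x2 y1 y2 :: int
    proof -
      have *: "a mod 4 mod 2 = a mod 2" for a :: int by (simp add: mod_mod_cancel)
      have "(a mod 4 + b mod 2) mod 2 = (a + b) mod 2" for a b :: int
        using mod_add_eq[of "a mod 4" 2 "b mod 2"] mod_add_eq[of a 2 b] by (simp add: *)
      then show ?thesis unfolding mod_add_eq by (simp add: ac_simps)
    qed
    then show "(fst (direct_mult c4m c2m x y), (fst (direct_mult c4m c2m x y) + snd (direct_mult c4m c2m x y)) mod 2) =
       direct_mult c4m c2m (fst x, (fst x + snd x) mod 2) (fst y, (fst y + snd y) mod 2)"
      by (simp only: cyclic_mult_def direct_mult_def fst_conv snd_conv)
  next
    fix x assume "x \<in> carrier (C4 \<times>\<times> C2)"
    then have "0 \<le> snd x" "snd x < 2" by (auto simp: carrier_integer_mod_group)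
    then have "(fst x + (fst x + snd x) mod 2) mod 2 = snd x" by presburger
    then show "(fst (fst x, (fst x + snd x) mod 2), (fst (fst x, (fst x + snd x) mod 2) +
        snd (fst x, (fst x + snd x) mod 2)) mod 2) = x" by simp
  qed (auto simp: carrier_integer_mod_group)
  then show ?thesis by (simp add: SG_16_3_def)
qed

section \<open>The finite list of subgroups\<close>

text \<open>With the roots x, y, -x, -y at the corners of a square, \<open>r1\<close>,
  \<open>r2\<close>, \<open>r3\<close> are the rotations by 1, 2, 3 steps, and each reflection
  \<open>s1\<close>, \<open>s2\<close>, \<open>s3\<close> is the rotation of the same index after
  \<open>s0\<close>. In terms of signs, \<open>s0\<close> negates x alone, \<open>s2\<close> negates
  y alone, \<open>r2\<close> negates both, and \<open>s3\<close> exchanges x and y.\<close>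

abbreviation "s2 \<equiv> Perm4 I1 I4 I3 I2"
abbreviation "s3 \<equiv> Perm4 I2 I1 I4 I3"
abbreviation "r1 \<equiv> Perm4 I2 I3 I4 I1"
abbreviation "s0 \<equiv> Perm4 I3 I2 I1 I4"
abbreviation "r2 \<equiv> Perm4 I3 I4 I1 I2"
abbreviation "r3 \<equiv> Perm4 I4 I1 I2 I3"
abbreviation "s1 \<equiv> Perm4 I4 I3 I2 I1"

text \<open>The entries are in lexicographic order of their values. The order matters: subgroups are
  subsequences of this list, and a coset is represented by its first entry here.\<close>

definition d8 :: "perm4 list" where
  "d8 = [r0, s2, s3, r1, s0, r2, r3, s1]"

definition s4 :: "perm4 list" where
  "s4 = concat (map (\<lambda>a. concat (map (\<lambda>b. concat (map (\<lambda>c. concat (map (\<lambda>d.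
     if distinct [a, b, c, d] then [Perm4 a b c d] else []) [I1, I2, I3, I4])) [I1, I2, I3, I4])) [I1, I2, I3, I4])) [I1, I2, I3, I4])"

text \<open>The group of signed permutations has exactly three transitive subgroups; they are isomorphic to
  D4, C4 and V4.\<close>

datatype gal_type = TD | TC | TV

primrec type_gens :: "gal_type \<Rightarrow> (perm4 \<times> nat) list" where
  "type_gens TD = [(r1, 4), (s0, 2)]"
| "type_gens TC = [(r1, 4)]"
| "type_gens TV = [(s3, 2), (r2, 2)]"

definition type_elems :: "gal_type \<Rightarrow> perm4 list" where
  "type_elems t = normal_forms perm_mult r0 (type_gens t)"

definition lift_gens :: "gal_type \<Rightarrow> perm4 list \<Rightarrow> (perm_pair \<times> nat) list" where
  "lift_gens t xs = map (\<lambda>((g, n), x). ((g, x), n)) (zip (type_gens t) xs)"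

text \<open>The subgroup of pairs that is generated by the pairs \<open>(g\<^sub>j, x\<^sub>j)\<close>, \<open>g\<^sub>j\<close> the generators of type t,
  and by \<open>{1} \<times> N\<close>, provided that \<open>g\<^sub>j \<mapsto> x\<^sub>j N\<close> defines a homomorphism.\<close>

definition lift_group :: "gal_type \<Rightarrow> perm4 list \<Rightarrow> perm4 list \<Rightarrow> perm_pair list" where
  "lift_group t xs N = concat (map (\<lambda>h. map (\<lambda>n. pp_mult h (r0, n)) N)
     (normal_forms pp_mult pp_one (lift_gens t xs)))"

datatype model = MD4D4 | M32_27 | M32_28 | M32_34 | M16_3 | M16_4 | MD4C4 | MD4V4 | MD4C2 | MD4 | MC4C4 | MC4C2 | MC2C4 | MC4 | MC4V4 | MV4C4 | MV4V4 | MV4C2 | MV4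

text \<open>The generators of each model are ordered so that the products of their powers run
  through the model without repetition; the exponent bounds multiply to its order.\<close>

fun model_check :: "model \<Rightarrow> perm_pair list \<Rightarrow> perm_pair list \<Rightarrow> bool" where
  "model_check MD4D4 = iso_check (direct_mult d4m d4m) ((0, 0), (0, 0))
     [(((1, 0), (0, 0)), 4), (((0, 1), (0, 0)), 2), (((0, 0), (1, 0)), 4), (((0, 0), (0, 1)), 2)]"
| "model_check M32_27 = iso_check (semidirect_mult (direct_mult v4m v4m) 2 (\<lambda>x. (snd x, fst x))) (((0, 0), (0, 0)), 0)
     [((((1, 0), (0, 0)), 0), 2), ((((0, 1), (0, 0)), 0), 2), ((((0, 0), (1, 0)), 0), 2), ((((0, 0), (0, 1)), 0), 2), ((((0, 0), (0, 0)), 1), 2)]"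
| "model_check M32_28 = iso_check (semidirect_mult (direct_mult c4m v4m) 2 (\<lambda>x. (- fst x mod 4, snd (snd x), fst (snd x)))) ((0, (0, 0)), 0)
     [(((1, (0, 0)), 0), 4), (((0, (1, 0)), 0), 2), (((0, (0, 1)), 0), 2), (((0, (0, 0)), 1), 2)]"
| "model_check M32_34 = iso_check (semidirect_mult (direct_mult c4m c4m) 2 (\<lambda>x. (- fst x mod 4, - snd x mod 4))) ((0, 0), 0)
     [(((1, 0), 0), 4), (((0, 1), 0), 4), (((0, 0), 1), 2)]"
| "model_check M16_3 = iso_check (semidirect_mult (direct_mult c4m c2m) 2 (\<lambda>x. (fst x, (fst x + snd x) mod 2))) ((0, 0), 0)
     [(((1, 0), 0), 4), (((0, 1), 0), 2), (((0, 0), 1), 2)]"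
| "model_check M16_4 = iso_check (semidirect_mult c4m 4 (\<lambda>x. - x mod 4)) (0, 0)
     [((1, 0), 4), ((0, 1), 4)]"
| "model_check MD4C4 = iso_check (direct_mult d4m c4m) ((0, 0), 0)
     [(((1, 0), 0), 4), (((0, 1), 0), 2), (((0, 0), 1), 4)]"
| "model_check MD4V4 = iso_check (direct_mult d4m v4m) ((0, 0), (0, 0))
     [(((1, 0), (0, 0)), 4), (((0, 1), (0, 0)), 2), (((0, 0), (1, 0)), 2), (((0, 0), (0, 1)), 2)]"
| "model_check MD4C2 = iso_check (direct_mult d4m c2m) ((0, 0), 0)
     [(((1, 0), 0), 4), (((0, 1), 0), 2), (((0, 0), 1), 2)]"
| "model_check MD4 = iso_check (d4m) (0, 0)
     [((1, 0), 4), ((0, 1), 2)]"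
| "model_check MC4C4 = iso_check (direct_mult c4m c4m) (0, 0)
     [((1, 0), 4), ((0, 1), 4)]"
| "model_check MC4C2 = iso_check (direct_mult c4m c2m) (0, 0)
     [((1, 0), 4), ((0, 1), 2)]"
| "model_check MC2C4 = iso_check (direct_mult c2m c4m) (0, 0)
     [((1, 0), 2), ((0, 1), 4)]"
| "model_check MC4 = iso_check (c4m) 0
     [(1, 4)]"
| "model_check MC4V4 = iso_check (direct_mult c4m v4m) (0, (0, 0))
     [((1, (0, 0)), 4), ((0, (1, 0)), 2), ((0, (0, 1)), 2)]"
| "model_check MV4C4 = iso_check (direct_mult v4m c4m) ((0, 0), 0)
     [(((1, 0), 0), 2), (((0, 1), 0), 2), (((0, 0), 1), 4)]"
| "model_check MV4V4 = iso_check (direct_mult v4m v4m) ((0, 0), (0, 0))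
     [(((1, 0), (0, 0)), 2), (((0, 1), (0, 0)), 2), (((0, 0), (1, 0)), 2), (((0, 0), (0, 1)), 2)]"
| "model_check MV4C2 = iso_check (direct_mult v4m c2m) ((0, 0), 0)
     [(((1, 0), 0), 2), (((0, 1), 0), 2), (((0, 0), 1), 2)]"
| "model_check MV4 = iso_check (v4m) (0, 0)
     [((1, 0), 2), ((0, 1), 2)]"

text \<open>The cube of \<open>fst h\<close> stands for its inverse: signed permutations of two letters satisfy \<open>p^4 = 1\<close>.\<close>

definition pp_conj :: "perm_pair \<Rightarrow> perm4 \<Rightarrow> perm4" where
  "pp_conj h x = perm_mult (snd h) (perm_mult x (perm_mult (fst h) (perm_mult (fst h) (fst h))))"

fun orbit_list :: "perm_pair list \<Rightarrow> perm4 list \<Rightarrow> perm4 list list" where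
  "orbit_list H [] = []"
| "orbit_list H (x # xs) = (let xo = remdups (map (\<lambda>h. pp_conj h x) H) in
     xo # orbit_list H (filter (\<lambda>y. \<not> List.member xo y) xs))"

text \<open>\<open>Proper\<close> stands for the second field lying strictly inside the first. The
  opposite inclusion is excluded by the comparison of the orders of the Galois groups.\<close>

datatype relation = Trivial | Degree2 | Degree4 | Proper | Equal

text \<open>The position of the two splitting fields in terms of the group H of the compositum. Here N is the
  set of all q with \<open>(1, q)\<close> in H, so the filtered list K is the subgroup that fixes the intersection
  of the two fields; c contains representatives that extend K to H in steps of index 2.\<close>

fun relation_check :: "relation \<Rightarrow> perm_pair list \<Rightarrow> perm4 list \<Rightarrow> perm_pair list \<Rightarrow> bool" where
  "relation_check Trivial c N H = list_all (\<lambda>h. List.member N (snd h)) H"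
| "relation_check Degree2 c N H = (let K = filter (\<lambda>h. List.member N (snd h)) H; a = hd c in
     List.member H a \<and> \<not> List.member K a \<and>
     list_all (\<lambda>h. List.member K h \<or> List.member (map (pp_mult a) K) h) H)"
| "relation_check Degree4 c N H = (let K = filter (\<lambda>h. List.member N (snd h)) H; a = hd c; b = hd (tl c);
       K2 = K @ map (pp_mult a) K in
     List.member H a \<and> \<not> List.member K a \<and> list_all (\<lambda>x. list_all (\<lambda>y. List.member K2 (pp_mult x y)) K2) K2 \<and>
     List.member H b \<and> \<not> List.member K2 b \<and>
     list_all (\<lambda>h. List.member K2 h \<or> List.member (map (pp_mult b) K2) h) H)"
| "relation_check Proper c N H = (list_all (\<lambda>h. fst h = r0 \<longrightarrow> snd h = r0) H \<and>
     list_ex (\<lambda>h. snd h = r0 \<and> fst h \<noteq> r0) H)"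
| "relation_check Equal c N H = list_all (\<lambda>h. (fst h = r0) = (snd h = r0)) H"

type_synonym key = "gal_type \<times> perm4 list \<times> perm4 list"
type_synonym row = "gal_type \<times> gal_type \<times> model \<times> relation \<times> nat list \<times> nat list"

definition same_elems :: "'x list \<Rightarrow> 'x list \<Rightarrow> bool" where
  "same_elems xs ys \<longleftrightarrow> list_all (List.member ys) xs \<and> list_all (List.member xs) ys"

text \<open>Only the second projection is compared with a list of elements: the first one is that of
  t by the construction of the lifts, and \<open>subgroup_cover\<close> supplies it. Orbit sizes are
  sorted decreasingly, as in the rows.\<close>

fun row_check :: "key \<times> row \<times> perm_pair list \<times> perm_pair list \<Rightarrow> bool" where
  "row_check ((t, xs, N), (t1, t2, m, rel, d1, d), ws, c) = (let H = lift_group t xs N in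
     t1 = t \<and> same_elems (map snd H) (type_elems t2) \<and> relation_check rel c N H \<and>
     rev (sort (map length (orbit_list H d8))) = d1 \<and>
     rev (sort (map length (orbit_list H s4))) = d \<and> model_check m ws H)"

text \<open>Each entry consists of a subgroup, its row, the images of the standard generators of the model
  group, and elements that generate a chain of subgroups of index 2.\<close>

definition subgroup_table :: "(key \<times> row \<times> perm_pair list \<times> perm_pair list) list" where
  "subgroup_table = [
    ((TD, [s3, r2], [r0]), (TD, TV, MD4, Proper, [4, 4], [8, 4, 4, 4, 4]),
      [(r1, s3), (s0, r2)], [(s0, r2), (r1, s3)]),
    ((TD, [s3, s1], [r0]), (TD, TV, MD4, Proper, [8], [8, 4, 4, 4, 4]),
      [(r1, s3), (s0, s1)], [(s0, s1), (r1, s3)]),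
    ((TD, [r1, s2], [r0]), (TD, TD, MD4, Equal, [2, 2, 2, 1, 1], [8, 4, 4, 2, 2, 2, 1, 1]),
      [(r1, r1), (s0, s2)], []),
    ((TD, [r1, s3], [r0]), (TD, TD, MD4, Equal, [4, 2, 2], [8, 8, 4, 2, 2]),
      [(r1, r1), (s0, s3)], []),
    ((TD, [r1, s0], [r0]), (TD, TD, MD4, Equal, [2, 2, 2, 1, 1], [8, 4, 4, 2, 2, 2, 1, 1]),
      [(r1, r1), (s0, s0)], []),
    ((TD, [r1, s1], [r0]), (TD, TD, MD4, Equal, [4, 2, 2], [8, 8, 4, 2, 2]),
      [(r1, r1), (s0, s1)], []),
    ((TD, [r2, s3], [r0]), (TD, TV, MD4, Proper, [4, 4], [8, 4, 4, 4, 4]),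
      [(r1, r2), (s0, s3)], [(s0, s3), (r1, r2)]),
    ((TD, [r2, s1], [r0]), (TD, TV, MD4, Proper, [4, 4], [8, 4, 4, 4, 4]),
      [(r1, r2), (s0, s1)], [(s0, s1), (r1, r2)]),
    ((TD, [r3, s2], [r0]), (TD, TD, MD4, Equal, [2, 2, 2, 1, 1], [8, 4, 4, 2, 2, 2, 1, 1]),
      [(r1, r3), (s0, s2)], []),
    ((TD, [r3, s3], [r0]), (TD, TD, MD4, Equal, [4, 2, 2], [8, 8, 4, 2, 2]),
      [(r1, r3), (s0, s3)], []),
    ((TD, [r3, s0], [r0]), (TD, TD, MD4, Equal, [2, 2, 2, 1, 1], [8, 4, 4, 2, 2, 2, 1, 1]),
      [(r1, r3), (s0, s0)], []),
    ((TD, [r3, s1], [r0]), (TD, TD, MD4, Equal, [4, 2, 2], [8, 8, 4, 2, 2]),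
      [(r1, r3), (s0, s1)], []),
    ((TD, [s1, s3], [r0]), (TD, TV, MD4, Proper, [8], [8, 4, 4, 4, 4]),
      [(r1, s1), (s0, s3)], [(s0, s3), (r1, s1)]),
    ((TD, [s1, r2], [r0]), (TD, TV, MD4, Proper, [4, 4], [8, 4, 4, 4, 4]),
      [(r1, s1), (s0, r2)], [(s0, r2), (r1, s1)]),
    ((TD, [r0, r2], [r0, s3]), (TD, TV, MD4C2, Degree2, [8], [8, 8, 4, 4]),
      [(r1, r0), (s0, r2), (r0, s3)], [(s0, r2)]),
    ((TD, [r2, r0], [r0, s3]), (TD, TV, MD4C2, Degree2, [8], [8, 8, 4, 4]),
      [(r1, r2), (s0, r0), (r0, s3)], [(r1, r2)]),
    ((TD, [r2, r2], [r0, s3]), (TD, TV, MD4C2, Degree2, [8], [8, 8, 8]),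
      [(r1, r2), (s0, r2), (r0, s3)], [(s0, r2)]),
    ((TD, [r0, s3], [r0, r2]), (TD, TV, MD4C2, Degree2, [4, 4], [8, 8, 4, 4]),
      [(r1, r0), (s0, s3), (r0, r2)], [(s0, s3)]),
    ((TD, [r0, r1], [r0, r2]), (TD, TC, M16_4, Degree2, [8], [16, 8]),
      [(r1, r0), (s0, r1)], [(s0, r1)]),
    ((TD, [s2, s3], [r0, r2]), (TD, TD, M16_3, Degree4, [8], [16, 8]),
      [(r1, s2), (r2, r2), (s0, s3)], [(s0, s3), (r1, s2)]),
    ((TD, [s2, r1], [r0, r2]), (TD, TD, M16_3, Degree4, [4, 4], [8, 8, 4, 4]),
      [(s0, r1), (r2, r2), (s1, s1)], [(s0, r1), (r1, s2)]),
    ((TD, [s3, r0], [r0, r2]), (TD, TV, MD4C2, Degree2, [4, 4], [8, 8, 4, 4]),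
      [(r1, s3), (s0, r0), (r0, r2)], [(r1, s3)]),
    ((TD, [s3, s2], [r0, r2]), (TD, TD, M16_3, Degree4, [4, 4], [16, 4, 4]),
      [(r1, s3), (r2, r2), (s0, s2)], [(s0, s2), (r1, s3)]),
    ((TD, [s3, s3], [r0, r2]), (TD, TV, MD4C2, Degree2, [8], [8, 8, 8]),
      [(r1, s3), (s0, s3), (r0, r2)], [(s0, s3)]),
    ((TD, [s3, r1], [r0, r2]), (TD, TD, M16_3, Degree4, [8], [16, 8]),
      [(s0, r1), (r2, r2), (s1, s2)], [(s0, r1), (r1, s3)]),
    ((TD, [r1, r0], [r0, r2]), (TD, TC, M16_3, Degree2, [4, 4], [16, 4, 4]),
      [(r1, r1), (r2, r0), (s0, r0)], [(r1, r1)]),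
    ((TD, [r1, s2], [r0, r2]), (TD, TD, MD4C2, Degree4, [2, 2, 2, 2], [8, 8, 2, 2, 2, 2]),
      [(r1, r1), (s0, s2), (r0, r2)], [(s0, s2), (r1, r1)]),
    ((TD, [r1, s3], [r0, r2]), (TD, TD, MD4C2, Degree4, [4, 4], [16, 4, 4]),
      [(r1, r1), (s0, s3), (r0, r2)], [(s0, s3), (r1, r1)]),
    ((TD, [r1, r1], [r0, r2]), (TD, TC, M16_3, Degree2, [4, 4], [8, 8, 4, 4]),
      [(s0, r1), (r2, r0), (s1, r2)], [(s0, r1)]),
    ((TD, [r0, s3], [r0, s2, s0, r2]), (TD, TD, M32_28, Degree2, [8], [16, 8]),
      [(r1, r0), (r0, s2), (r0, s0), (s0, s3)], [(s0, s3)]),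
    ((TD, [s3, r0], [r0, s2, s0, r2]), (TD, TD, M32_27, Degree2, [4, 4], [16, 4, 4]),
      [(r0, s2), (s0, r0), (r0, s0), (s2, r0), (s1, s3)], [(r1, s3)]),
    ((TD, [s3, s3], [r0, s2, s0, r2]), (TD, TD, M32_27, Degree2, [8], [16, 8]),
      [(r0, s2), (s1, r0), (r0, s0), (s3, r0), (s0, s3)], [(s0, s3)]),
    ((TD, [r0, r0], [r0, r1, r2, r3]), (TD, TC, MD4C4, Trivial, [8], [16, 8]),
      [(r1, r0), (s0, r0), (r0, r1)], []),
    ((TD, [r0, s2], [r0, r1, r2, r3]), (TD, TD, M32_34, Degree2, [4, 4], [16, 4, 4]),
      [(r0, r1), (r1, r0), (s0, s2)], [(s0, s2)]),
    ((TD, [s2, r0], [r0, r1, r2, r3]), (TD, TD, M32_28, Degree2, [8], [16, 8]),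
      [(r0, r1), (s0, r0), (s2, r0), (s1, s2)], [(r1, s2)]),
    ((TD, [s2, s2], [r0, r1, r2, r3]), (TD, TD, M32_28, Degree2, [8], [16, 8]),
      [(r0, r1), (s1, r0), (s3, r0), (s0, s2)], [(s0, s2)]),
    ((TD, [r0, s3], [r0, s1]), (TD, TV, MD4C2, Degree2, [8], [8, 8, 4, 4]),
      [(r1, r0), (s0, s3), (r0, s1)], [(s0, s3)]),
    ((TD, [s3, r0], [r0, s1]), (TD, TV, MD4C2, Degree2, [8], [8, 8, 4, 4]),
      [(r1, s3), (s0, r0), (r0, s1)], [(r1, s3)]),
    ((TD, [s3, s3], [r0, s1]), (TD, TV, MD4C2, Degree2, [8], [8, 8, 8]),
      [(r1, s3), (s0, s3), (r0, s1)], [(s0, s3)]),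
    ((TD, [r0, r0], [r0, s3, r2, s1]), (TD, TV, MD4V4, Trivial, [8], [8, 8, 8]),
      [(r1, r0), (s0, r0), (r0, s3), (r0, r2)], []),
    ((TD, [r0, s2], [r0, s3, r2, s1]), (TD, TD, M32_28, Degree2, [8], [16, 8]),
      [(r1, r0), (r0, s3), (r0, s1), (s0, s2)], [(s0, s2)]),
    ((TD, [s2, r0], [r0, s3, r2, s1]), (TD, TD, M32_27, Degree2, [8], [16, 8]),
      [(r0, s3), (s0, r0), (r0, s1), (s2, r0), (s1, s2)], [(r1, s2)]),
    ((TD, [s2, s2], [r0, s3, r2, s1]), (TD, TD, M32_27, Degree2, [4, 4], [8, 8, 4, 4]),
      [(r0, s3), (s1, r0), (r0, s1), (s3, r0), (s0, s2)], [(s0, s2)]),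
    ((TD, [r0, r0], [r0, s2, s3, r1, s0, r2, r3, s1]), (TD, TD, MD4D4, Trivial, [8], [16, 8]),
      [(r0, r1), (r0, s2), (r1, r0), (s0, r0)], []),
    ((TC, [r1], [r0]), (TC, TC, MC4, Equal, [2, 2, 1, 1, 1, 1], [4, 4, 4, 4, 2, 2, 1, 1, 1, 1]),
      [(r1, r1)], [(r2, r2), (r1, r1)]),
    ((TC, [r3], [r0]), (TC, TC, MC4, Equal, [2, 2, 1, 1, 1, 1], [4, 4, 4, 4, 2, 2, 1, 1, 1, 1]),
      [(r1, r3)], [(r2, r2), (r1, r3)]),
    ((TC, [r2], [r0, s3]), (TC, TV, MC4C2, Degree2, [8], [8, 8, 4, 4]),
      [(r1, r2), (r0, s3)], [(r1, r2)]),
    ((TC, [s3], [r0, r2]), (TC, TV, MC4C2, Degree2, [4, 4], [8, 8, 4, 4]),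
      [(r1, s3), (r0, r2)], [(r1, s3)]),
    ((TC, [r1], [r0, r2]), (TC, TC, MC4C2, Degree2, [2, 2, 2, 2], [8, 8, 2, 2, 2, 2]),
      [(r1, r1), (r0, r2)], [(r1, r1)]),
    ((TC, [r0], [r0, r1, r2, r3]), (TC, TC, MC4C4, Trivial, [4, 4], [16, 4, 4]),
      [(r0, r1), (r1, r0)], []),
    ((TC, [s3], [r0, s1]), (TC, TV, MC4C2, Degree2, [8], [8, 8, 4, 4]),
      [(r1, s3), (r0, s1)], [(r1, s3)]),
    ((TC, [r0], [r0, s3, r2, s1]), (TC, TV, MC4V4, Trivial, [8], [8, 8, 8]),
      [(r1, r0), (r0, s3), (r0, r2)], []),
    ((TV, [s3, r2], [r0]), (TV, TV, MV4, Equal, [2, 2, 1, 1, 1, 1], [4, 4, 2, 2, 2, 2, 2, 2, 1, 1, 1, 1]),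
      [(r2, r2), (s3, s3)], [(r2, r2), (s3, s3)]),
    ((TV, [s3, s1], [r0]), (TV, TV, MV4, Equal, [4, 2, 2], [4, 4, 2, 2, 2, 2, 2, 2, 1, 1, 1, 1]),
      [(r2, s1), (s3, s3)], [(r2, s1), (s3, s3)]),
    ((TV, [r2, s3], [r0]), (TV, TV, MV4, Equal, [4, 2, 2], [4, 4, 2, 2, 2, 2, 2, 2, 1, 1, 1, 1]),
      [(r2, s3), (s3, r2)], [(r2, s3), (s3, r2)]),
    ((TV, [r2, s1], [r0]), (TV, TV, MV4, Equal, [4, 2, 2], [4, 4, 2, 2, 2, 2, 2, 2, 1, 1, 1, 1]),
      [(r2, s1), (s3, r2)], [(r2, s1), (s3, r2)]),
    ((TV, [s1, s3], [r0]), (TV, TV, MV4, Equal, [4, 2, 2], [4, 4, 2, 2, 2, 2, 2, 2, 1, 1, 1, 1]),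
      [(r2, s3), (s3, s1)], [(r2, s3), (s3, s1)]),
    ((TV, [s1, r2], [r0]), (TV, TV, MV4, Equal, [2, 2, 1, 1, 1, 1], [4, 4, 2, 2, 2, 2, 2, 2, 1, 1, 1, 1]),
      [(r2, r2), (s3, s1)], [(r2, r2), (s3, s1)]),
    ((TV, [r0, r2], [r0, s3]), (TV, TV, MV4C2, Degree2, [4, 2, 2], [4, 4, 4, 4, 2, 2, 2, 2]),
      [(r0, s3), (r2, r2), (s3, r0)], [(r2, r2)]),
    ((TV, [r2, r0], [r0, s3]), (TV, TV, MV4C2, Degree2, [4, 4], [4, 4, 4, 4, 2, 2, 2, 2]),
      [(r0, s3), (r2, r0), (s3, r2)], [(s3, r2)]),
    ((TV, [r2, r2], [r0, s3]), (TV, TV, MV4C2, Degree2, [4, 2, 2], [4, 4, 4, 4, 2, 2, 2, 2]),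
      [(r0, s3), (r2, r2), (s3, r2)], [(r2, r2)]),
    ((TV, [r0, s3], [r0, r2]), (TV, TV, MV4C2, Degree2, [4, 4], [4, 4, 4, 4, 2, 2, 2, 2]),
      [(r0, r2), (r2, s3), (s3, r0)], [(r2, s3)]),
    ((TV, [r0, r1], [r0, r2]), (TV, TC, MC2C4, Degree2, [8], [8, 8, 4, 4]),
      [(s3, r0), (r2, r1)], [(r2, r1)]),
    ((TV, [s3, r0], [r0, r2]), (TV, TV, MV4C2, Degree2, [2, 2, 2, 2], [4, 4, 4, 4, 2, 2, 2, 2]),
      [(r0, r2), (r2, r0), (s3, s3)], [(s3, s3)]),
    ((TV, [s3, s3], [r0, r2]), (TV, TV, MV4C2, Degree2, [4, 4], [4, 4, 4, 4, 2, 2, 2, 2]),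
      [(r0, r2), (r2, s3), (s3, s3)], [(r2, s3)]),
    ((TV, [r1, r0], [r0, r2]), (TV, TC, MC2C4, Degree2, [4, 4], [8, 8, 4, 4]),
      [(r2, r0), (s3, r1)], [(s3, r1)]),
    ((TV, [r1, r1], [r0, r2]), (TV, TC, MC2C4, Degree2, [8], [8, 8, 4, 4]),
      [(s1, r2), (r2, r1)], [(r2, r1)]),
    ((TV, [r0, r0], [r0, r1, r2, r3]), (TV, TC, MV4C4, Trivial, [8], [8, 8, 8]),
      [(r2, r0), (s3, r0), (r0, r1)], []),
    ((TV, [r0, s3], [r0, s1]), (TV, TV, MV4C2, Degree2, [4, 2, 2], [4, 4, 4, 4, 2, 2, 2, 2]),
      [(r0, s1), (r2, s3), (s3, r0)], [(r2, s3)]),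
    ((TV, [s3, r0], [r0, s1]), (TV, TV, MV4C2, Degree2, [4, 4], [4, 4, 4, 4, 2, 2, 2, 2]),
      [(r0, s1), (r2, r0), (s3, s3)], [(s3, s3)]),
    ((TV, [s3, s3], [r0, s1]), (TV, TV, MV4C2, Degree2, [4, 2, 2], [4, 4, 4, 4, 2, 2, 2, 2]),
      [(r0, s1), (r2, s3), (s3, s3)], [(r2, s3)]),
    ((TV, [r0, r0], [r0, s3, r2, s1]), (TV, TV, MV4V4, Trivial, [4, 4], [4, 4, 4, 4, 4, 4]),
      [(r0, s3), (r0, r2), (r2, r0), (s3, r0)], [])]"

lemma subgroup_table_rows: "list_all row_check subgroup_table"
  by code_simp

text \<open>In a finite group, closure under products entails closure under inverses.\<close>

definition is_subgroup_list :: "perm4 list \<Rightarrow> bool" where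
  "is_subgroup_list N \<longleftrightarrow> List.member N r0 \<and> list_all (\<lambda>x. list_all (\<lambda>y. List.member N (perm_mult x y)) N) N"

definition d8_subgroups :: "perm4 list list" where
  "d8_subgroups = filter is_subgroup_list (subseqs d8)"

text \<open>One representative for each left coset x N. Changing a lift by an element of the kernel
  N does not change the subgroup, so representatives suffice as second components of the lifted
  generators.\<close>

definition coset_reps :: "perm4 list \<Rightarrow> perm4 list" where
  "coset_reps N = filter (\<lambda>x. x = hd (filter (List.member (map (perm_mult x) N)) d8)) d8"

definition perm_transitive :: "perm4 list \<Rightarrow> bool" where
  "perm_transitive ps \<longleftrightarrow> list_all (\<lambda>i. list_ex (\<lambda>p. perm_app p I1 = i) ps) [I1, I2, I3, I4]"

text \<open>Every relator of \<open>type_gens\<close> that is needed occurs among these words. When the first component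
  of a word is trivial, its second component must lie in N.\<close>

definition test_words :: "perm_pair list \<Rightarrow> perm4 list \<Rightarrow> perm_pair list list" where
  "test_words gs N = concat (map (\<lambda>g. [[g, g], [g, g, g, g]] @ map (\<lambda>n. [g, (r0, n), g, g, g]) N @
     map (\<lambda>h. [g, h, g, h]) gs) gs)"

text \<open>These are necessary conditions on a key that comes from a group H as in
  \<open>subgroup_cover\<close>. They need not characterize subgroups, since whatever passes them is
  looked up in the table. The bound on Q expresses that the second group is not larger than the
  first.\<close>

definition candidate :: "key \<Rightarrow> bool" where
  "candidate k = (case k of (t, xs, N) \<Rightarrow>
     list_all (\<lambda>w. let (p, q) = foldr pp_mult w pp_one in p = r0 \<longrightarrow> List.member N q)
       (test_words (map fst (lift_gens t xs)) N) \<and>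
     (let Q = remdups (map snd (lift_group t xs N)) in
       perm_transitive Q \<and> length Q \<le> length (type_elems t)))"

definition lift_keys :: "key list" where
  "lift_keys = concat (map (\<lambda>t. concat (map (\<lambda>N. map (\<lambda>xs. (t, xs, N))
     (product_lists (map (\<lambda>_. coset_reps N) (type_gens t)))) d8_subgroups)) [TD, TC, TV])"

text \<open>The dihedral group of order 8 has ten subgroups N; with all choices of coset
  representatives for the generators of the three types, 349 keys are tested.\<close>

lemma subgroup_table_complete:
  "list_all (\<lambda>k. candidate k \<longrightarrow> List.member (map fst subgroup_table) k) lift_keys"
  by code_simp

lemma coset_reps_cover:
  "list_all (\<lambda>N. list_all (\<lambda>x. list_ex (\<lambda>n. List.member (coset_reps N) (perm_mult x n)) N) d8) d8_subgroups"
  by code_simp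

lemma transitive_d8_subgroups:
  "list_all (\<lambda>N. perm_transitive N \<longrightarrow> list_ex (\<lambda>t. same_elems N (type_elems t)) [TD, TC, TV]) d8_subgroups"
  by code_simp

section \<open>From evaluated certificates to isomorphisms\<close>

lemma model_iso:
  assumes "model_spec K f e c" and "c = prod_list (map snd ms)" and "\<forall>(m, n)\<in>set ms. m \<in> carrier K"
    and "iso_check f e ms hs H"
  shows "pp_group (set H) \<cong> K"
  using assms by (intro iso_check_correct[of K f e ms hs H]) (simp_all add: model_spec_def)

lemmas model_carriers = carrier_integer_mod_group dihedral_def semidirect_def
  SG_32_27_def SG_32_28_def SG_32_34_def SG_16_3_def SG_16_4_def

lemma model_check_D4D4: "model_check MD4D4 ws H \<Longrightarrow> pp_group (set H) \<cong> D4 \<times>\<times> D4"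
  by (rule model_iso[OF model_direct[OF model_D4 model_D4], rotated 2], simp only: model_check.simps) (simp_all add: model_carriers)

lemma model_check_32_27: "model_check M32_27 ws H \<Longrightarrow> pp_group (set H) \<cong> SG_32_27"
  by (rule model_iso[OF model_SG_32_27, rotated 2], simp only: model_check.simps) (simp_all add: model_carriers)

lemma model_check_32_28: "model_check M32_28 ws H \<Longrightarrow> pp_group (set H) \<cong> SG_32_28"
  by (rule model_iso[OF model_SG_32_28, rotated 2], simp only: model_check.simps) (simp_all add: model_carriers)

lemma model_check_32_34: "model_check M32_34 ws H \<Longrightarrow> pp_group (set H) \<cong> SG_32_34"
  by (rule model_iso[OF model_SG_32_34, rotated 2], simp only: model_check.simps) (simp_all add: model_carriers)

lemma model_check_16_3: "model_check M16_3 ws H \<Longrightarrow> pp_group (set H) \<cong> SG_16_3"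
  by (rule model_iso[OF model_SG_16_3, rotated 2], simp only: model_check.simps) (simp_all add: model_carriers)

lemma model_check_16_4: "model_check M16_4 ws H \<Longrightarrow> pp_group (set H) \<cong> SG_16_4"
  by (rule model_iso[OF model_SG_16_4, rotated 2], simp only: model_check.simps) (simp_all add: model_carriers)

lemma model_check_D4C4: "model_check MD4C4 ws H \<Longrightarrow> pp_group (set H) \<cong> D4 \<times>\<times> C4"
  by (rule model_iso[OF model_direct[OF model_D4 model_C4], rotated 2], simp only: model_check.simps) (simp_all add: model_carriers)

lemma model_check_D4V4: "model_check MD4V4 ws H \<Longrightarrow> pp_group (set H) \<cong> D4 \<times>\<times> V4"
  by (rule model_iso[OF model_direct[OF model_D4 model_V4], rotated 2], simp only: model_check.simps) (simp_all add: model_carriers)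

lemma model_check_D4C2: "model_check MD4C2 ws H \<Longrightarrow> pp_group (set H) \<cong> D4 \<times>\<times> C2"
  by (rule model_iso[OF model_direct[OF model_D4 model_C2], rotated 2], simp only: model_check.simps) (simp_all add: model_carriers)

lemma model_check_D4: "model_check MD4 ws H \<Longrightarrow> pp_group (set H) \<cong> D4"
  by (rule model_iso[OF model_D4, rotated 2], simp only: model_check.simps) (simp_all add: model_carriers)

lemma model_check_C4C4: "model_check MC4C4 ws H \<Longrightarrow> pp_group (set H) \<cong> C4 \<times>\<times> C4"
  by (rule model_iso[OF model_direct[OF model_C4 model_C4], rotated 2], simp only: model_check.simps) (simp_all add: model_carriers)

lemma model_check_C4C2: "model_check MC4C2 ws H \<Longrightarrow> pp_group (set H) \<cong> C4 \<times>\<times> C2"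
  by (rule model_iso[OF model_direct[OF model_C4 model_C2], rotated 2], simp only: model_check.simps) (simp_all add: model_carriers)

lemma model_check_C2C4: "model_check MC2C4 ws H \<Longrightarrow> pp_group (set H) \<cong> C2 \<times>\<times> C4"
  by (rule model_iso[OF model_direct[OF model_C2 model_C4], rotated 2], simp only: model_check.simps) (simp_all add: model_carriers)

lemma model_check_C4: "model_check MC4 ws H \<Longrightarrow> pp_group (set H) \<cong> C4"
  by (rule model_iso[OF model_C4, rotated 2], simp only: model_check.simps) (simp_all add: model_carriers)

lemma model_check_C4V4: "model_check MC4V4 ws H \<Longrightarrow> pp_group (set H) \<cong> C4 \<times>\<times> V4"
  by (rule model_iso[OF model_direct[OF model_C4 model_V4], rotated 2], simp only: model_check.simps) (simp_all add: model_carriers)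

lemma model_check_V4C4: "model_check MV4C4 ws H \<Longrightarrow> pp_group (set H) \<cong> V4 \<times>\<times> C4"
  by (rule model_iso[OF model_direct[OF model_V4 model_C4], rotated 2], simp only: model_check.simps) (simp_all add: model_carriers)

lemma model_check_V4V4: "model_check MV4V4 ws H \<Longrightarrow> pp_group (set H) \<cong> V4 \<times>\<times> V4"
  by (rule model_iso[OF model_direct[OF model_V4 model_V4], rotated 2], simp only: model_check.simps) (simp_all add: model_carriers)

lemma model_check_V4C2: "model_check MV4C2 ws H \<Longrightarrow> pp_group (set H) \<cong> V4 \<times>\<times> C2"
  by (rule model_iso[OF model_direct[OF model_V4 model_C2], rotated 2], simp only: model_check.simps) (simp_all add: model_carriers)

lemma model_check_V4: "model_check MV4 ws H \<Longrightarrow> pp_group (set H) \<cong> V4"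
  by (rule model_iso[OF model_V4, rotated 2], simp only: model_check.simps) (simp_all add: model_carriers)

section \<open>Every admissible group occurs in the table\<close>

text \<open>This is the substitute for inverses: the cube of x is inverse to x, so a set that is
  closed under products contains the inverses of its elements.\<close>

lemma d8_inverse:
  assumes "x \<in> set d8"
  shows "perm_mult x (perm_mult x (perm_mult x x)) = r0"
proof -
  have "list_all (\<lambda>x. perm_mult x (perm_mult x (perm_mult x x)) = r0) d8"
    by code_simp
  then show ?thesis using assms by (simp add: list_all_iff)
qed

text \<open>The evaluated lists contain subgroups as lists, not as sets. Subsequences of
  \<open>d8\<close> provide a list of the expected form for every subset.\<close>

lemma d8_subgroup_list:
  assumes "S \<subseteq> set d8" "r0 \<in> S" "\<And>x y. x \<in> S \<Longrightarrow> y \<in> S \<Longrightarrow> perm_mult x y \<in> S"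
  obtains N where "N \<in> set d8_subgroups" "set N = S"
proof -
  have "S \<in> set ` set (subseqs d8)" using assms(1) by (simp add: subseqs_powset)
  then obtain N where "N \<in> set (subseqs d8)" "set N = S" by blast
  then show ?thesis
    using that assms(2,3) by (simp add: d8_subgroups_def is_subgroup_list_def list_all_iff)
qed

text \<open>N is the kernel of the first projection, read in the second component. Each generator of
  the first projection has a lift in H whose second component is a coset representative modulo N.
  Normal forms of these lifts meet every fibre of the first projection, and a fibre is a coset of
  the kernel, so the key reproduces H exactly.\<close>

lemma subgroup_cover:
  assumes sub: "H \<subseteq> set d8 \<times> set d8" and one: "pp_one \<in> H"
    and closed: "\<And>x y. x \<in> H \<Longrightarrow> y \<in> H \<Longrightarrow> pp_mult x y \<in> H"
    and tr1: "\<And>i. \<exists>h\<in>H. perm_app (fst h) I1 = i" and tr2: "\<And>i. \<exists>h\<in>H. perm_app (snd h) I1 = i"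
    and card: "card (snd ` H) \<le> card (fst ` H)"
  obtains t xs N r ws c where "((t, xs, N), r, ws, c) \<in> set subgroup_table"
    "set (lift_group t xs N) = H" "set N = {q. (r0, q) \<in> H}" "fst ` H = set (type_elems t)"
proof -
  have cl1: "perm_mult x y \<in> fst ` H" if "x \<in> fst ` H" "y \<in> fst ` H" for x y
  proof -
    from that obtain h k where "h \<in> H" "fst h = x" "k \<in> H" "fst k = y" by blast
    then have "pp_mult h k \<in> H" "fst (pp_mult h k) = perm_mult x y"
      using closed by (blast, simp add: pp_mult_def)
    then show ?thesis by (metis image_eqI)
  qed
  obtain P where P: "P \<in> set d8_subgroups" "set P = fst ` H"
  proof (rule d8_subgroup_list)
    show "fst ` H \<subseteq> set d8" using sub by auto
    show "r0 \<in> fst ` H" using one by force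
  qed (use cl1 in blast)+
  have "perm_transitive P"
    using tr1 P(2) by (auto simp: perm_transitive_def list_ex_iff)
  then obtain t where "same_elems P (type_elems t)"
    using transitive_d8_subgroups P(1) unfolding list_all_iff list_ex_iff by blast
  then have t: "fst ` H = set (type_elems t)"
    using P(2) by (auto simp: same_elems_def list_all_iff)
  have clN: "perm_mult x y \<in> {q. (r0, q) \<in> H}"
    if "x \<in> {q. (r0, q) \<in> H}" "y \<in> {q. (r0, q) \<in> H}" for x y
    using that closed[of "(r0, x)" "(r0, y)"] by (simp add: pp_mult_def)
  obtain N where N: "N \<in> set d8_subgroups" "set N = {q. (r0, q) \<in> H}"
  proof (rule d8_subgroup_list)
    show "{q. (r0, q) \<in> H} \<subseteq> set d8" using sub by auto
    show "r0 \<in> {q. (r0, q) \<in> H}" using one by simp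
  qed (use clN in blast)+
  have gens: "g \<in> fst ` H" if "(g, n) \<in> set (type_gens t)" for g n
  proof -
    have "list_all (\<lambda>t. list_all (\<lambda>(g, n). List.member (type_elems t) g) (type_gens t)) [TD, TC, TV]"
      by code_simp
    then have "\<forall>t\<in>{TD, TC, TV}. \<forall>(g, n)\<in>set (type_gens t). g \<in> set (type_elems t)"
      by (simp only: list_all_iff list.set List.member_iff) 
    moreover have "t \<in> {TD, TC, TV}" by (cases t) simp_all
    ultimately show ?thesis unfolding t using that by blast
  qed
  \<comment> \<open>Multiplying an arbitrary lift on the right by an element of the kernel moves its
    second component to the representative of the coset.\<close>
  have "\<exists>x. x \<in> set (coset_reps N) \<and> (g, x) \<in> H" if gn: "(g, n) \<in> set (type_gens t)" for g n
  proof -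
    obtain x where x: "(g, x) \<in> H" using gens[OF gn] by force
    then have "x \<in> set d8" using sub by auto
    then obtain y where y: "y \<in> set N" "perm_mult x y \<in> set (coset_reps N)"
      using coset_reps_cover N(1) unfolding list_all_iff list_ex_iff by force
    have "pp_mult (g, x) (r0, y) \<in> H" using closed[OF x, of "(r0, y)"] y(1) N(2) by simp
    then show ?thesis using y(2) by (auto simp: pp_mult_def simp del: perm_mult.simps)
  qed
  then obtain ch where ch: "\<And>g n. (g, n) \<in> set (type_gens t) \<Longrightarrow> ch g \<in> set (coset_reps N) \<and> (g, ch g) \<in> H"
    by metis
  define xs where "xs = map (\<lambda>(g, n). ch g) (type_gens t)"
  have lift: "lift_gens t xs = map (\<lambda>(g, n). ((g, ch g), n)) (type_gens t)"
    by (auto simp: lift_gens_def xs_def zip_map2 zip_same_conv_map)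
  define L where "L = normal_forms pp_mult pp_one (lift_gens t xs)"
  have LH: "set L \<subseteq> H"
  proof -
    have "\<forall>x\<in>set L. x \<in> H"
      unfolding L_def
    proof (rule normal_forms_invariant[where P = "\<lambda>x. x \<in> H", OF _ one])
      fix g n x assume g: "(g, n) \<in> set (lift_gens t xs)" and x: "x \<in> H"
      have "g \<in> H" using g ch unfolding lift by auto
      then show "pp_mult g x \<in> H" using x by (rule closed)
    qed
    then show ?thesis by blast
  qed
  have "map fst L = type_elems t"
    unfolding L_def type_elems_def
    by (subst map_normal_forms[where f' = perm_mult]) (auto simp: pp_mult_def lift case_prod_beta o_def)
  then have L1: "fst ` set L = fst ` H" unfolding t by (metis list.set_map)
  have Hset: "set (lift_group t xs N) = H"
  proof
    show "set (lift_group t xs N) \<subseteq> H"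
      using LH N(2) closed by (auto simp: lift_group_def L_def[symmetric])
    show "H \<subseteq> set (lift_group t xs N)"
    proof
      fix h assume h: "h \<in> H"
      then obtain l where l: "l \<in> set L" "fst l = fst h" using L1 by (metis imageE image_eqI)
      then have lH: "l \<in> H" using LH by auto
      then have inv: "pp_mult l (pp_mult l (pp_mult l l)) = pp_one"
        using sub d8_inverse[of "fst l"] d8_inverse[of "snd l"] by (auto simp: pp_mult_def)
      \<comment> \<open>m is l^-1 h with the cube for the inverse. As l and h have the same first
        component, m lies in the kernel and h = l m.\<close>
      define m where "m = pp_mult (pp_mult l (pp_mult l l)) h"
      have "m \<in> H" unfolding m_def using lH h closed by blast
      moreover have "fst m = r0"
        using inv l(2) unfolding m_def pp_mult_def by (simp add: perm_mult_assoc)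
      ultimately have m: "snd m \<in> set N" "m = (r0, snd m)" using N(2) by (auto, metis prod.collapse)+
      have "pp_mult l m = h"
        unfolding m_def using inv by (metis pp_mult_assoc pp_mult_one(1))
      then have "h = pp_mult l (r0, snd m)" using m(2) by simp
      then show "h \<in> set (lift_group t xs N)"
        using l(1) m(1) by (auto simp: lift_group_def L_def[symmetric])
    qed
  qed
  have "(t, xs, N) \<in> set lift_keys"
  proof -
    have "xs \<in> set (product_lists (map (\<lambda>_. coset_reps N) (type_gens t)))"
      unfolding product_lists_set xs_def using ch by (auto simp: list_all2_conv_all_nth split: prod.split dest: nth_mem)
    moreover have "t \<in> set [TD, TC, TV]" by (cases t) simp_all
    ultimately show ?thesis unfolding lift_keys_def using N(1) by force
  qed
  \<comment> \<open>Test words are made of elements of H, so their products lie in H; a trivial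
    first component then puts the second one into N.\<close>
  moreover have "candidate (t, xs, N)"
  proof -
    have words: "\<forall>h\<in>set w. h \<in> H" if "w \<in> set (test_words (map fst (lift_gens t xs)) N)" for w
    proof -
      have *: "\<forall>h\<in>set w. h \<in> H" if "w \<in> set (test_words gs N)" "set gs \<subseteq> H" for gs
        using that N(2) by (auto simp: test_words_def)
      show ?thesis by (rule *[OF that]) (use ch in \<open>auto simp: lift\<close>)
    qed
    have fold: "foldr pp_mult w pp_one \<in> H" if "\<forall>h\<in>set w. h \<in> H" for w
      using that by (induction w) (auto simp: one closed)
    have "\<forall>w\<in>set (test_words (map fst (lift_gens t xs)) N).
        let (p, q) = foldr pp_mult w pp_one in p = r0 \<longrightarrow> List.member N q"
      using fold[OF words] N(2) by (auto simp: Let_def case_prod_beta) (metis prod.collapse)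
    moreover have "perm_transitive (remdups (map snd (lift_group t xs N)))"
      using tr2 by (auto simp: perm_transitive_def list_ex_iff Hset)
    moreover have "length (remdups (map snd (lift_group t xs N))) \<le> length (type_elems t)"
      using card unfolding t by (simp add: length_remdups_card_conv Hset) (meson card_length le_trans)
    ultimately show ?thesis by (simp add: candidate_def list_all_iff Let_def)
  qed
  ultimately have "(t, xs, N) \<in> set (map fst subgroup_table)"
    using subgroup_table_complete unfolding list_all_iff by auto
  then obtain r ws c where "((t, xs, N), r, ws, c) \<in> set subgroup_table" by force
  then show ?thesis using that Hset N(2) t by blast
qed

section \<open>Orbits of the twisted conjugation action\<close>

text \<open>The first equation is the rule for the inverse of a product, written with cubes. It is
  what makes \<open>pp_conj\<close> an action.\<close>

lemma cube_mult_d8: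
  assumes "x \<in> set d8" "y \<in> set d8"
  shows "perm_mult (perm_mult x y) (perm_mult (perm_mult x y) (perm_mult x y)) =
    perm_mult (perm_mult y (perm_mult y y)) (perm_mult x (perm_mult x x))"
    and "perm_mult x y \<in> set d8"
proof -
  have "list_all (\<lambda>x. list_all (\<lambda>y. perm_mult (perm_mult x y) (perm_mult (perm_mult x y) (perm_mult x y)) =
    perm_mult (perm_mult y (perm_mult y y)) (perm_mult x (perm_mult x x)) \<and> List.member d8 (perm_mult x y)) d8) d8"
    by code_simp
  then show "perm_mult (perm_mult x y) (perm_mult (perm_mult x y) (perm_mult x y)) =
    perm_mult (perm_mult y (perm_mult y y)) (perm_mult x (perm_mult x x))" "perm_mult x y \<in> set d8"
    using assms unfolding list_all_iff List.member_iff by blast+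
qed

lemma d8_commute_r2: "p \<in> set d8 \<Longrightarrow> perm_app p (perm_app r2 i) = perm_app r2 (perm_app p i)"
  unfolding d8_def by (cases i) auto

lemma pp_conj_mult:
  assumes "h \<in> set d8 \<times> set d8" "k \<in> set d8 \<times> set d8"
  shows "pp_conj h (pp_conj k x) = pp_conj (pp_mult h k) x"
  using cube_mult_d8(1)[of "fst h" "fst k"] assms
  by (simp add: pp_conj_def pp_mult_def perm_mult_assoc mem_Times_iff)

lemma pp_conj_one: "pp_conj pp_one x = x"
  by (simp only: pp_conj_def fst_conv snd_conv perm_mult_one)

definition orbit_of :: "perm_pair set \<Rightarrow> perm4 \<Rightarrow> perm4 set" where
  "orbit_of H x = (\<lambda>h. pp_conj h x) ` H"

context
  fixes H :: "perm_pair set"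
  assumes sub: "H \<subseteq> set d8 \<times> set d8" and one: "pp_one \<in> H"
    and closed: "\<And>x y. x \<in> H \<Longrightarrow> y \<in> H \<Longrightarrow> pp_mult x y \<in> H"
begin

lemma orbit_of_refl: "x \<in> orbit_of H x"
  unfolding orbit_of_def using one pp_conj_one by (metis image_eqI)

lemma orbit_of_eq:
  assumes "y \<in> orbit_of H x"
  shows "orbit_of H y = orbit_of H x"
proof -
  obtain k where k: "k \<in> H" "y = pp_conj k x" using assms by (auto simp: orbit_of_def)
  have 1: "pp_conj h y = pp_conj (pp_mult h k) x" if "h \<in> H" for h
    using pp_conj_mult[of h k x] that k sub by auto
  define k' where "k' = pp_mult k (pp_mult k k)"
  have k': "k' \<in> H" using k closed by (simp add: k'_def)
  have "k \<in> set d8 \<times> set d8" using k sub by auto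
  then have "pp_mult k' k = pp_one"
    using d8_inverse[of "fst k"] d8_inverse[of "snd k"] by (simp add: k'_def pp_mult_def perm_mult_assoc mem_Times_iff)
  then have 2: "pp_conj h x = pp_conj (pp_mult h k') y" if "h \<in> H" for h
    using 1[OF closed[OF that k']] pp_mult_assoc[of h k' k] by (metis pp_mult_one(2))
  show ?thesis unfolding orbit_of_def using 1 2 closed k(1) k' by blast
qed

text \<open>Each call splits off one orbit. Orbits are equal or disjoint, so the remaining entries
  are again closed under the action, and no later call meets the same orbit; this allows induction
  on the length.\<close>

lemma orbit_list_correct:
  assumes H: "set Hl = H"
  shows "distinct xs \<Longrightarrow> (\<And>x. x \<in> set xs \<Longrightarrow> orbit_of H x \<subseteq> set xs) \<Longrightarrow>
    image_mset card (mset_set (orbit_of H ` set xs)) = mset (map length (orbit_list Hl xs))"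
proof (induction "length xs" arbitrary: xs rule: less_induct)
  case less
  show ?case
  proof (cases xs)
    case (Cons x ys)
    define xo where "xo = remdups (map (\<lambda>h. pp_conj h x) Hl)"
    define zs where "zs = filter (\<lambda>y. \<not> List.member xo y) ys"
    have xo: "set xo = orbit_of H x" "length xo = card (orbit_of H x)"
      by (simp_all add: xo_def orbit_of_def H length_remdups_card_conv)
    have rec: "orbit_list Hl xs = xo # orbit_list Hl zs"
      by (simp add: Cons xo_def zs_def Let_def)
    have zs: "set zs = set xs - orbit_of H x"
      using orbit_of_refl[of x] by (auto simp: zs_def xo Cons)
    have IH: "image_mset card (mset_set (orbit_of H ` set zs)) = mset (map length (orbit_list Hl zs))"
    proof (rule less.hyps)
      show "length zs < length xs" by (simp add: zs_def Cons le_imp_less_Suc)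
      show "distinct zs" using less.prems(1) by (simp add: zs_def Cons)
      fix y assume y: "y \<in> set zs"
      have "z \<notin> orbit_of H x" if "z \<in> orbit_of H y" for z
        using orbit_of_eq[OF that] orbit_of_eq[of z x] orbit_of_refl[of y] y zs by auto
      then show "orbit_of H y \<subseteq> set zs" using less.prems(2)[of y] y zs by auto
    qed
    have "orbit_of H ` set xs = insert (orbit_of H x) (orbit_of H ` set zs)"
      using orbit_of_eq[of _ x] by (auto simp: zs Cons)
    moreover have "orbit_of H x \<notin> orbit_of H ` set zs"
      using orbit_of_refl zs by blast
    ultimately show ?thesis by (simp add: rec IH xo)
  qed simp
qed

end

section \<open>The dihedral permutations of the statement\<close>

fun ix_nat :: "ix \<Rightarrow> nat" where
  "ix_nat I1 = 1" | "ix_nat I2 = 2" | "ix_nat I3 = 3" | "ix_nat I4 = 4"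

text \<open>The cycle (1234) corresponds to \<open>r1\<close> and (13) to \<open>s0\<close>. One
  direction is induction over the generated subgroup, where an inverse is matched by a cube; the
  other holds because \<open>d8\<close> consists of the products of powers of \<open>r1\<close> and
  \<open>s0\<close>.\<close>

lemma dihedral_perms_d8:
  "\<pi> \<in> dihedral_perms \<Longrightarrow> \<exists>p\<in>set d8. \<forall>i. \<pi> (ix_nat i) = ix_nat (perm_app p i)"
  "p \<in> set d8 \<Longrightarrow> \<exists>\<pi>\<in>dihedral_perms. \<forall>i. \<pi> (ix_nat i) = ix_nat (perm_app p i)"
proof -
  let ?R = "cycle_of_list [1, 2, 3, 4] :: nat \<Rightarrow> nat" and ?S = "cycle_of_list [1, 3] :: nat \<Rightarrow> nat"
  let ?ok = "\<lambda>\<pi> p. \<forall>i. \<pi> (ix_nat i) = ix_nat (perm_app p i)"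
  have R: "?ok ?R r1"
  proof
    fix i show "?R (ix_nat i) = ix_nat (perm_app r1 i)"
      by (cases i) (simp_all add: Transposition.transpose_def)
  qed
  have S: "?ok ?S s0"
  proof
    fix i show "?S (ix_nat i) = ix_nat (perm_app s0 i)"
      by (cases i) (simp_all add: Transposition.transpose_def)
  qed
  have RS: "{?R, ?S} \<subseteq> carrier (sym_group 4)"
  proof -
    have "?R permutes set [1, 2, 3, 4]" "?S permutes set [1, 3]"
      by (rule cycle_permutes)+
    then have "?R permutes {1..4}" "?S permutes {1..4}" by (auto elim!: permutes_subset)
    then show ?thesis by (simp add: sym_group_def)
  qed
  have d: "r1 \<in> set d8" "s0 \<in> set d8" "r0 \<in> set d8" by (auto simp: d8_def)
  show "\<exists>p\<in>set d8. ?ok \<pi> p" if "\<pi> \<in> dihedral_perms" for \<pi>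
    using that unfolding dihedral_perms_def
  proof (induction rule: generate.induct)
    case one
    then show ?case by (rule bexI[OF _ d(3)]) (simp add: sym_group_def del: perm_app.simps)
  next
    case (incl h)
    then show ?case using R S d by blast
  next
    case (inv h)
    then obtain p where p: "p \<in> set d8" "?ok h p" using R S d by blast
    have h: "h permutes {1..4}" using inv RS by (auto simp: sym_group_def)
    have "(inv\<^bsub>sym_group 4\<^esub> h) (ix_nat i) = ix_nat (perm_app (perm_mult p (perm_mult p p)) i)" for i
    proof -
      have "h (ix_nat (perm_app (perm_mult p (perm_mult p p)) i)) = ix_nat (perm_app (perm_mult p (perm_mult p (perm_mult p p))) i)"
        using p(2) by simp
      also have "\<dots> = ix_nat i" unfolding d8_inverse[OF p(1)] perm_app_one ..
      finally show ?thesis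
        unfolding sym_group_inv_equality[OF h[folded sym_group_carrier]] permutes_inv_eq[OF h] .
    qed
    moreover have "perm_mult p (perm_mult p p) \<in> set d8" using p cube_mult_d8(2) by blast
    ultimately show ?case by blast
  next
    case (eng g h)
    then obtain p q where "p \<in> set d8" "?ok g p" "q \<in> set d8" "?ok h q" by blast
    then have "perm_mult p q \<in> set d8" "?ok (g \<otimes>\<^bsub>sym_group 4\<^esub> h) (perm_mult p q)"
      using cube_mult_d8(2) by (simp_all add: sym_group_def)
    then show ?case by blast
  qed
  have comp: "\<exists>\<pi>\<in>dihedral_perms. ?ok \<pi> (perm_mult p q)"
    if "\<exists>\<pi>\<in>dihedral_perms. ?ok \<pi> p" "\<exists>\<pi>\<in>dihedral_perms. ?ok \<pi> q" for p q
  proof -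
    obtain f g where fg: "f \<in> dihedral_perms" "?ok f p" "g \<in> dihedral_perms" "?ok g q"
      using \<open>\<exists>\<pi>\<in>dihedral_perms. ?ok \<pi> p\<close> \<open>\<exists>\<pi>\<in>dihedral_perms. ?ok \<pi> q\<close> by blast
    then have "f \<circ> g \<in> dihedral_perms"
      using generate.eng[of f "sym_group 4" "{?R, ?S}" g] by (simp add: dihedral_perms_def sym_group_def)
    moreover have "?ok (f \<circ> g) (perm_mult p q)" using fg by simp
    ultimately show ?thesis by blast
  qed
  have Rr: "\<exists>\<pi>\<in>dihedral_perms. ?ok \<pi> r1" "\<exists>\<pi>\<in>dihedral_perms. ?ok \<pi> s0"
    using R S generate.incl[of _ "{?R, ?S}" "sym_group 4"] unfolding dihedral_perms_def by blast+
  have elems: "set d8 = set (type_elems TD)" by code_simp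
  have "\<forall>p\<in>set (type_elems TD). \<exists>\<pi>\<in>dihedral_perms. ?ok \<pi> p"
    unfolding type_elems_def
  proof (rule normal_forms_invariant)
    have "perm_mult r1 (perm_mult r1 (perm_mult r1 r1)) = r0" by simp
    then show "\<exists>\<pi>\<in>dihedral_perms. ?ok \<pi> r0" using comp Rr(1) by metis
    fix g n p assume "(g, n) \<in> set (type_gens TD)" and p: "\<exists>\<pi>\<in>dihedral_perms. ?ok \<pi> p"
    then have "g = r1 \<or> g = s0" by auto
    then show "\<exists>\<pi>\<in>dihedral_perms. ?ok \<pi> (perm_mult g p)" using comp[OF _ p] Rr by blast
  qed
  then show "p \<in> set d8 \<Longrightarrow> \<exists>\<pi>\<in>dihedral_perms. ?ok \<pi> p" using elems by simp
qed

lemma perm_app_lookup: "perm_app (Perm4 (f I1) (f I2) (f I3) (f I4)) i = f i"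
  by (cases i) simp_all

lemma set_s4: "set s4 = {p. inj (perm_app p)}"
proof (rule Set.set_eqI)
  fix p
  obtain a b c d where p: "p = Perm4 a b c d" by (cases p)
  have "inj (perm_app p) \<longleftrightarrow> distinct [a, b, c, d]"
  proof
    assume "inj (perm_app p)"
    then show "distinct [a, b, c, d]"
      using injD[of "perm_app p" I1 I2] injD[of "perm_app p" I1 I3] injD[of "perm_app p" I1 I4]
        injD[of "perm_app p" I2 I3] injD[of "perm_app p" I2 I4] injD[of "perm_app p" I3 I4] p by auto
  next
    assume d: "distinct [a, b, c, d]"
    show "inj (perm_app p)"
    proof (rule injI)
      fix i j assume "perm_app p i = perm_app p j"
      then show "i = j" using d p by (cases i; cases j) auto
    qed
  qed
  moreover have "p \<in> set s4 \<longleftrightarrow> distinct [a, b, c, d]"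
    by (cases a; cases b; cases c; cases d) (auto simp: s4_def p)
  ultimately show "p \<in> set s4 \<longleftrightarrow> p \<in> {p. inj (perm_app p)}" by simp
qed

lemma distinct_s4: "distinct s4" and distinct_d8: "distinct d8" and d8_subset_s4: "set d8 \<subseteq> set s4"
  by code_simp+

section \<open>Homomorphisms of subfields\<close>

context field
begin

text \<open>The values may lie anywhere in R: a homomorphism of an intermediate field can move it,
  and only its extension to the top of the tower maps that field to itself.\<close>

abbreviation homs :: "'a set \<Rightarrow> ('a \<Rightarrow> 'a) set" where
  "homs K \<equiv> ring_hom (R\<lparr>carrier := K\<rparr>) R"

lemma homsI:
  assumes "\<And>x. x \<in> K \<Longrightarrow> h x \<in> carrier R"
    and "\<And>x y. x \<in> K \<Longrightarrow> y \<in> K \<Longrightarrow> h (x \<otimes> y) = h x \<otimes> h y"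
    and "\<And>x y. x \<in> K \<Longrightarrow> y \<in> K \<Longrightarrow> h (x \<oplus> y) = h x \<oplus> h y"
    and "h \<one> = \<one>"
  shows "h \<in> homs K"
  using assms by (auto simp: ring_hom_def)

lemma homsD:
  assumes "h \<in> homs K"
  shows "\<And>x. x \<in> K \<Longrightarrow> h x \<in> carrier R"
    and "\<And>x y. x \<in> K \<Longrightarrow> y \<in> K \<Longrightarrow> h (x \<otimes> y) = h x \<otimes> h y"
    and "\<And>x y. x \<in> K \<Longrightarrow> y \<in> K \<Longrightarrow> h (x \<oplus> y) = h x \<oplus> h y"
    and "h \<one> = \<one>"
  using assms by (auto simp: ring_hom_def)

lemma subfield_closed:
  assumes "subfield K R"
  shows "K \<subseteq> carrier R" "\<zero> \<in> K" "\<one> \<in> K"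
    "\<And>x y. x \<in> K \<Longrightarrow> y \<in> K \<Longrightarrow> x \<oplus> y \<in> K" "\<And>x y. x \<in> K \<Longrightarrow> y \<in> K \<Longrightarrow> x \<otimes> y \<in> K"
    "\<And>x. x \<in> K \<Longrightarrow> \<ominus> x \<in> K" "\<And>x y. x \<in> K \<Longrightarrow> y \<in> K \<Longrightarrow> x \<ominus> y \<in> K"
    "\<And>x. x \<in> K \<Longrightarrow> x \<noteq> \<zero> \<Longrightarrow> inv x \<in> K"
  using subringE[OF subfieldE(1)[OF assms]] subfield_m_inv(1)[OF assms] subfieldE(3)[OF assms]
  by (auto simp: a_minus_def)

lemma homs_simps:
  assumes K: "subfield K R" and h: "h \<in> homs K"
  shows "h \<zero> = \<zero>" "\<And>x. x \<in> K \<Longrightarrow> h (\<ominus> x) = \<ominus> (h x)"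
    "\<And>x y. x \<in> K \<Longrightarrow> y \<in> K \<Longrightarrow> h (x \<ominus> y) = h x \<ominus> h y"
    "\<And>x. x \<in> K \<Longrightarrow> x \<noteq> \<zero> \<Longrightarrow> h x \<noteq> \<zero>" "inj_on h K"
    "\<And>x. x \<in> K \<Longrightarrow> x \<noteq> \<zero> \<Longrightarrow> h (inv x) = inv (h x)"
proof -
  note c = subfield_closed[OF K] and hD = homsD[OF h]
  have KR: "x \<in> carrier R" if "x \<in> K" for x using c(1) that by auto
  show z: "h \<zero> = \<zero>"
    using hD(3)[OF c(2) c(2)] hD(1)[OF c(2)] KR[OF c(2)]
    by (metis add.l_cancel_one local.add.m_closed r_zero)
  show m: "h (\<ominus> x) = \<ominus> (h x)" if "x \<in> K" for x
    using hD(3)[OF that c(6)[OF that]] z KR[OF that] hD(1)[OF that] hD(1)[OF c(6)[OF that]]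
    by (metis minus_equality r_neg add.m_comm)
  show s: "h (x \<ominus> y) = h x \<ominus> h y" if "x \<in> K" "y \<in> K" for x y
    using hD(3)[OF that(1) c(6)[OF that(2)]] m[OF that(2)] by (simp add: a_minus_def)
  have i: "h x \<otimes> h (inv x) = \<one>" if "x \<in> K" "x \<noteq> \<zero>" for x
    using hD(2)[OF that(1) c(8)[OF that]] hD(4) that KR[OF that(1)] by (simp add: field_Units)
  show nz: "h x \<noteq> \<zero>" if "x \<in> K" "x \<noteq> \<zero>" for x
    using i[OF that] hD(1)[OF c(8)[OF that]] by auto
  show "inj_on h K"
  proof (rule inj_onI)
    fix x y assume xy: "x \<in> K" "y \<in> K" "h x = h y"
    then have "h (x \<ominus> y) = \<zero>" using s hD(1) by (simp add: r_neg minus_eq)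
    then have "x \<ominus> y = \<zero>" using nz[OF c(7)] xy by blast
    then show "x = y" using xy KR by simp
  qed
  show "h (inv x) = inv (h x)" if "x \<in> K" "x \<noteq> \<zero>" for x
    using i[OF that] hD(1)[OF that(1)] hD(1)[OF c(8)[OF that]] comm_inv_char by metis
qed

lemma square_eq_square:
  assumes "x \<in> carrier R" "y \<in> carrier R" "x \<otimes> x = y \<otimes> y"
  shows "x = y \<or> x = \<ominus> y"
proof -
  have "(x \<ominus> y) \<otimes> (x \<oplus> y) = x \<otimes> x \<ominus> y \<otimes> y" using assms(1,2) by algebra
  also have "\<dots> = \<zero>" using assms by simp
  finally have "(x \<ominus> y) \<otimes> (x \<oplus> y) = \<zero>" .
  then have "x \<ominus> y = \<zero> \<or> x \<oplus> y = \<zero>" by (rule integral) (use assms in simp_all)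
  then show ?thesis
    using assms(1,2) minus_equality[of x y] by auto
qed

section \<open>Adjoining a square root\<close>

text \<open>If d lies in K already, this is K. Towers can therefore be formed without knowing which
  of their steps are proper.\<close>

definition quad_ext :: "'a set \<Rightarrow> 'a \<Rightarrow> 'a set" where
  "quad_ext K d = {u \<oplus> v \<otimes> d | u v. u \<in> K \<and> v \<in> K}"

context
  fixes K d
  assumes K: "subfield K R" and d: "d \<in> carrier R" and dd: "d \<otimes> d \<in> K"
begin

private lemmas c = subfield_closed[OF K]
private lemma KR: "x \<in> K \<Longrightarrow> x \<in> carrier R" using c(1) by auto

lemma quad_ext_mem: "K \<subseteq> quad_ext K d" "d \<in> quad_ext K d"
proof -
  show "K \<subseteq> quad_ext K d"
  proof
    fix x assume x: "x \<in> K"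
    then have "x = x \<oplus> \<zero> \<otimes> d" using KR d by simp
    then show "x \<in> quad_ext K d" using x c(2) unfolding quad_ext_def by blast
  qed
  have "d = \<zero> \<oplus> \<one> \<otimes> d" using d by simp
  then show "d \<in> quad_ext K d" using c(2,3) unfolding quad_ext_def by blast
qed

lemma quad_ext_unique:
  assumes "d \<notin> K" "u \<in> K" "v \<in> K" "u' \<in> K" "v' \<in> K" "u \<oplus> v \<otimes> d = u' \<oplus> v' \<otimes> d"
  shows "u = u' \<and> v = v'"
proof -
  note R = KR[OF assms(2)] KR[OF assms(3)] KR[OF assms(4)] KR[OF assms(5)] d
  have e: "(v \<ominus> v') \<otimes> d = u' \<ominus> u"
  proof -
    have "(v \<ominus> v') \<otimes> d = (u \<oplus> v \<otimes> d) \<ominus> (u \<oplus> v' \<otimes> d)" using R by algebra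
    also have "\<dots> = (u' \<oplus> v' \<otimes> d) \<ominus> (u \<oplus> v' \<otimes> d)" using assms(6) by simp
    also have "\<dots> = u' \<ominus> u" using R by algebra
    finally show ?thesis .
  qed
  have "v \<ominus> v' = \<zero>"
  proof (rule ccontr)
    assume nz: "v \<ominus> v' \<noteq> \<zero>"
    have w: "v \<ominus> v' \<in> K" using c assms by simp
    have "d = inv (v \<ominus> v') \<otimes> ((v \<ominus> v') \<otimes> d)"
      using nz KR[OF w] d KR[OF c(8)[OF w nz]] by (simp add: m_assoc[symmetric] field_Units)
    also have "\<dots> \<in> K" unfolding e using c(5)[OF c(8)[OF w nz] c(7)] assms by simp
    finally show False using assms(1) by simp
  qed
  then have v: "v = v'" using R by simp
  then have "u' \<ominus> u = \<zero>" using e R by (simp add: minus_eq r_neg)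
  then show ?thesis using v R by simp
qed

lemma quad_ext_trivial: "d \<in> K \<Longrightarrow> quad_ext K d = K"
  using quad_ext_mem c(4,5) unfolding quad_ext_def by blast

lemma quad_ext_add_mult:
  assumes "u \<in> K" "v \<in> K" "u' \<in> K" "v' \<in> K"
  shows "(u \<oplus> v \<otimes> d) \<oplus> (u' \<oplus> v' \<otimes> d) = (u \<oplus> u') \<oplus> (v \<oplus> v') \<otimes> d"
    and "(u \<oplus> v \<otimes> d) \<otimes> (u' \<oplus> v' \<otimes> d) = (u \<otimes> u' \<oplus> v \<otimes> v' \<otimes> (d \<otimes> d)) \<oplus> (u \<otimes> v' \<oplus> v \<otimes> u') \<otimes> d"
proof -
  note R = KR[OF assms(1)] KR[OF assms(2)] KR[OF assms(3)] KR[OF assms(4)] d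
  show "(u \<oplus> v \<otimes> d) \<oplus> (u' \<oplus> v' \<otimes> d) = (u \<oplus> u') \<oplus> (v \<oplus> v') \<otimes> d"
    using R by algebra
  show "(u \<oplus> v \<otimes> d) \<otimes> (u' \<oplus> v' \<otimes> d) = (u \<otimes> u' \<oplus> v \<otimes> v' \<otimes> (d \<otimes> d)) \<oplus> (u \<otimes> v' \<oplus> v \<otimes> u') \<otimes> d"
    using R by algebra
qed

lemma quad_ext_subfield: "subfield (quad_ext K d) R"
proof (cases "d \<in> K")
  case True
  then show ?thesis using quad_ext_trivial K by simp
next
  case False
  show ?thesis
  proof (rule subfieldI')
    show "subring (quad_ext K d) R"
    proof (rule subringI)
      show "quad_ext K d \<subseteq> carrier R" using KR d unfolding quad_ext_def by auto
      show "\<one> \<in> quad_ext K d" using quad_ext_mem c(3) by auto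
    next
      fix x assume "x \<in> quad_ext K d"
      then obtain u v where x: "x = u \<oplus> v \<otimes> d" "u \<in> K" "v \<in> K" unfolding quad_ext_def by blast
      have "\<ominus> x = (\<ominus> u) \<oplus> (\<ominus> v) \<otimes> d" using x(1) KR[OF x(2)] KR[OF x(3)] d by algebra
      then show "\<ominus> x \<in> quad_ext K d" using c(6) x unfolding quad_ext_def by blast
    next
      fix x y assume "x \<in> quad_ext K d" "y \<in> quad_ext K d"
      then obtain u v u' v' where x: "x = u \<oplus> v \<otimes> d" "u \<in> K" "v \<in> K" 
        and y: "y = u' \<oplus> v' \<otimes> d" "u' \<in> K" "v' \<in> K" unfolding quad_ext_def by blast
      have "u \<oplus> u' \<in> K" "v \<oplus> v' \<in> K" using x y c(4) by simp_all
      then show "x \<oplus> y \<in> quad_ext K d"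
        using quad_ext_add_mult(1)[OF x(2,3) y(2,3)] unfolding x y quad_ext_def by blast
      have "u \<otimes> u' \<oplus> v \<otimes> v' \<otimes> (d \<otimes> d) \<in> K" "u \<otimes> v' \<oplus> v \<otimes> u' \<in> K"
        using x y c(4,5) dd by simp_all
      then show "x \<otimes> y \<in> quad_ext K d"
        using quad_ext_add_mult(2)[OF x(2,3) y(2,3)] unfolding x y quad_ext_def by blast
    qed
  next
    fix x assume "x \<in> quad_ext K d - {\<zero>}"
    then obtain u v where x: "x = u \<oplus> v \<otimes> d" "u \<in> K" "v \<in> K" and nz: "x \<noteq> \<zero>"
      unfolding quad_ext_def by blast
    note R = KR[OF x(2)] KR[OF x(3)] d
    \<comment> \<open>y is the conjugate of x and n its norm. The norm lies in K and is nonzero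
      because coordinates are unique, so the inverse of x is y divided by n.\<close>
    define y where "y = u \<oplus> (\<ominus> v) \<otimes> d"
    define n where "n = u \<otimes> u \<ominus> v \<otimes> v \<otimes> (d \<otimes> d)"
    have nK: "n \<in> K" unfolding n_def using x c dd by simp
    have yR: "y \<in> carrier R" and xR: "x \<in> carrier R" using R unfolding y_def x(1) by simp_all
    have xy: "x \<otimes> y = n" unfolding x(1) y_def n_def using R by algebra
    have "y \<noteq> \<zero>"
    proof
      assume "y = \<zero>"
      then have "u \<oplus> (\<ominus> v) \<otimes> d = \<zero> \<oplus> \<zero> \<otimes> d" using d by (simp add: y_def)
      then have "u = \<zero>" "\<ominus> v = \<zero>" using quad_ext_unique[OF False x(2) c(6)[OF x(3)] c(2) c(2)] by auto
      then show False using nz x(1) R by simp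
    qed
    then have n0: "n \<noteq> \<zero>" using xy nz integral xR yR by blast
    have iK: "inv n \<in> K" using c(8)[OF nK n0] .
    have "x \<otimes> (y \<otimes> inv n) = \<one>"
      using xy xR yR n0 KR[OF nK] KR[OF iK] by (simp add: m_assoc[symmetric] field_Units)
    then have "inv x = y \<otimes> inv n" using comm_inv_char xR yR KR[OF iK] by simp
    also have "\<dots> = u \<otimes> inv n \<oplus> (\<ominus> v \<otimes> inv n) \<otimes> d" unfolding y_def using R KR[OF iK] by algebra
    also have "\<dots> \<in> quad_ext K d" using c(5)[OF x(2) iK] c(5)[OF c(6)[OF x(3)] iK] unfolding quad_ext_def by blast
    finally show "inv x \<in> quad_ext K d" .
  qed
qed

lemma quad_ext_minimal:
  assumes "subfield E R" "K \<subseteq> E" "d \<in> E"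
  shows "quad_ext K d \<subseteq> E"
  using subfield_closed(4,5)[OF assms(1)] assms(2,3) unfolding quad_ext_def by blast

text \<open>The condition on d' is the equation of d, transported by h. Coordinates with respect to
  1 and d are unique for d outside K, so u + v d can be sent to h u + h v d'.\<close>

lemma quad_ext_hom:
  assumes h: "h \<in> homs K" and d': "d' \<in> carrier R" "d' \<otimes> d' = h (d \<otimes> d)" and dK: "d \<notin> K"
  obtains g where "g \<in> homs (quad_ext K d)" "\<And>x. x \<in> K \<Longrightarrow> g x = h x" "g d = d'"
proof -
  define g where "g x = (let p = SOME p. fst p \<in> K \<and> snd p \<in> K \<and> x = fst p \<oplus> snd p \<otimes> d in
      h (fst p) \<oplus> h (snd p) \<otimes> d')" for x
  have g: "g (u \<oplus> v \<otimes> d) = h u \<oplus> h v \<otimes> d'" if "u \<in> K" "v \<in> K" for u v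
  proof -
    define p where "p = (SOME p. fst p \<in> K \<and> snd p \<in> K \<and> u \<oplus> v \<otimes> d = fst p \<oplus> snd p \<otimes> d)"
    have "fst p \<in> K \<and> snd p \<in> K \<and> u \<oplus> v \<otimes> d = fst p \<oplus> snd p \<otimes> d"
      unfolding p_def by (rule someI[of _ "(u, v)"]) (simp add: that)
    then have "fst p = u" "snd p = v" using quad_ext_unique[OF dK that] by auto
    then show ?thesis by (simp add: g_def Let_def p_def)
  qed
  note hD = homsD[OF h] and h0 = homs_simps(1)[OF K h]
  have gK: "g x = h x" if "x \<in> K" for x
    using g[OF that c(2)] KR[OF that] d h0 d' hD(1)[OF that] by simp
  have "g d = d'"
    using g[OF c(2) c(3)] d h0 hD(4) d' by simp
  moreover have "g \<in> homs (quad_ext K d)"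
  proof (rule homsI)
    show "g \<one> = \<one>" using gK c(3) hD(4) by simp
  next
    fix x assume "x \<in> quad_ext K d"
    then show "g x \<in> carrier R" using g hD(1) d' unfolding quad_ext_def by auto
  next
    fix x y assume "x \<in> quad_ext K d" "y \<in> quad_ext K d"
    then obtain u v u' v' where x: "x = u \<oplus> v \<otimes> d" "u \<in> K" "v \<in> K" 
      and y: "y = u' \<oplus> v' \<otimes> d" "u' \<in> K" "v' \<in> K" unfolding quad_ext_def by blast
    note R = hD(1)[OF x(2)] hD(1)[OF x(3)] hD(1)[OF y(2)] hD(1)[OF y(3)] d'(1)
    have "g (x \<oplus> y) = h (u \<oplus> u') \<oplus> h (v \<oplus> v') \<otimes> d'"
      unfolding x(1) y(1) using quad_ext_add_mult(1)[OF x(2,3) y(2,3)] g c(4) x y by simp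
    also have "\<dots> = (h u \<oplus> h u') \<oplus> (h v \<oplus> h v') \<otimes> d'" using hD(3) x y by simp
    also have "\<dots> = (h u \<oplus> h v \<otimes> d') \<oplus> (h u' \<oplus> h v' \<otimes> d')" using R by algebra
    finally show "g (x \<oplus> y) = g x \<oplus> g y" using g x y by simp
    have "g (x \<otimes> y) = h (u \<otimes> u' \<oplus> v \<otimes> v' \<otimes> (d \<otimes> d)) \<oplus> h (u \<otimes> v' \<oplus> v \<otimes> u') \<otimes> d'"
      unfolding x(1) y(1) using quad_ext_add_mult(2)[OF x(2,3) y(2,3)] g c(4,5) x y dd by simp
    also have "\<dots> = (h u \<otimes> h u' \<oplus> h v \<otimes> h v' \<otimes> (d' \<otimes> d')) \<oplus> (h u \<otimes> h v' \<oplus> h v \<otimes> h u') \<otimes> d'"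
      using hD(2,3) x y c(4,5) dd d'(2) by simp
    also have "\<dots> = (h u \<oplus> h v \<otimes> d') \<otimes> (h u' \<oplus> h v' \<otimes> d')" using R by algebra
    finally show "g (x \<otimes> y) = g x \<otimes> g y" using g x y by simp
  qed
  ultimately show ?thesis using that gK by blast
qed

end

section \<open>Normality in towers of square roots\<close>

text \<open>\<open>normal_over M K E\<close> says that E is normal over M, as far as automorphisms over M of the intermediate
  field K go, and Galois over K.\<close>

definition normal_over :: "'a set \<Rightarrow> 'a set \<Rightarrow> 'a set \<Rightarrow> bool" where
  "normal_over M K E \<longleftrightarrow>
     (\<forall>h\<in>homs K. (\<forall>x\<in>M. h x = x) \<longrightarrow> (\<exists>g\<in>homs E. \<forall>x\<in>K. g x = h x)) \<and>
     (\<forall>x\<in>E. (\<forall>g\<in>homs E. (\<forall>y\<in>K. g y = y) \<longrightarrow> g x = x) \<longrightarrow> x \<in> K)"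

lemma normal_over_refl: "normal_over M K K"
proof -
  have "\<forall>x\<in>E. (\<forall>g\<in>homs E. (\<forall>y\<in>E. g y = y) \<longrightarrow> g x = x) \<longrightarrow> x \<in> E" for E by blast
  then show ?thesis unfolding normal_over_def by blast
qed

text \<open>Assumption \<open>sq\<close> provides a square root of the transported d d, so h extends
  to \<open>quad_ext K d\<close> and from there to E. For the fixed elements, sending d to -d
  extends to E and fixes K; if it also fixes x = u + v d, then 2 v d = 0, and x = u lies in K as 2
  is invertible.\<close>

lemma normal_over_step:
  assumes two: "\<one> \<oplus> \<one> \<noteq> \<zero>" and K: "subfield K R" and MK: "M \<subseteq> K"
    and d: "d \<in> carrier R" "d \<otimes> d \<in> K"
    and sq: "\<And>h. h \<in> homs K \<Longrightarrow> (\<And>x. x \<in> M \<Longrightarrow> h x = x) \<Longrightarrow> \<exists>d'\<in>carrier R. d' \<otimes> d' = h (d \<otimes> d)"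
    and N: "normal_over M (quad_ext K d) E"
  shows "normal_over M K E"
proof (cases "d \<in> K")
  case True
  then show ?thesis using N quad_ext_trivial[OF K d] by simp
next
  case False
  note c = subfield_closed[OF K]
  have ext: "\<exists>g\<in>homs E. (\<forall>x\<in>K. g x = h x) \<and> g d = d'"
    if h: "h \<in> homs K" "\<And>x. x \<in> M \<Longrightarrow> h x = x" and d': "d' \<in> carrier R" "d' \<otimes> d' = h (d \<otimes> d)" for h d'
  proof -
    obtain f where f: "f \<in> homs (quad_ext K d)" "\<And>x. x \<in> K \<Longrightarrow> f x = h x" "f d = d'"
      using quad_ext_hom[OF K d h(1) d' False] by blast
    moreover have "\<forall>x\<in>M. f x = x" using f(2) h(2) MK by auto
    ultimately obtain g where "g \<in> homs E" "\<forall>x\<in>quad_ext K d. g x = f x"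
      using N unfolding normal_over_def by blast
    then show ?thesis using f quad_ext_mem[OF K d] by (metis subsetD)
  qed
  show ?thesis
    unfolding normal_over_def
  proof (intro conjI ballI impI)
    fix h assume "h \<in> homs K" "\<forall>x\<in>M. h x = x"
    then show "\<exists>g\<in>homs E. \<forall>x\<in>K. g x = h x" using sq[of h] ext[of h] by blast
  next
    fix x assume x: "x \<in> E" "\<forall>g\<in>homs E. (\<forall>y\<in>K. g y = y) \<longrightarrow> g x = x"
    have "\<forall>g\<in>homs E. (\<forall>y\<in>quad_ext K d. g y = y) \<longrightarrow> g x = x"
      using x(2) quad_ext_mem(1)[OF K d] by blast
    then have "x \<in> quad_ext K d" using N x(1) unfolding normal_over_def by blast
    then obtain u v where uv: "x = u \<oplus> v \<otimes> d" "u \<in> K" "v \<in> K" unfolding quad_ext_def by blast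
    have uvR: "u \<in> carrier R" "v \<in> carrier R" using uv c(1) by auto
    have id: "(\<lambda>x. x) \<in> homs K" using c(1) by (intro homsI) auto
    obtain f where f: "f \<in> homs (quad_ext K d)" "\<And>x. x \<in> K \<Longrightarrow> f x = x" "f d = \<ominus> d"
      using quad_ext_hom[OF K d id, of "\<ominus> d"] False d(1) by (auto simp: l_minus r_minus)
    have "\<forall>x\<in>M. f x = x" using f(2) MK by auto
    then obtain g where g: "g \<in> homs E" "\<forall>y\<in>quad_ext K d. g y = f y"
      using f(1) N unfolding normal_over_def by blast
    then have "\<forall>y\<in>K. g y = y" using f(2) quad_ext_mem(1)[OF K d] by auto
    then have "f x = x" using x(2) g \<open>x \<in> quad_ext K d\<close> by auto
    moreover have "f x = u \<oplus> v \<otimes> (\<ominus> d)"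
    proof -
      note q = quad_ext_mem[OF K d] subfield_closed(5)[OF quad_ext_subfield[OF K d]]
      have m: "u \<in> quad_ext K d" "v \<in> quad_ext K d" "v \<otimes> d \<in> quad_ext K d" using q uv by auto
      show ?thesis
        unfolding uv(1) using homsD(2,3)[OF f(1)] m q(2) f(2,3) uv(2,3) by simp
    qed
    ultimately have e: "u \<oplus> v \<otimes> d = u \<oplus> v \<otimes> (\<ominus> d)" using uv(1) by simp
    have "(\<one> \<oplus> \<one>) \<otimes> (v \<otimes> d) = (u \<oplus> v \<otimes> d) \<ominus> (u \<oplus> v \<otimes> (\<ominus> d))"
      using uvR d(1) by algebra
    also have "\<dots> = \<zero>" unfolding e using uvR d(1) by (simp add: minus_eq r_neg)
    finally have "v \<otimes> d = \<zero>" using integral[of "\<one> \<oplus> \<one>" "v \<otimes> d"] two uvR d(1) by auto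
    then show "x \<in> K" using uv uvR by simp
  qed
qed

end

context field
begin

text \<open>With minimality of a generated field this shows that homomorphisms agreeing on
  generators agree everywhere, without induction over the elements generated.\<close>

lemma homs_equalizer:
  assumes E: "subfield E R" and g: "g \<in> homs E" and h: "h \<in> homs E"
  shows "subfield {x \<in> E. g x = h x} R"
proof (rule subfieldI')
  note c = subfield_closed[OF E]
  show "subring {x \<in> E. g x = h x} R"
    by (rule subringI)
      (use c in \<open>auto simp: homsD(4)[OF g] homsD(4)[OF h] homs_simps(2)[OF E g] homs_simps(2)[OF E h]
        homsD(2,3)[OF g] homsD(2,3)[OF h]\<close>)
  show "inv k \<in> {x \<in> E. g x = h x}" if "k \<in> {x \<in> E. g x = h x} - {\<zero>}" for k
    using that c(8)[of k] by (simp add: homs_simps(6)[OF E g] homs_simps(6)[OF E h])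
qed

lemma homs_stable_subfield:
  assumes E: "subfield E R" and h: "h \<in> homs E"
  shows "subfield {x \<in> E. h x \<in> E} R"
proof (rule subfieldI')
  note c = subfield_closed[OF E]
  show "subring {x \<in> E. h x \<in> E} R"
    by (rule subringI)
      (use c in \<open>auto simp: homsD(4)[OF h] homs_simps(2)[OF E h] homsD(2,3)[OF h]\<close>)
  show "inv k \<in> {x \<in> E. h x \<in> E}" if "k \<in> {x \<in> E. h x \<in> E} - {\<zero>}" for k
    using that c(8)[of k] c(8)[of "h k"] homs_simps(4)[OF E h, of k]
    by (simp add: homs_simps(6)[OF E h])
qed

section \<open>Biquadratic extensions\<close>

text \<open>A tower of square roots from K up to K(x, y). The square of d = x x - y y is (x x + y
  y)^2 - 4 (x x)(y y) and lies in K; then x x and y y are half the sum and half the difference of x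
  x + y y and d, so x and y are square roots over K(d).\<close>

definition biquad_ext :: "'a set \<Rightarrow> 'a \<Rightarrow> 'a \<Rightarrow> 'a set" where
  "biquad_ext K x y = quad_ext (quad_ext (quad_ext K (x \<otimes> x \<ominus> y \<otimes> y)) x) y"

text \<open>h fixes the coefficients of (X - p)(X - q), so it sends the root p to p or q.\<close>

lemma hom_square_cases:
  assumes K: "subfield K R" and MK: "M \<subseteq> K" and h: "h \<in> homs K" "\<And>z. z \<in> M \<Longrightarrow> h z = z"
    and pq: "p \<in> K" "q \<in> carrier R" "p \<oplus> q \<in> M" "p \<otimes> q \<in> M"
  shows "h p = p \<or> h p = q"
proof -
  have pR: "p \<in> carrier R" using subfield_closed(1)[OF K] pq(1) by auto
  have hR: "h p \<in> carrier R" by (rule homsD(1)[OF h(1) pq(1)])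
  have MK': "p \<oplus> q \<in> K" "p \<otimes> q \<in> K" using pq MK by auto
  note c = subfield_closed[OF K]
  have e: "p \<otimes> p \<ominus> (p \<oplus> q) \<otimes> p \<oplus> p \<otimes> q = \<zero>" using pR pq(2) by algebra
  have "h (p \<otimes> p \<ominus> (p \<oplus> q) \<otimes> p \<oplus> p \<otimes> q) = h p \<otimes> h p \<ominus> (p \<oplus> q) \<otimes> h p \<oplus> p \<otimes> q"
    using c(5)[OF pq(1) pq(1)] c(5)[OF MK'(1) pq(1)] c(7)[OF c(5)[OF pq(1) pq(1)] c(5)[OF MK'(1) pq(1)]]
      MK' pq h(2) by (simp add: homsD(2,3)[OF h(1)] homs_simps(3)[OF K h(1)])
  then have z: "h p \<otimes> h p \<ominus> (p \<oplus> q) \<otimes> h p \<oplus> p \<otimes> q = \<zero>"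
    unfolding e homs_simps(1)[OF K h(1)] by simp
  have "(h p \<ominus> p) \<otimes> (h p \<ominus> q) = h p \<otimes> h p \<ominus> (p \<oplus> q) \<otimes> h p \<oplus> p \<otimes> q"
    using pR pq(2) hR by algebra
  then have "(h p \<ominus> p) \<otimes> (h p \<ominus> q) = \<zero>" unfolding z .
  then have "h p \<ominus> p = \<zero> \<or> h p \<ominus> q = \<zero>" by (rule integral) (use pR pq hR in simp_all)
  then show ?thesis using pR pq hR by simp
qed

context
  fixes M K x y
  assumes two: "\<one> \<oplus> \<one> \<noteq> \<zero>" and K: "subfield K R" and MK: "M \<subseteq> K"
    and xy: "x \<in> carrier R" "y \<in> carrier R"
    and coeffs: "x \<otimes> x \<oplus> y \<otimes> y \<in> M" "(x \<otimes> x) \<otimes> (y \<otimes> y) \<in> M"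
begin

private definition "d = x \<otimes> x \<ominus> y \<otimes> y"

private lemma dR: "d \<in> carrier R" using xy by (simp add: d_def)

private lemma dd: "d \<otimes> d = (x \<otimes> x \<oplus> y \<otimes> y) \<otimes> (x \<otimes> x \<oplus> y \<otimes> y) \<ominus>
    (\<one> \<oplus> \<one>) \<otimes> (\<one> \<oplus> \<one>) \<otimes> ((x \<otimes> x) \<otimes> (y \<otimes> y))"
  unfolding d_def using xy by algebra

private lemma ddM: "subfield M' R \<Longrightarrow> M \<subseteq> M' \<Longrightarrow> d \<otimes> d \<in> M'"
proof -
  assume a: "subfield M' R" "M \<subseteq> M'"
  note c = subfield_closed[OF a(1)]
  have 1: "x \<otimes> x \<oplus> y \<otimes> y \<in> M'" "(x \<otimes> x) \<otimes> (y \<otimes> y) \<in> M'" using coeffs a by auto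
  then show ?thesis unfolding dd using c(3-7) by simp
qed

private lemma K1: "subfield (quad_ext K d) R"
  by (rule quad_ext_subfield[OF K dR ddM[OF K MK]])

private lemma squares: "x \<otimes> x \<in> quad_ext K d" "y \<otimes> y \<in> quad_ext K d"
proof -
  note c = subfield_closed[OF K1] and m = quad_ext_mem[OF K dR ddM[OF K MK]]
  have s: "x \<otimes> x \<oplus> y \<otimes> y \<in> quad_ext K d" using coeffs MK m(1) by auto
  have t: "inv (\<one> \<oplus> \<one>) \<in> quad_ext K d" using c(8)[OF c(4)[OF c(3) c(3)] two] .
  have tR: "inv (\<one> \<oplus> \<one>) \<in> carrier R" using t c(1) by auto
  have "x \<otimes> x = ((\<one> \<oplus> \<one>) \<otimes> inv (\<one> \<oplus> \<one>)) \<otimes> (x \<otimes> x)" using two xy by (simp add: field_Units)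
  also have "\<dots> = inv (\<one> \<oplus> \<one>) \<otimes> ((x \<otimes> x \<oplus> y \<otimes> y) \<oplus> d)" unfolding d_def using xy tR by algebra
  finally show x: "x \<otimes> x \<in> quad_ext K d" using c(5)[OF t c(4)[OF s m(2)]] by simp
  have "y \<otimes> y = (x \<otimes> x \<oplus> y \<otimes> y) \<ominus> x \<otimes> x" using xy by algebra
  then show "y \<otimes> y \<in> quad_ext K d" using c(7)[OF s x] by simp
qed

private lemma K2: "subfield (quad_ext (quad_ext K d) x) R"
  by (rule quad_ext_subfield[OF K1 xy(1) squares(1)])

private lemma yy: "y \<otimes> y \<in> quad_ext (quad_ext K d) x"
  using squares(2) quad_ext_mem(1)[OF K1 xy(1) squares(1)] by auto

lemma biquad_ext_subfield: "subfield (biquad_ext K x y) R"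
  unfolding biquad_ext_def d_def[symmetric] by (rule quad_ext_subfield[OF K2 xy(2) yy])

lemma biquad_ext_mem: "K \<subseteq> biquad_ext K x y" "x \<in> biquad_ext K x y" "y \<in> biquad_ext K x y"
  using quad_ext_mem[OF K dR ddM[OF K MK]] quad_ext_mem[OF K1 xy(1) squares(1)]
    quad_ext_mem[OF K2 xy(2) yy]
  unfolding biquad_ext_def d_def[symmetric] by blast+

lemma biquad_ext_minimal:
  assumes "subfield E R" "K \<subseteq> E" "x \<in> E" "y \<in> E"
  shows "biquad_ext K x y \<subseteq> E"
proof -
  have "d \<in> E" unfolding d_def using subfield_closed(5,7)[OF assms(1)] assms by simp
  then show ?thesis unfolding biquad_ext_def d_def[symmetric]
    using quad_ext_minimal[OF K dR ddM[OF K MK] assms(1)]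
      quad_ext_minimal[OF K1 xy(1) squares(1) assms(1)] quad_ext_minimal[OF K2 xy(2) yy assms(1)] assms
    by simp
qed

text \<open>Three square roots are adjoined. The image of each adjoined square must be a square in
  R: d d lies in M and is fixed, and \<open>hom_square_cases\<close> sends x x and y y to one of x x
  and y y.\<close>

lemma normal_over_biquad_step:
  assumes M: "subfield M R" and N: "normal_over M (biquad_ext K x y) E"
  shows "normal_over M K E"
proof (rule normal_over_step[OF two K MK dR ddM[OF K MK]])
  have MK1: "M \<subseteq> quad_ext K d" using MK quad_ext_mem(1)[OF K dR ddM[OF K MK]] by blast
  then have MK2: "M \<subseteq> quad_ext (quad_ext K d) x" using quad_ext_mem(1)[OF K1 xy(1) squares(1)] by blast
  show "\<exists>d'\<in>carrier R. d' \<otimes> d' = h (d \<otimes> d)" if "\<And>z. z \<in> M \<Longrightarrow> h z = z" for h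
    using that[OF ddM[OF M]] dR by auto
  show "normal_over M (quad_ext K d) E"
  proof (rule normal_over_step[OF two K1 MK1 xy(1) squares(1)])
    show "\<exists>d'\<in>carrier R. d' \<otimes> d' = h (x \<otimes> x)"
      if "h \<in> homs (quad_ext K d)" "\<And>z. z \<in> M \<Longrightarrow> h z = z" for h
      using hom_square_cases[OF K1 MK1 that squares(1) _ coeffs] xy by auto
    show "normal_over M (quad_ext (quad_ext K d) x) E"
    proof (rule normal_over_step[OF two K2 MK2 xy(2) yy])
      show "\<exists>d'\<in>carrier R. d' \<otimes> d' = h (y \<otimes> y)"
        if "h \<in> homs (quad_ext (quad_ext K d) x)" "\<And>z. z \<in> M \<Longrightarrow> h z = z" for h
      proof -
        have "y \<otimes> y \<oplus> x \<otimes> x \<in> M" "(y \<otimes> y) \<otimes> (x \<otimes> x) \<in> M"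
          using coeffs xy by (simp_all add: a_comm m_comm)
        from hom_square_cases[OF K2 MK2 that yy _ this] show ?thesis using xy by auto
      qed
      show "normal_over M (quad_ext (quad_ext (quad_ext K d) x) y) E"
        using N unfolding biquad_ext_def d_def .
    qed
  qed
qed

end

end

section \<open>The roots of one quartic\<close>

primrec root_at :: "(nat \<Rightarrow> 'a) \<Rightarrow> ix \<Rightarrow> 'a" where
  "root_at \<alpha> I1 = \<alpha> 1" | "root_at \<alpha> I2 = \<alpha> 2" | "root_at \<alpha> I3 = \<alpha> 3" | "root_at \<alpha> I4 = \<alpha> 4"

lemma range_root_at: "range (root_at \<alpha>) = \<alpha> ` {1..4}"
proof -
  have 1: "UNIV = {I1, I2, I3, I4}" using ix.exhaust by blast
  have 2: "{1..4} = {1, 2, 3, 4::nat}" by auto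
  show ?thesis unfolding 1 2 by simp
qed

text \<open>The quartic is represented by its roots. The two elements in \<open>coeffs\<close> are
  -a and b, because the squares of the roots are the two roots of T^2 + a T + b.\<close>

locale signed_roots = field R for R (structure) +
  fixes M :: "'a set" and \<alpha> :: "nat \<Rightarrow> 'a"
  assumes M: "subfield M R"
    and roots: "\<alpha> 1 \<in> carrier R" "\<alpha> 2 \<in> carrier R" "\<alpha> 3 = \<ominus> \<alpha> 1" "\<alpha> 4 = \<ominus> \<alpha> 2"
    and inj: "inj_on \<alpha> {1..4}"
    and coeffs: "\<alpha> 1 \<otimes> \<alpha> 1 \<oplus> \<alpha> 2 \<otimes> \<alpha> 2 \<in> M" "(\<alpha> 1 \<otimes> \<alpha> 1) \<otimes> (\<alpha> 2 \<otimes> \<alpha> 2) \<in> M"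
begin

definition L :: "'a set" where "L = biquad_ext M (\<alpha> 1) (\<alpha> 2)"

text \<open>If 2 were zero, \<open>\<alpha> 1\<close> would equal its negative
  \<open>\<alpha> 3\<close>, against the distinctness of the roots.\<close>

lemma two: "\<one> \<oplus> \<one> \<noteq> \<zero>"
proof
  assume "\<one> \<oplus> \<one> = \<zero>"
  then have "(\<one> \<oplus> \<one>) \<otimes> \<alpha> 1 = \<zero>" using roots by simp
  then have "\<alpha> 1 \<oplus> \<alpha> 1 = \<zero>" using roots by (simp add: l_distr)
  then have "\<alpha> 1 = \<alpha> 3" using roots minus_equality[of "\<alpha> 1" "\<alpha> 1"] by simp
  then show False using inj by (auto dest: inj_onD)
qed

lemma inj_root_at: "inj (root_at \<alpha>)"
proof (rule injI)
  fix i j assume "root_at \<alpha> i = root_at \<alpha> j"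
  then show "i = j" using inj by (cases i; cases j) (auto dest: inj_onD)
qed

lemma root_at_carrier: "root_at \<alpha> i \<in> carrier R"
  using roots by (cases i) auto

lemma root_at_r2: "root_at \<alpha> (perm_app r2 i) = \<ominus> (root_at \<alpha> i)"
  using roots by (cases i) auto

lemma root_at_squares: "root_at \<alpha> i \<otimes> root_at \<alpha> i = \<alpha> 1 \<otimes> \<alpha> 1 \<or> root_at \<alpha> i \<otimes> root_at \<alpha> i = \<alpha> 2 \<otimes> \<alpha> 2"
  using roots by (cases i) (auto simp: l_minus r_minus)

lemma L_subfield: "subfield L R" and L_mem: "M \<subseteq> L" "\<alpha> 1 \<in> L" "\<alpha> 2 \<in> L"
  unfolding L_def using biquad_ext_subfield[OF two M subset_refl roots(1,2) coeffs]
    biquad_ext_mem[OF two M subset_refl roots(1,2) coeffs] by simp_all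

lemma root_at_in:
  assumes "subfield E R" "\<alpha> 1 \<in> E" "\<alpha> 2 \<in> E"
  shows "root_at \<alpha> i \<in> E"
  using assms(2,3) subfield_closed(6)[OF assms(1)] roots by (cases i) auto

lemma L_minimal:
  assumes "subfield E R" "M \<subseteq> E" "\<And>i. root_at \<alpha> i \<in> E"
  shows "L \<subseteq> E"
  unfolding L_def using biquad_ext_minimal[OF two M subset_refl roots(1,2) coeffs assms(1,2)]
    assms(3)[of I1] assms(3)[of I2] by simp

text \<open>The square of a root goes to the square of a root, so a root goes to plus or minus a
  root. The induced map on indices is injective and commutes with negation \<open>r2\<close>; it is
  determined by the images of \<open>I1\<close> and \<open>I2\<close>, which leaves the eight
  elements of \<open>d8\<close>.\<close>

lemma hom_root_at:
  assumes E: "subfield E R" "L \<subseteq> E" and h: "h \<in> homs E" "\<And>x. x \<in> M \<Longrightarrow> h x = x"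
  obtains p where "p \<in> set d8" "\<And>i. h (root_at \<alpha> i) = root_at \<alpha> (perm_app p i)"
proof -
  have rE: "root_at \<alpha> i \<in> E" for i using root_at_in[OF E(1)] L_mem E(2) by blast
  have ME: "M \<subseteq> E" using L_mem E(2) by blast
  have ex: "\<exists>j. h (root_at \<alpha> i) = root_at \<alpha> j" for i
  proof -
    let ?x = "root_at \<alpha> i"
    note c = subfield_closed[OF E(1)]
    have sq: "\<alpha> 1 \<otimes> \<alpha> 1 \<in> E" "\<alpha> 2 \<otimes> \<alpha> 2 \<in> E" using c(5) rE[of I1] rE[of I2] by simp_all
    have coeffs': "\<alpha> 2 \<otimes> \<alpha> 2 \<oplus> \<alpha> 1 \<otimes> \<alpha> 1 \<in> M" "(\<alpha> 2 \<otimes> \<alpha> 2) \<otimes> (\<alpha> 1 \<otimes> \<alpha> 1) \<in> M"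
      using coeffs roots by (simp_all add: a_comm m_comm)
    have "h ?x \<otimes> h ?x = h (?x \<otimes> ?x)" using homsD(2)[OF h(1) rE rE] by simp
    also have "\<dots> = \<alpha> 1 \<otimes> \<alpha> 1 \<or> \<dots> = \<alpha> 2 \<otimes> \<alpha> 2"
      using root_at_squares[of i] hom_square_cases[OF E(1) ME h sq(1) _ coeffs]
        hom_square_cases[OF E(1) ME h sq(2) _ coeffs'] roots by auto
    finally have "h ?x \<otimes> h ?x = root_at \<alpha> I1 \<otimes> root_at \<alpha> I1 \<or> h ?x \<otimes> h ?x = root_at \<alpha> I2 \<otimes> root_at \<alpha> I2"
      by simp
    then obtain j where "h ?x \<otimes> h ?x = root_at \<alpha> j \<otimes> root_at \<alpha> j" by blast
    then have "h ?x = root_at \<alpha> j \<or> h ?x = \<ominus> root_at \<alpha> j"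
      by (rule square_eq_square[OF homsD(1)[OF h(1) rE] root_at_carrier])
    then show ?thesis using root_at_r2[of j] by metis
  qed
  then obtain f where f: "\<And>i. h (root_at \<alpha> i) = root_at \<alpha> (f i)" by metis
  have neg: "f (perm_app r2 i) = perm_app r2 (f i)" for i
  proof -
    have "root_at \<alpha> (f (perm_app r2 i)) = root_at \<alpha> (perm_app r2 (f i))"
      using f[of "perm_app r2 i"] f[of i] root_at_r2[of i] root_at_r2[of "f i"]
        homs_simps(2)[OF E(1) h(1) rE, of i] by simp
    then show ?thesis by (rule injD[OF inj_root_at])
  qed
  have injf: "f i = f j \<Longrightarrow> i = j" for i j
    using f[of i] f[of j] inj_onD[OF homs_simps(5)[OF E(1) h(1)] _ rE rE, of i j] injD[OF inj_root_at, of i j] by simp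
  have "Perm4 (f I1) (f I2) (f I3) (f I4) \<in> set d8"
    using neg[of I1] neg[of I2] injf[of I1 I2] injf[of I1 I4]
    by (cases "f I1"; cases "f I2") (auto simp: d8_def)
  moreover have "perm_app (Perm4 (f I1) (f I2) (f I3) (f I4)) i = f i" for i
    by (cases i) simp_all
  ultimately show ?thesis using that f by metis
qed

end

section \<open>Linear independence of homomorphisms\<close>

context field
begin

lemma hom_finsum:
  assumes E: "subfield E R" and h: "h \<in> homs E" and "finite A" and "\<And>i. i \<in> A \<Longrightarrow> f i \<in> E"
  shows "finsum R f A \<in> E \<and> h (finsum R f A) = finsum R (\<lambda>i. h (f i)) A"
  using assms(3,4)
proof (induction A rule: finite_induct)
  case empty
  then show ?case using subfield_closed(2)[OF E] homs_simps(1)[OF E h] by simp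
next
  case (insert a A)
  note c = subfield_closed[OF E]
  have f: "f \<in> A \<rightarrow> carrier R" "f a \<in> carrier R" using insert.prems c(1) by auto
  have hf: "(\<lambda>i. h (f i)) \<in> A \<rightarrow> carrier R" "h (f a) \<in> carrier R"
    using insert.prems homsD(1)[OF h] by auto
  show ?case
    using insert c(4) homsD(3)[OF h] by (simp add: finsum_insert[OF insert.hyps f] finsum_insert[OF insert.hyps hf])
qed

theorem dedekind_independence:
  assumes E: "subfield E R"
  shows "finite A \<Longrightarrow> A \<subseteq> homs E \<inter> extensional E \<Longrightarrow> c \<in> A \<rightarrow> carrier R \<Longrightarrow>
    (\<And>x. x \<in> E \<Longrightarrow> finsum R (\<lambda>h. c h \<otimes> h x) A = \<zero>) \<Longrightarrow> h \<in> A \<Longrightarrow> c h = \<zero>"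
proof (induction A arbitrary: c h rule: finite_induct)
  case (insert g A)
  note cl = subfield_closed[OF E]
  have gE: "g \<in> homs E" "g \<in> extensional E" and AE: "A \<subseteq> homs E \<inter> extensional E" using insert.prems by auto
  have cR: "c g \<in> carrier R" "\<And>f. f \<in> A \<Longrightarrow> c f \<in> carrier R" using insert.prems(2) by auto
  have hR: "f x \<in> carrier R" if "f \<in> A" "x \<in> E" for f x using AE that homsD(1) by blast
  have gR: "g x \<in> carrier R" if "x \<in> E" for x using gE that homsD(1) by blast
  have rel: "c g \<otimes> g x \<oplus> finsum R (\<lambda>h. c h \<otimes> h x) A = \<zero>" if "x \<in> E" for x
    using insert.prems(3)[OF that] finsum_insert[OF insert.hyps, of "\<lambda>h. c h \<otimes> h x"] cR hR gR that by auto
  have ring_id: "t = (p \<otimes> (q \<otimes> r) \<oplus> (t \<oplus> q \<otimes> w)) \<ominus> q \<otimes> (p \<otimes> r \<oplus> w)"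
    if "t \<in> carrier R" "p \<in> carrier R" "q \<in> carrier R" "r \<in> carrier R" "w \<in> carrier R" for t p q r w
    using that by algebra
  have A0: "c f = \<zero>" if f: "f \<in> A" for f
  proof -
    have "f \<noteq> g" using f insert.hyps by auto
    \<comment> \<open>Both functions are extensional on E, so different ones already differ at a
      point of E.\<close>
    have "\<exists>z\<in>E. f z \<noteq> g z"
    proof (rule ccontr)
      assume "\<not> ?thesis"
      then have "f = g" using f AE gE(2) by (intro extensionalityI[of f E g]) auto
      then show False using \<open>f \<noteq> g\<close> by simp
    qed
    then obtain z where z: "z \<in> E" "f z \<noteq> g z" by blast
    \<comment> \<open>Take the relation at z x and subtract g z times the relation at x. The term of
      g cancels, and a relation between the elements of A with coefficients c' remains.\<close>
    define c' where "c' h = c h \<otimes> (h z \<ominus> g z)" for h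
    have c'R': "c' f \<in> carrier R" if "f \<in> A" for f using cR hR gR z that unfolding c'_def by auto
    then have c'R: "c' \<in> A \<rightarrow> carrier R" by auto
    have "finsum R (\<lambda>h. c' h \<otimes> h x) A = \<zero>" if x: "x \<in> E" for x
    proof -
      have zx: "z \<otimes> x \<in> E" using cl(5) z x by simp
      let ?S = "finsum R (\<lambda>h. c h \<otimes> h x) A"
      have SR: "?S \<in> carrier R" using cR hR x by (intro finsum_closed) auto
      have "finsum R (\<lambda>h. c h \<otimes> h (z \<otimes> x)) A =
          finsum R (\<lambda>h. c' h \<otimes> h x \<oplus> g z \<otimes> (c h \<otimes> h x)) A"
      proof (rule finsum_cong')
        fix h assume h: "h \<in> A"
        then have e: "h (z \<otimes> x) = h z \<otimes> h x" using AE homsD(2) z x by blast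
        show "c h \<otimes> h (z \<otimes> x) = c' h \<otimes> h x \<oplus> g z \<otimes> (c h \<otimes> h x)"
          unfolding e c'_def using cR(2)[OF h] hR[OF h z(1)] hR[OF h x] gR[OF z(1)] by algebra
      qed (use c'R' cR hR gR z x in auto)
      also have "\<dots> = finsum R (\<lambda>h. c' h \<otimes> h x) A \<oplus> finsum R (\<lambda>h. g z \<otimes> (c h \<otimes> h x)) A"
        by (rule finsum_addf) (use c'R' cR hR gR z x in auto)
      also have "finsum R (\<lambda>h. g z \<otimes> (c h \<otimes> h x)) A = g z \<otimes> ?S"
        by (rule finsum_rdistr[symmetric]) (use insert.hyps cR hR gR z x in auto)
      finally have e: "finsum R (\<lambda>h. c h \<otimes> h (z \<otimes> x)) A = finsum R (\<lambda>h. c' h \<otimes> h x) A \<oplus> g z \<otimes> ?S" .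
      have TR: "finsum R (\<lambda>h. c' h \<otimes> h x) A \<in> carrier R"
        using c'R hR x by (intro finsum_closed) auto
      have "c g \<otimes> (g z \<otimes> g x) \<oplus> (finsum R (\<lambda>h. c' h \<otimes> h x) A \<oplus> g z \<otimes> ?S) = \<zero>"
        using rel[OF zx] unfolding e homsD(2)[OF gE(1) z(1) x] .
      moreover have "g z \<otimes> (c g \<otimes> g x \<oplus> ?S) = \<zero>" using rel[OF x] gR[OF z(1)] by simp
      moreover have "finsum R (\<lambda>h. c' h \<otimes> h x) A =
          (c g \<otimes> (g z \<otimes> g x) \<oplus> (finsum R (\<lambda>h. c' h \<otimes> h x) A \<oplus> g z \<otimes> ?S)) \<ominus> g z \<otimes> (c g \<otimes> g x \<oplus> ?S)"
        using ring_id[OF TR cR(1) gR[OF z(1)] gR[OF x] SR] .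
      ultimately show ?thesis by (simp add: minus_eq)
    qed
    then have "c' f = \<zero>" using insert.IH[OF AE c'R _ f] by blast
    then have "c f = \<zero> \<or> f z \<ominus> g z = \<zero>"
      unfolding c'_def by (rule integral) (use cR hR gR f z in auto)
    then show ?thesis using z hR[OF f z(1)] gR[OF z(1)] by auto
  qed
  have "finsum R (\<lambda>h. c h \<otimes> h \<one>) A = \<zero>"
  proof -
    have "finsum R (\<lambda>h. c h \<otimes> h \<one>) A = finsum R (\<lambda>h. \<zero>) A"
      by (rule finsum_cong') (use A0 hR[OF _ cl(3)] in auto)
    then show ?thesis by simp
  qed
  then have "c g = \<zero>" using rel[OF cl(3)] homsD(4)[OF gE(1)] cR by simp
  then show ?case using A0 insert.prems(4) by blast
qed simp

end

text \<open>The Galois groups that occur here have exponent 4. Assuming this of all endomorphisms makes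
  endomorphisms invertible, with the cube as inverse.\<close>

locale exponent4_ext = field R for R (structure) +
  fixes M E :: "'a set"
  assumes M: "subfield M R" and E: "subfield E R" and ME: "M \<subseteq> E"
    and fourth: "\<And>h x. h \<in> homs E \<Longrightarrow> (\<And>y. y \<in> M \<Longrightarrow> h y = y) \<Longrightarrow> x \<in> E \<Longrightarrow>
      h x \<in> E \<and> h (h (h (h x))) = x"
begin

abbreviation "G \<equiv> Gal R E M"

text \<open>By \<open>fourth\<close>, the threefold iterate of s is an inverse of s on E, so
  bijectivity comes for free and only the homomorphism property has to be known.\<close>

lemma Gal_iff: "s \<in> carrier G \<longleftrightarrow> s \<in> extensional E \<and> s \<in> homs E \<and> (\<forall>x\<in>M. s x = x)"
proof
  assume "s \<in> carrier G"
  then have s: "s \<in> Bij E" "s \<in> ring_hom (R\<lparr>carrier := E\<rparr>) (R\<lparr>carrier := E\<rparr>)" "\<forall>x\<in>M. s x = x"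
    by (auto simp: Gal_def ring_iso_def)
  then have "s \<in> homs E" using subfield_closed(1)[OF E] by (auto simp: ring_hom_def)
  then show "s \<in> extensional E \<and> s \<in> homs E \<and> (\<forall>x\<in>M. s x = x)" using s by (auto simp: Bij_def)
next
  assume s: "s \<in> extensional E \<and> s \<in> homs E \<and> (\<forall>x\<in>M. s x = x)"
  then have f: "s x \<in> E" "s (s (s (s x))) = x" if "x \<in> E" for x using fourth[of s x] that by auto
  have b: "bij_betw s E E"
    by (rule bij_betw_byWitness[where f' = "\<lambda>x. s (s (s x))"]) (use f in auto)
  have "s \<in> ring_hom (R\<lparr>carrier := E\<rparr>) (R\<lparr>carrier := E\<rparr>)" using s f by (auto simp: ring_hom_def)
  then show "s \<in> carrier G" using s b by (auto simp: Gal_def ring_iso_def Bij_def)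
qed

lemma Gal_restrict:
  assumes "h \<in> homs E" "\<And>x. x \<in> M \<Longrightarrow> h x = x"
  shows "restrict h E \<in> carrier G"
proof -
  have "restrict h E \<in> homs E" using assms subfield_closed[OF E] by (auto simp: ring_hom_def)
  then show ?thesis using assms ME by (auto simp: Gal_iff)
qed

lemma GalD:
  assumes "s \<in> carrier G"
  shows "s \<in> homs E" "s \<in> extensional E" "\<And>x. x \<in> M \<Longrightarrow> s x = x" "\<And>x. x \<in> E \<Longrightarrow> s x \<in> E"
    "\<And>x. x \<in> E \<Longrightarrow> s (s (s (s x))) = x"
  using assms fourth[of s] by (auto simp: Gal_iff)

lemma Gal_mult:
  assumes "s \<in> carrier G" "t \<in> carrier G"
  shows "s \<otimes>\<^bsub>G\<^esub> t = compose E s t"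
  using assms by (simp add: Gal_def BijGroup_def)

lemma Gal_one: "\<one>\<^bsub>G\<^esub> = (\<lambda>x\<in>E. x)"
  by (simp add: Gal_def BijGroup_def)

lemma Gal_eqI:
  assumes "s \<in> carrier G" "t \<in> carrier G" "\<And>x. x \<in> E \<Longrightarrow> s x = t x"
  shows "s = t"
  using assms GalD(2) by (intro extensionalityI[of s E t]) auto

lemma Gal_compose:
  assumes "s \<in> carrier G" "t \<in> carrier G"
  shows "compose E s t \<in> carrier G"
proof -
  have "(\<lambda>x. s (t x)) \<in> homs E"
    using GalD[OF assms(1)] GalD[OF assms(2)] homsD[OF GalD(1)[OF assms(1)]] homsD[OF GalD(1)[OF assms(2)]]
    by (intro homsI) auto
  moreover have "s (t x) = x" if "x \<in> M" for x using GalD(3)[OF assms(1) that] GalD(3)[OF assms(2) that] by simp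
  ultimately show ?thesis using Gal_restrict[of "\<lambda>x. s (t x)"] by (simp add: compose_def)
qed

lemma Gal_id: "(\<lambda>x\<in>E. x) \<in> carrier G"
  using subfield_closed(1)[OF E] by (intro Gal_restrict homsI) auto

lemma Gal_group: "group G"
proof (rule groupI)
  fix s t u assume s: "s \<in> carrier G" and t: "t \<in> carrier G" and u: "u \<in> carrier G"
  show "s \<otimes>\<^bsub>G\<^esub> t \<in> carrier G" using s t by (simp add: Gal_mult Gal_compose)
  show "s \<otimes>\<^bsub>G\<^esub> t \<otimes>\<^bsub>G\<^esub> u = s \<otimes>\<^bsub>G\<^esub> (t \<otimes>\<^bsub>G\<^esub> u)"
  proof -
    have "u \<in> E \<rightarrow> E" using GalD(4)[OF u] by auto
    then show ?thesis
      using s t u by (simp only: Gal_mult Gal_compose compose_assoc)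
  qed
next
  fix s assume s: "s \<in> carrier G"
  show "\<one>\<^bsub>G\<^esub> \<otimes>\<^bsub>G\<^esub> s = s"
    unfolding Gal_one Gal_mult[OF Gal_id s] using GalD(2,4)[OF s] by (intro Id_compose) auto
  have "compose E s (compose E s s) \<in> carrier G" using s by (simp add: Gal_compose)
  moreover have "compose E s (compose E s s) \<otimes>\<^bsub>G\<^esub> s = \<one>\<^bsub>G\<^esub>"
    unfolding Gal_mult[OF calculation s] Gal_one
    using s GalD(4,5)[OF s] by (auto simp: compose_def)
  ultimately show "\<exists>t\<in>carrier G. t \<otimes>\<^bsub>G\<^esub> s = \<one>\<^bsub>G\<^esub>" by blast
qed (simp add: Gal_one Gal_id)

lemma Gal_inv_apply:
  assumes s: "s \<in> carrier G" and x: "x \<in> E"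
  shows "(inv\<^bsub>G\<^esub> s) (s x) = x" "(inv\<^bsub>G\<^esub> s) x = s (s (s x))"
proof -
  interpret G: group G by (rule Gal_group)
  have *: "(inv\<^bsub>G\<^esub> s) (s x) = x" if "x \<in> E" for x
    using G.l_inv[OF s] that unfolding Gal_mult[OF G.inv_closed[OF s] s] Gal_one
    by (metis compose_eq restrict_apply)
  show "(inv\<^bsub>G\<^esub> s) (s x) = x" by (rule *[OF x])
  show "(inv\<^bsub>G\<^esub> s) x = s (s (s x))"
    using *[of "s (s (s x))"] GalD(4,5)[OF s] x by simp
qed

section \<open>Fixed fields of subgroups of index 2\<close>

definition Fix :: "('a \<Rightarrow> 'a) set \<Rightarrow> 'a set" where
  "Fix U = {x \<in> E. \<forall>s\<in>U. s x = x}"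

lemma FixD: "x \<in> Fix U \<Longrightarrow> s \<in> U \<Longrightarrow> s x = x"
  unfolding Fix_def by blast

lemma Fix_subfield:
  assumes "U \<subseteq> carrier G"
  shows "subfield (Fix U) R"
proof (rule subfieldI')
  note c = subfield_closed[OF E]
  have U: "s \<in> homs E" if "s \<in> U" for s using GalD(1) assms that by blast
  have sub: "x \<oplus> y \<in> Fix U \<and> x \<otimes> y \<in> Fix U \<and> \<ominus> x \<in> Fix U" if xy: "x \<in> Fix U" "y \<in> Fix U" for x y
  proof -
    have E': "x \<in> E" "y \<in> E" using xy by (simp_all add: Fix_def)
    have "s (x \<oplus> y) = x \<oplus> y \<and> s (x \<otimes> y) = x \<otimes> y \<and> s (\<ominus> x) = \<ominus> x" if s: "s \<in> U" for s
      using homsD(2,3)[OF U[OF s] E'] homs_simps(2)[OF E U[OF s] E'(1)] FixD[OF xy(1) s] FixD[OF xy(2) s]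
      by simp
    then show ?thesis using E' c(4-6) unfolding Fix_def by simp
  qed
  have "\<one> \<in> Fix U" using c(3) homsD(4)[OF U] unfolding Fix_def by simp
  then show "subring (Fix U) R"
    using sub c(1) by (intro subringI) (auto simp: Fix_def)
  show "inv k \<in> Fix U" if "k \<in> Fix U - {\<zero>}" for k
  proof -
    have k: "k \<in> E" "k \<noteq> \<zero>" "k \<in> Fix U" using that by (auto simp: Fix_def)
    have "s (inv k) = inv k" if "s \<in> U" for s
      using homs_simps(6)[OF E U[OF that] k(1,2)] FixD[OF k(3) that] by simp
    then show ?thesis using c(8)[OF k(1,2)] unfolding Fix_def by simp
  qed
qed

text \<open>The element a acts on \<open>Fix U\<close> as an involution with fixed field
  \<open>Fix V\<close>. If it moves y, then d = y - a y is nonzero with a d = -d, and every x in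
  \<open>Fix U\<close> is (x + a x)/2 plus (x - a x)/(2 d) times d, with both coefficients in
  \<open>Fix V\<close>. So 1 and d form a basis.\<close>

lemma index2_Fix_dimension:
  assumes two: "\<one> \<oplus> \<one> \<noteq> \<zero>" and fin: "finite U"
    and U: "U \<subseteq> carrier G" "(\<lambda>x\<in>E. x) \<in> U" "\<And>s t. s \<in> U \<Longrightarrow> t \<in> U \<Longrightarrow> compose E s t \<in> U"
    and V: "U \<subseteq> V" "V \<subseteq> carrier G" "\<And>s t. s \<in> V \<Longrightarrow> t \<in> V \<Longrightarrow> compose E s t \<in> V"
    and a: "a \<in> V" "a \<notin> U" and split: "\<And>s. s \<in> V \<Longrightarrow> s \<in> U \<or> (\<exists>t\<in>U. s = compose E a t)"
  shows "dimension 2 (Fix V) (Fix U)"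
proof -
  note c = subfield_closed[OF E]
  have aG: "a \<in> carrier G" using a V by auto
  have UG: "s \<in> carrier G" if "s \<in> U" for s using that U by auto
  have cancel: "compose E (compose E s (compose E s s)) (compose E s t) = t"
    "compose E (compose E t s) (compose E s (compose E s s)) = t"
    if "s \<in> carrier G" "t \<in> carrier G" for s t
    using that GalD(4,5)[OF that(1)] GalD(4)[OF that(2)]
    by (intro Gal_eqI Gal_compose; simp add: compose_eq Gal_compose)+
  \<comment> \<open>If the square of a were in the coset a U, cancelling a would put a into
    U.\<close>
  have aa: "compose E a a \<in> U"
  proof (rule ccontr)
    assume "compose E a a \<notin> U"
    then obtain t where t: "t \<in> U" "compose E a a = compose E a t" using split V(3) a by blast
    then have "a = t" using cancel(1)[OF aG aG] cancel(1)[OF aG UG[OF t(1)]] by simp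
    then show False using a t by simp
  qed
  \<comment> \<open>A subgroup of index 2 is normal: s a is not in U, hence in the coset a U.
    Therefore a maps \<open>Fix U\<close> to itself.\<close>
  have normal: "\<exists>t\<in>U. compose E s a = compose E a t" if s: "s \<in> U" for s
  proof -
    have "compose E s a \<notin> U"
    proof
      assume "compose E s a \<in> U"
      then have "compose E (compose E s (compose E s s)) (compose E s a) \<in> U" using U(3) s by blast
      then show False using cancel(1)[OF UG[OF s] aG] a by simp
    qed
    moreover have "compose E s a \<in> V" using V s a by blast
    ultimately show ?thesis using split by blast
  qed
  have Fa: "a x \<in> Fix U" "a (a x) = x" if x: "x \<in> Fix U" for x
  proof -
    have xE: "x \<in> E" using x by (simp add: Fix_def)
    have "s (a x) = a x" if s: "s \<in> U" for s
    proof -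
      obtain t where t: "t \<in> U" "compose E s a = compose E a t" using normal[OF s] by blast
      then have "s (a x) = a (t x)" using xE by (metis compose_eq)
      then show ?thesis using FixD[OF x t(1)] by simp
    qed
    then show "a x \<in> Fix U" using GalD(4)[OF aG xE] by (simp add: Fix_def)
    have "compose E a a x = x" by (rule FixD[OF x aa])
    then show "a (a x) = x" using xE by (simp add: compose_eq)
  qed
  have FixV: "x \<in> Fix V" if "x \<in> Fix U" "a x = x" for x
  proof -
    have xE: "x \<in> E" using that by (simp add: Fix_def)
    have "s x = x" if "s \<in> V" for s
      using split[OF that]
    proof
      assume "\<exists>t\<in>U. s = compose E a t"
      then obtain t where t: "t \<in> U" "s = compose E a t" by blast
      then show ?thesis using FixD[OF \<open>x \<in> Fix U\<close> t(1)] \<open>a x = x\<close> xE by (simp add: compose_eq)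
    qed (rule FixD[OF \<open>x \<in> Fix U\<close>])
    then show ?thesis using xE by (simp add: Fix_def)
  qed
  have FVU: "Fix V \<subseteq> Fix U" using V(1) by (auto simp: Fix_def)
  have Va: "a x = x" if "x \<in> Fix V" for x by (rule FixD[OF that a(1)])
  have FU: "subfield (Fix U) R" and FV: "subfield (Fix V) R"
    using Fix_subfield U(1) V(2) by blast+
  note cU = subfield_closed[OF FU] and cV = subfield_closed[OF FV]
  have FE: "Fix U \<subseteq> E" by (auto simp: Fix_def)
  note aH = homsD[OF GalD(1)[OF aG]] homs_simps[OF E GalD(1)[OF aG]]
  \<comment> \<open>Otherwise all traces \<open>T x\<close> over U are fixed by a, a linear dependence between U and the coset aU.\<close>
  have "\<exists>y\<in>Fix U. a y \<noteq> y"
  proof (rule ccontr)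
    assume "\<not> ?thesis"
    then have triv: "a y = y" if "y \<in> Fix U" for y using that by blast
    define T where "T x = finsum R (\<lambda>s. s x) U" for x
    have TE: "T x \<in> E" and hT: "h (T x) = finsum R (\<lambda>s. h (s x)) U" if "x \<in> E" "h \<in> homs E" for x h
      using hom_finsum[OF E that(2) fin, of "\<lambda>s. s x"] GalD(4) U(1) that(1) unfolding T_def by blast+
    have TFix: "T x \<in> Fix U" if x: "x \<in> E" for x
    proof -
      have "s (T x) = T x" if s: "s \<in> U" for s
      proof -
        have inj: "inj_on (compose E s) U"
          by (rule inj_onI) (metis cancel(1)[OF UG[OF s]] UG)
        have "compose E s ` U = U"
          by (rule card_subset_eq[OF fin]) (use U(3) s card_image[OF inj] in auto)
        then have "T x = finsum R (\<lambda>t. t x) (compose E s ` U)" by (simp add: T_def)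
        also have "\<dots> = finsum R (\<lambda>t. compose E s t x) U"
          by (rule finsum_reindex[OF _ inj]) (use UG GalD(4) x c(1) Gal_compose s in blast)
        also have "\<dots> = s (T x)" using hT[OF x GalD(1)[OF UG[OF s]]] x by (simp add: compose_eq)
        finally show ?thesis by simp
      qed
      then show ?thesis using TE[OF x GalD(1)[OF aG]] by (simp add: Fix_def)
    qed
    define W where "W = compose E a ` U"
    have inja: "inj_on (compose E a) U"
      by (rule inj_onI) (metis cancel(1)[OF aG] UG)
    have disj: "U \<inter> W = {}"
    proof -
      have False if "t \<in> U" "compose E a t \<in> U" for t
      proof -
        have "compose E (compose E a t) (compose E t (compose E t t)) \<in> U" using that U(3) by blast
        then show False using cancel(2)[OF UG[OF that(1)] aG] a by simp
      qed
      then show ?thesis by (auto simp: W_def)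
    qed
    have WG: "s \<in> carrier G" if "s \<in> W" for s using that UG Gal_compose aG by (auto simp: W_def)
    have finW: "finite W" using fin by (simp add: W_def)
    have sR: "s x \<in> carrier R" if "s \<in> U \<union> W" "x \<in> E" for s x
      using that UG WG GalD(4) c(1) by blast
    define cf where "cf s = (if s \<in> U then \<one> else \<ominus> \<one>)" for s :: "'a \<Rightarrow> 'a"
    have "cf (\<lambda>x\<in>E. x) = \<zero>"
    proof (rule dedekind_independence[OF E, of "U \<union> W" cf])
      show "U \<union> W \<subseteq> homs E \<inter> extensional E" using UG WG GalD(1,2) by blast
      show "cf \<in> U \<union> W \<rightarrow> carrier R" by (simp add: cf_def)
    next
      fix x assume x: "x \<in> E"
      have "finsum R (\<lambda>h. cf h \<otimes> h x) (U \<union> W) =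
          finsum R (\<lambda>h. cf h \<otimes> h x) U \<oplus> finsum R (\<lambda>h. cf h \<otimes> h x) W"
        by (rule finsum_Un_disjoint[OF fin finW disj]) (use sR x in \<open>auto simp: cf_def\<close>)
      also have "finsum R (\<lambda>h. cf h \<otimes> h x) U = T x"
        unfolding T_def by (rule finsum_cong') (use sR x in \<open>auto simp: cf_def\<close>)
      also have "finsum R (\<lambda>h. cf h \<otimes> h x) W = finsum R (\<lambda>h. \<ominus> \<one> \<otimes> h x) W"
        by (rule finsum_cong') (use sR x disj in \<open>auto simp: cf_def\<close>)
      also have "\<dots> = \<ominus> \<one> \<otimes> finsum R (\<lambda>h. h x) W"
        by (rule finsum_rdistr[symmetric, OF finW]) (use sR x in auto)
      also have "finsum R (\<lambda>h. h x) W = finsum R (\<lambda>t. compose E a t x) U"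
        unfolding W_def by (rule finsum_reindex[OF _ inja]) (use sR x in \<open>auto simp: W_def\<close>)
      also have "\<dots> = a (T x)" using hT[OF x GalD(1)[OF aG]] x by (simp add: compose_eq)
      also have "\<dots> = T x" by (rule triv[OF TFix[OF x]])
      finally show "finsum R (\<lambda>h. cf h \<otimes> h x) (U \<union> W) = \<zero>"
        using TE[OF x GalD(1)[OF aG]] c(1) by (auto simp: l_minus r_neg)
    qed (use fin finW U(2) in auto)
    then show False using U(2) by (simp add: cf_def)
  qed
  then obtain y where y: "y \<in> Fix U" "a y \<noteq> y" by blast
  define d where "d = y \<ominus> a y"
  have dU: "d \<in> Fix U" unfolding d_def using cU(7)[OF y(1) Fa(1)[OF y(1)]] .
  have R: "x \<in> carrier R" if "x \<in> Fix U" for x using that cU(1) by auto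
  have d0: "d \<noteq> \<zero>" using y R[OF y(1)] R[OF Fa(1)[OF y(1)]] unfolding d_def by auto
  have ad: "a d = \<ominus> d"
  proof -
    have "a d = a y \<ominus> a (a y)" unfolding d_def using aH(7) y Fa(1)[OF y(1)] FE by blast
    also have "\<dots> = a y \<ominus> y" using Fa(2)[OF y(1)] by simp
    also have "\<dots> = \<ominus> d" unfolding d_def using R[OF y(1)] R[OF Fa(1)[OF y(1)]] by algebra
    finally show ?thesis .
  qed
  have idU: "inv d \<in> Fix U" by (rule cU(8)[OF dU d0])
  have t: "inv (\<one> \<oplus> \<one>) \<in> Fix V" using cV(8)[OF cV(4)[OF cV(3) cV(3)] two] .
  have "line_extension (Fix V) d (Fix V) = Fix U"
  proof
    show "line_extension (Fix V) d (Fix V) \<subseteq> Fix U"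
      using cU(4,5) subsetD[OF FVU] dU unfolding line_extension_def set_add_def' r_coset_def by auto
    show "Fix U \<subseteq> line_extension (Fix V) d (Fix V)"
    proof
      fix x assume x: "x \<in> Fix U"
      define u where "u = inv (\<one> \<oplus> \<one>) \<otimes> (x \<oplus> a x)"
      define v where "v = inv (\<one> \<oplus> \<one>) \<otimes> ((x \<ominus> a x) \<otimes> inv d)"
      have tU: "inv (\<one> \<oplus> \<one>) \<in> Fix U" using t FVU by auto
      note xs = x Fa(1)[OF x] dU idU tU
      have "u \<in> Fix U" "v \<in> Fix U" unfolding u_def v_def using xs cU(4,5,7) by simp_all
      have inE: "z \<in> E" if "z \<in> Fix U" for z using that FE by auto
      have "a u = u"
      proof -
        have "a u = a (inv (\<one> \<oplus> \<one>)) \<otimes> (a x \<oplus> a (a x))"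
          unfolding u_def using aH(2,3) inE xs cU(4) by simp
        also have "\<dots> = u" unfolding u_def using Va[OF t] Fa(2)[OF x] R xs by (simp add: a_comm)
        finally show ?thesis .
      qed
      have "a v = v"
      proof -
        have "a v = a (inv (\<one> \<oplus> \<one>)) \<otimes> ((a x \<ominus> a (a x)) \<otimes> inv (a d))"
          unfolding v_def using aH(2,7,10) inE xs cU(5,7) d0 by simp
        also have "\<dots> = inv (\<one> \<oplus> \<one>) \<otimes> ((a x \<ominus> x) \<otimes> inv (\<ominus> d))" using Va[OF t] Fa(2)[OF x] ad by simp
        also have "inv (\<ominus> d) = \<ominus> (inv d)"
        proof (rule comm_inv_char)
          have "(\<ominus> d) \<otimes> \<ominus> (inv d) = d \<otimes> inv d" using R[OF dU] R[OF idU] by algebra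
          then show "(\<ominus> d) \<otimes> \<ominus> (inv d) = \<one>" using d0 R[OF dU] by (simp add: field_Units)
        qed (use R dU idU in auto)
        also have "inv (\<one> \<oplus> \<one>) \<otimes> ((a x \<ominus> x) \<otimes> \<ominus> (inv d)) = v"
          unfolding v_def using R[OF x] R[OF Fa(1)[OF x]] R[OF idU] R[OF tU] by algebra
        finally show ?thesis .
      qed
      have "v \<otimes> d = inv (\<one> \<oplus> \<one>) \<otimes> (x \<ominus> a x) \<otimes> (d \<otimes> inv d)"
        unfolding v_def using R[OF x] R[OF Fa(1)[OF x]] R[OF idU] R[OF dU] R[OF tU] by algebra
      also have "d \<otimes> inv d = \<one>" using d0 R[OF dU] by (simp add: field_Units)
      finally have "v \<otimes> d \<oplus> u = (\<one> \<oplus> \<one>) \<otimes> inv (\<one> \<oplus> \<one>) \<otimes> x"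
        unfolding u_def using R[OF x] R[OF Fa(1)[OF x]] R[OF tU] by algebra
      also have "\<dots> = x" using two R[OF x] by (simp add: field_Units)
      finally have "x = v \<otimes> d \<oplus> u" by simp
      moreover have "u \<in> Fix V" "v \<in> Fix V"
        using FixV \<open>a u = u\<close> \<open>a v = v\<close> \<open>u \<in> Fix U\<close> \<open>v \<in> Fix U\<close> by blast+
      ultimately show "x \<in> line_extension (Fix V) d (Fix V)"
        unfolding line_extension_def set_add_def' r_coset_def by blast
    qed
  qed
  moreover have "d \<notin> Fix V"
  proof
    assume "d \<in> Fix V"
    then have "d = \<ominus> d" using Va ad by simp
    then have "(\<one> \<oplus> \<one>) \<otimes> d = \<zero>" using R[OF dU] by (metis l_distr l_one one_closed r_neg)
    then show False using integral[of "\<one> \<oplus> \<one>" d] two d0 R[OF dU] by auto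
  qed
  ultimately show ?thesis
    using Suc_dim[OF R[OF dU], of "Fix V" 1 "Fix V"] dimension_one[OF FV] by (simp add: numeral_2_eq_2)
qed

end

context field
begin

lemma homs_eqI:
  assumes "subfield E R" and "g \<in> homs E" "h \<in> homs E"
    and "\<And>F. subfield F R \<Longrightarrow> M \<subseteq> F \<Longrightarrow> S \<subseteq> F \<Longrightarrow> E \<subseteq> F" and "M \<subseteq> E" "S \<subseteq> E"
    and "\<And>x. x \<in> M \<Longrightarrow> g x = h x" "\<And>x. x \<in> S \<Longrightarrow> g x = h x" and "x \<in> E"
  shows "g x = h x"
  using assms(4)[OF homs_equalizer[OF assms(1-3)]] assms(5-9) by blast

lemma homs_subset: "h \<in> homs E \<Longrightarrow> K \<subseteq> E \<Longrightarrow> h \<in> homs K"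
  unfolding ring_hom_def by (auto simp: subset_eq)

text \<open>Both claims pass from S to E by minimality: the elements that h keeps in E form a
  subfield, and the fourth iterate of h is itself a homomorphism, to be compared with the
  identity.\<close>

lemma exponent4_extI:
  assumes M: "subfield M R" and E: "subfield E R" "M \<subseteq> E" "S \<subseteq> E"
    and gen: "\<And>F. subfield F R \<Longrightarrow> M \<subseteq> F \<Longrightarrow> S \<subseteq> F \<Longrightarrow> E \<subseteq> F"
    and S: "\<And>h x. h \<in> homs E \<Longrightarrow> (\<And>y. y \<in> M \<Longrightarrow> h y = y) \<Longrightarrow> x \<in> S \<Longrightarrow> h x \<in> S \<and> h (h (h (h x))) = x"
  shows "exponent4_ext R M E"
proof (rule exponent4_ext.intro[OF field_axioms exponent4_ext_axioms.intro[OF M E(1,2)]])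
  fix h x assume h: "h \<in> homs E" "\<And>y. y \<in> M \<Longrightarrow> h y = y" and x: "x \<in> E"
  have "E \<subseteq> {x \<in> E. h x \<in> E}"
  proof (rule gen[OF homs_stable_subfield[OF E(1) h(1)]])
    show "M \<subseteq> {x \<in> E. h x \<in> E}" using h(2) E(2) by auto
    show "S \<subseteq> {x \<in> E. h x \<in> E}" using S[OF h] E(3) by blast
  qed
  then have hE: "h x \<in> E" if "x \<in> E" for x using that by blast
  have "(\<lambda>x. h (h (h (h x)))) \<in> homs E"
    using hE homsD[OF h(1)] by (intro homsI) simp_all
  moreover have "(\<lambda>x. x) \<in> homs E" using subfield_closed(1)[OF E(1)] by (intro homsI) auto
  ultimately have "h (h (h (h x))) = x"
    by (rule homs_eqI[OF E(1) _ _ gen E(2,3) _ _ x]) (use h(2) S[OF h] in simp_all)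
  then show "h x \<in> E \<and> h (h (h (h x))) = x" using hE x by blast
qed

end

context exponent4_ext
begin

text \<open>The Galois correspondence for a field of the tower. \<open>normal_over\<close> speaks of
  arbitrary homomorphisms of E; restricting them to E turns them into elements of the group.\<close>

lemma Fix_normal_over:
  assumes N: "normal_over M K E" and K: "K \<subseteq> E" "M \<subseteq> K"
  shows "Fix {s \<in> carrier G. \<forall>y\<in>K. s y = y} = K"
proof
  show "K \<subseteq> Fix {s \<in> carrier G. \<forall>y\<in>K. s y = y}" using K by (auto simp: Fix_def)
  show "Fix {s \<in> carrier G. \<forall>y\<in>K. s y = y} \<subseteq> K"
  proof
    fix x assume x: "x \<in> Fix {s \<in> carrier G. \<forall>y\<in>K. s y = y}"
    then have xE: "x \<in> E" by (simp add: Fix_def)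
    have "g x = x" if g: "g \<in> homs E" "\<forall>y\<in>K. g y = y" for g
    proof -
      have "restrict g E \<in> carrier G" by (rule Gal_restrict) (use g K in auto)
      then have "restrict g E \<in> {s \<in> carrier G. \<forall>y\<in>K. s y = y}" using g K by auto
      from FixD[OF x this] show ?thesis using xE by simp
    qed
    then show "x \<in> K" using N xE unfolding normal_over_def by blast
  qed
qed

end

section \<open>The Galois group of one quartic as a permutation group\<close>

context signed_roots
begin

definition perm_of :: "('a \<Rightarrow> 'a) \<Rightarrow> perm4" where
  "perm_of h = (THE p. \<forall>i. h (root_at \<alpha> i) = root_at \<alpha> (perm_app p i))"

lemma perm_of_eqI:
  assumes "\<And>i. h (root_at \<alpha> i) = root_at \<alpha> (perm_app p i)"
  shows "perm_of h = p"
  unfolding perm_of_def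
proof (rule the_equality)
  fix q assume "\<forall>i. h (root_at \<alpha> i) = root_at \<alpha> (perm_app q i)"
  then have "root_at \<alpha> (perm_app q i) = root_at \<alpha> (perm_app p i)" for i using assms by metis
  then show "q = p" by (intro perm_eqI injD[OF inj_root_at])
qed (use assms in blast)

lemma perm_of:
  assumes "subfield E R" "L \<subseteq> E" "h \<in> homs E" "\<And>x. x \<in> M \<Longrightarrow> h x = x"
  shows "perm_of h \<in> set d8" "h (root_at \<alpha> i) = root_at \<alpha> (perm_app (perm_of h) i)"
proof -
  obtain p where p: "p \<in> set d8" "\<And>i. h (root_at \<alpha> i) = root_at \<alpha> (perm_app p i)"
    using hom_root_at[OF assms] by blast
  then have "perm_of h = p" by (intro perm_of_eqI)
  then show "perm_of h \<in> set d8" "h (root_at \<alpha> i) = root_at \<alpha> (perm_app (perm_of h) i)"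
    using p by simp_all
qed

lemma root_at_L: "root_at \<alpha> i \<in> L"
  using root_at_in[OF L_subfield L_mem(2,3)] .

lemma L_gen: "subfield F R \<Longrightarrow> M \<subseteq> F \<Longrightarrow> range (root_at \<alpha>) \<subseteq> F \<Longrightarrow> L \<subseteq> F"
  using L_minimal by blast

lemma hom_fourth_root_at:
  assumes "subfield E R" "L \<subseteq> E" "h \<in> homs E" "\<And>x. x \<in> M \<Longrightarrow> h x = x"
  shows "h (h (h (h (root_at \<alpha> i)))) = root_at \<alpha> i"
  using d8_inverse[OF perm_of(1)[OF assms]] by (metis perm_of(2)[OF assms] perm_app_mult perm_app_one)

sublocale X: exponent4_ext R M L
proof (rule exponent4_extI[OF M L_subfield L_mem(1) _ L_gen])
  fix h x assume h: "h \<in> homs L" "\<And>y. y \<in> M \<Longrightarrow> h y = y" and "x \<in> range (root_at \<alpha>)"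
  then obtain i where "x = root_at \<alpha> i" by blast
  then show "h x \<in> range (root_at \<alpha>) \<and> h (h (h (h x))) = x"
    using perm_of(2)[OF L_subfield subset_refl h] hom_fourth_root_at[OF L_subfield subset_refl h] by simp
qed (use root_at_L in auto)

lemma perm_of_compose:
  assumes E: "exponent4_ext R M E" "L \<subseteq> E"
    and s: "s \<in> carrier (Gal R E M)" "t \<in> carrier (Gal R E M)"
  shows "perm_of (compose E s t) = perm_mult (perm_of s) (perm_of t)"
proof (rule perm_of_eqI)
  interpret E: exponent4_ext R M E by fact
  fix i
  show "compose E s t (root_at \<alpha> i) = root_at \<alpha> (perm_app (perm_mult (perm_of s) (perm_of t)) i)"
    using perm_of(2)[OF E.E E(2) E.GalD(1,3)[OF s(1)]] perm_of(2)[OF E.E E(2) E.GalD(1,3)[OF s(2)]]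
      root_at_L E(2) by (simp add: compose_eq subsetD)
qed

lemma perm_of_id: "L \<subseteq> E \<Longrightarrow> perm_of (\<lambda>x\<in>E. x) = r0"
  by (rule perm_of_eqI) (use root_at_L in \<open>auto simp: perm_app_one simp del: perm_app.simps\<close>)

text \<open>The diagonal pairs (p, p) embed a single permutation group among groups of pairs, so
  that the certificates for pairs also identify the Galois group of one quartic.\<close>

lemma Gal_iso_perms:
  "Gal R L M \<cong> pp_group ((\<lambda>p. (p, p)) ` perm_of ` carrier (Gal R L M))"
proof -
  let ?f = "\<lambda>s. (perm_of s, perm_of s)"
  have "inj_on ?f (carrier (Gal R L M))"
  proof (rule inj_onI)
    fix s t assume s: "s \<in> carrier (Gal R L M)" and t: "t \<in> carrier (Gal R L M)" and e: "?f s = ?f t"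
    show "s = t"
    proof (rule X.Gal_eqI[OF s t])
      fix x assume x: "x \<in> L"
      show "s x = t x"
      proof (rule homs_eqI[OF L_subfield X.GalD(1)[OF s] X.GalD(1)[OF t] L_gen L_mem(1)])
        show "s x = t x" if "x \<in> range (root_at \<alpha>)" for x
          using that e perm_of(2)[OF L_subfield subset_refl X.GalD(1,3)[OF s]]
            perm_of(2)[OF L_subfield subset_refl X.GalD(1,3)[OF t]] by auto
      qed (use root_at_L X.GalD(3)[OF s] X.GalD(3)[OF t] x in auto)
    qed
  qed
  moreover have "?f (s \<otimes>\<^bsub>Gal R L M\<^esub> t) = pp_mult (?f s) (?f t)"
    if "s \<in> carrier (Gal R L M)" "t \<in> carrier (Gal R L M)" for s t
    using perm_of_compose[OF X.exponent4_ext_axioms subset_refl that] X.Gal_mult[OF that]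
    by (simp add: pp_mult_def)
  ultimately have "?f \<in> iso (Gal R L M) (pp_group ((\<lambda>p. (p, p)) ` perm_of ` carrier (Gal R L M)))"
    by (auto simp: iso_def hom_def bij_betw_def pp_group_def image_image)
  then show ?thesis by (auto simp: is_iso_def)
qed

lemma order_Gal: "order (Gal R L M) = card (perm_of ` carrier (Gal R L M))"
  using iso_same_card[OF Gal_iso_perms] unfolding order_def pp_group_def
  by (simp add: card_image inj_on_def)

lemma fixes_L_iff:
  assumes E: "exponent4_ext R M E" "L \<subseteq> E" and s: "s \<in> carrier (Gal R E M)"
  shows "(\<forall>y\<in>L. s y = y) \<longleftrightarrow> perm_of s = r0"
proof
  assume "\<forall>y\<in>L. s y = y"
  then show "perm_of s = r0"
    by (intro perm_of_eqI) (use root_at_L in \<open>simp only: perm_app_one\<close>)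
next
  interpret E: exponent4_ext R M E by fact
  assume e: "perm_of s = r0"
  have id: "(\<lambda>x. x) \<in> homs L" using subfield_closed(1)[OF L_subfield] by (intro homsI) auto
  note sL = homs_subset[OF E.GalD(1)[OF s] E(2)]
  show "\<forall>y\<in>L. s y = y"
  proof
    fix y assume y: "y \<in> L"
    show "s y = y"
      by (rule homs_eqI[OF L_subfield sL id L_gen L_mem(1)])
        (use y root_at_L E.GalD(3)[OF s] perm_of(2)[OF E.E E(2) E.GalD(1,3)[OF s], unfolded e perm_app_one] in auto)
  qed
qed

text \<open>Restriction from E to L is onto, since \<open>normal_over\<close> extends every
  automorphism of L. This identifies the projections of the group of the compositum with the two
  Galois groups.\<close>

lemma perm_of_Gal_restrict:
  assumes E: "exponent4_ext R M E" "L \<subseteq> E" and N: "normal_over M L E"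
  shows "perm_of ` carrier (Gal R E M) = perm_of ` carrier (Gal R L M)"
proof
  interpret E: exponent4_ext R M E by fact
  show "perm_of ` carrier (Gal R E M) \<subseteq> perm_of ` carrier (Gal R L M)"
  proof (rule image_subsetI)
    fix t assume t: "t \<in> carrier (Gal R E M)"
    have "restrict t L \<in> carrier (Gal R L M)"
      using X.Gal_restrict[OF homs_subset[OF E.GalD(1)[OF t] E(2)] E.GalD(3)[OF t]] .
    moreover have "perm_of (restrict t L) = perm_of t"
      by (rule perm_of_eqI) (use root_at_L perm_of(2)[OF E.E E(2) E.GalD(1,3)[OF t]] in simp)
    ultimately show "perm_of t \<in> perm_of ` carrier (Gal R L M)" by (metis image_eqI)
  qed
  show "perm_of ` carrier (Gal R L M) \<subseteq> perm_of ` carrier (Gal R E M)"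
  proof (rule image_subsetI)
    fix s assume s: "s \<in> carrier (Gal R L M)"
    obtain g where g: "g \<in> homs E" "\<forall>x\<in>L. g x = s x"
      using N X.GalD(1,3)[OF s] unfolding normal_over_def by blast
    have t: "restrict g E \<in> carrier (Gal R E M)"
      by (rule E.Gal_restrict[OF g(1)]) (use g(2) X.GalD(3)[OF s] L_mem(1) in auto)
    have "perm_of (restrict g E) = perm_of s"
      by (rule perm_of_eqI) (use g(2) root_at_L E(2) perm_of(2)[OF L_subfield subset_refl X.GalD(1,3)[OF s]] in auto)
    then show "perm_of s \<in> perm_of ` carrier (Gal R E M)" using t by (metis image_eqI)
  qed
qed

text \<open>The fixed field of the group is M. A smaller orbit of \<open>\<alpha> 1\<close> would be
  closed under negation or have two elements, and either case gives a monic quadratic over M with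
  root \<open>\<alpha> 1\<close>.\<close>

lemma Gal_transitive:
  assumes irred: "\<And>u v. u \<in> M \<Longrightarrow> v \<in> M \<Longrightarrow> \<alpha> 1 \<otimes> \<alpha> 1 \<oplus> u \<otimes> \<alpha> 1 \<oplus> v \<noteq> \<zero>"
    and E: "exponent4_ext R M E" "L \<subseteq> E" and N: "normal_over M M E"
  shows "\<exists>s\<in>carrier (Gal R E M). perm_app (perm_of s) I1 = i"
proof -
  interpret E: exponent4_ext R M E by fact
  let ?G = "carrier (Gal R E M)"
  define P where "P = perm_of ` ?G"
  have act: "s (root_at \<alpha> j) = root_at \<alpha> (perm_app (perm_of s) j)" and pd: "perm_of s \<in> set d8"
    if "s \<in> ?G" for s j
    using perm_of[OF E.E E(2) E.GalD(1,3)[OF that]] by simp_all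
  have Pd: "p \<in> set d8" if "p \<in> P" for p using that pd by (auto simp: P_def)
  have Pm: "perm_mult p q \<in> P" if "p \<in> P" "q \<in> P" for p q
  proof -
    from that obtain s t where s: "s \<in> ?G" "p = perm_of s" and t: "t \<in> ?G" "q = perm_of t"
      unfolding P_def by blast
    have "perm_mult p q = perm_of (compose E s t)" using perm_of_compose[OF E s(1) t(1)] s t by simp
    then show ?thesis unfolding P_def using E.Gal_compose[OF s(1) t(1)] by blast
  qed
  have P1: "r0 \<in> P" using perm_of_id[OF E(2)] E.Gal_id unfolding P_def by (metis image_eqI)
  have rE: "root_at \<alpha> j \<in> E" for j using root_at_L E(2) by auto
  have "{s \<in> ?G. \<forall>y\<in>M. s y = y} = ?G" using E.GalD(3) by auto
  then have "E.Fix ?G = M" using E.Fix_normal_over[OF N E.ME subset_refl] by simp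
  then have fixM: "x \<in> M" if "x \<in> E" "\<And>s. s \<in> ?G \<Longrightarrow> s x = x" for x
    using that unfolding E.Fix_def by blast
  note c = subfield_closed[OF E.E] and cM = subfield_closed[OF M]
  define x where "x j = root_at \<alpha> j" for j
  have xR: "x j \<in> carrier R" for j using root_at_carrier by (simp add: x_def)
  have xE: "x j \<in> E" for j using rE by (simp add: x_def)
  have x1: "x I1 = \<alpha> 1" by (simp add: x_def)
  \<comment> \<open>Otherwise \<open>\<alpha> 1\<close> goes only to plus or minus itself, its
    square lies in M, and X^2 minus that square is a forbidden quadratic.\<close>
  have step1: "\<exists>p\<in>P. perm_app p I1 \<noteq> I1 \<and> perm_app p I1 \<noteq> I3"
  proof (rule ccontr)
    assume "\<not> ?thesis"
    then have a: "perm_app p I1 = I1 \<or> perm_app p I1 = I3" if "p \<in> P" for p using that by blast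
    have "x I1 \<otimes> x I1 \<in> M"
    proof (rule fixM)
      fix s assume s: "s \<in> ?G"
      have "s (x I1) = x I1 \<or> s (x I1) = \<ominus> (x I1)"
        using act[OF s, of I1] a[of "perm_of s"] s roots by (auto simp: x_def P_def simp del: perm_app.simps)
      then show "s (x I1 \<otimes> x I1) = x I1 \<otimes> x I1"
        using homsD(2)[OF E.GalD(1)[OF s] xE xE] xR by (auto simp: l_minus r_minus)
    qed (use c(5) xE in simp)
    moreover have "x I1 \<otimes> x I1 \<oplus> \<zero> \<otimes> x I1 \<oplus> \<ominus> (x I1 \<otimes> x I1) = \<zero>" using xR by (simp add: r_neg)
    ultimately show False using irred[OF cM(2) cM(6)] unfolding x1 by blast
  qed
  then obtain p where p: "p \<in> P" "perm_app p I1 \<noteq> I1" "perm_app p I1 \<noteq> I3" by blast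
  define j where "j = perm_app p I1"
  have r22: "perm_app r2 (perm_app r2 i) = i" for i by (cases i) simp_all
  \<comment> \<open>If the negative of j is not reached, neither is \<open>I3\<close>, because p
    sends \<open>I3\<close> to the negative of j. So the orbit is {\<open>I1\<close>, j}, and sum
    and product of these two roots are fixed.\<close>
  have step2: "\<exists>q\<in>P. perm_app q I1 = perm_app r2 j"
  proof (rule ccontr)
    assume no: "\<not> ?thesis"
    have no3: "perm_app q I1 \<noteq> I3" if "q \<in> P" for q
    proof
      assume q: "perm_app q I1 = I3"
      have "perm_app (perm_mult p q) I1 = perm_app p (perm_app r2 I1)" using q by simp
      also have "\<dots> = perm_app r2 j" using d8_commute_r2[OF Pd[OF p(1)]] by (simp only: j_def)
      finally show False using no Pm[OF p(1) that] by blast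
    qed
    have o: "perm_app q I1 = I1 \<or> perm_app q I1 = j" if "q \<in> P" for q
      using no3[OF that] no that p(2,3) unfolding j_def
      by (cases "perm_app q I1"; cases "perm_app p I1") auto
    have o2: "perm_app q j = I1 \<or> perm_app q j = j" if "q \<in> P" for q
      using o[OF Pm[OF that p(1)]] by (simp add: j_def)
    have inv: "x (perm_app q I1) \<oplus> x (perm_app q j) = x I1 \<oplus> x j \<and> x (perm_app q I1) \<otimes> x (perm_app q j) = x I1 \<otimes> x j"
      if q: "q \<in> P" for q
    proof -
      have "perm_app q I1 \<noteq> perm_app q j"
      proof
        assume e: "perm_app q I1 = perm_app q j"
        have "perm_mult (perm_mult q (perm_mult q q)) q = r0"
          using d8_inverse[OF Pd[OF q]] by (simp add: perm_mult_assoc)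
        then have "I1 = j" using e by (metis perm_app_mult perm_app_one)
        then show False using p(2) by (simp add: j_def)
      qed
      then show ?thesis using o[OF q] o2[OF q] xR by (auto simp: a_comm m_comm)
    qed
    have st: "s (x I1) = x (perm_app (perm_of s) I1)" "s (x j) = x (perm_app (perm_of s) j)" "perm_of s \<in> P" if "s \<in> ?G" for s
      using act[OF that] that by (auto simp: x_def P_def simp del: root_at.simps)
    have "s (x I1 \<oplus> x j) = x I1 \<oplus> x j" "s (x I1 \<otimes> x j) = x I1 \<otimes> x j" if s: "s \<in> ?G" for s
      using inv[OF st(3)[OF s]]
      unfolding homsD(2,3)[OF E.GalD(1)[OF s] xE xE] st(1,2)[OF s] by blast+
    then have "x I1 \<oplus> x j \<in> M" and v: "x I1 \<otimes> x j \<in> M"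
      using c(4,5) xE by (auto intro!: fixM)
    then have "\<ominus> (x I1 \<oplus> x j) \<in> M" using cM(6) by blast
    moreover have "x I1 \<otimes> x I1 \<oplus> (\<ominus> (x I1 \<oplus> x j)) \<otimes> x I1 \<oplus> x I1 \<otimes> x j = \<zero>"
      using xR[of I1] xR[of j] by algebra
    ultimately show False using irred[OF _ v] unfolding x1 by blast
  qed
  then obtain q where q: "q \<in> P" "perm_app q I1 = perm_app r2 j" by blast
  \<comment> \<open>The inverse of p after q sends \<open>I1\<close> to the negative of p^-1 j, that
    is to \<open>I3\<close>, since negation commutes with signed permutations.\<close>
  have "perm_app (perm_mult (perm_mult p (perm_mult p p)) q) I1 = perm_app r2 (perm_app (perm_mult (perm_mult p (perm_mult p p)) p) I1)"
    using q(2) d8_commute_r2[OF Pd[OF p(1)]] by (simp add: j_def)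
  also have "perm_mult (perm_mult p (perm_mult p p)) p = r0"
    using d8_inverse[OF Pd[OF p(1)]] by (simp add: perm_mult_assoc)
  finally have "perm_app (perm_mult (perm_mult p (perm_mult p p)) q) I1 = I3" by simp
  then have "\<exists>p\<in>P. perm_app p I1 = I3" using Pm p(1) q(1) by blast
  moreover have "\<exists>p\<in>P. perm_app p I1 = I1" using P1 by (metis perm_app_one)
  moreover have "\<exists>p\<in>P. perm_app p I1 = I2" "\<exists>p\<in>P. perm_app p I1 = I4"
    using p q unfolding j_def by (cases "perm_app p I1"; auto)+
  ultimately have "\<exists>p\<in>P. perm_app p I1 = i" by (cases i) auto
  then show ?thesis by (auto simp: P_def)
qed

end

section \<open>Two quartics and their compositum\<close>

locale signed_roots_pair = field R + A: signed_roots R M \<alpha> + B: signed_roots R M \<beta>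
  for R (structure) and M \<alpha> \<beta> +
  assumes irreducible_\<alpha>: "\<And>u v. u \<in> M \<Longrightarrow> v \<in> M \<Longrightarrow> \<alpha> 1 \<otimes> \<alpha> 1 \<oplus> u \<otimes> \<alpha> 1 \<oplus> v \<noteq> \<zero>"
    and irreducible_\<beta>: "\<And>u v. u \<in> M \<Longrightarrow> v \<in> M \<Longrightarrow> \<beta> 1 \<otimes> \<beta> 1 \<oplus> u \<otimes> \<beta> 1 \<oplus> v \<noteq> \<zero>"
begin

definition E :: "'a set" where "E = biquad_ext A.L (\<beta> 1) (\<beta> 2)"

lemmas tower_AB = A.two A.L_subfield A.L_mem(1) B.roots(1,2) B.coeffs
lemmas tower_BA = A.two B.L_subfield B.L_mem(1) A.roots(1,2) A.coeffs

lemma E_subfield: "subfield E R" and A_L_subset: "A.L \<subseteq> E"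
  unfolding E_def using biquad_ext_subfield[OF tower_AB] biquad_ext_mem[OF tower_AB] by simp_all

lemma \<beta>_mem: "\<beta> 1 \<in> E" "\<beta> 2 \<in> E"
  unfolding E_def using biquad_ext_mem[OF tower_AB] by simp_all

lemma M_subset: "M \<subseteq> E"
  using A.L_mem A_L_subset by blast

lemma B_L_subset: "B.L \<subseteq> E"
  using B.L_minimal[OF E_subfield M_subset] B.root_at_in[OF E_subfield \<beta>_mem] by blast

lemma E_minimal:
  assumes "subfield F R" "A.L \<subseteq> F" "B.L \<subseteq> F"
  shows "E \<subseteq> F"
  unfolding E_def using biquad_ext_minimal[OF tower_AB assms(1,2)] assms(3) B.L_mem by blast

lemma E_gen:
  assumes "subfield F R" "M \<subseteq> F" "range (root_at \<alpha>) \<union> range (root_at \<beta>) \<subseteq> F"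
  shows "E \<subseteq> F"
  by (rule E_minimal[OF assms(1)]) (use A.L_gen B.L_gen assms in auto)

text \<open>Normality over \<open>B.L\<close> requires a tower that passes through
  \<open>B.L\<close>; the tower that defines E passes through \<open>A.L\<close>.\<close>

lemma E_symmetric: "E = biquad_ext B.L (\<alpha> 1) (\<alpha> 2)"
proof
  show "E \<subseteq> biquad_ext B.L (\<alpha> 1) (\<alpha> 2)"
    using E_minimal[OF biquad_ext_subfield[OF tower_BA]] biquad_ext_mem[OF tower_BA]
      A.L_minimal[OF biquad_ext_subfield[OF tower_BA]]
      A.root_at_in[OF biquad_ext_subfield[OF tower_BA]] B.L_mem(1) by blast
  show "biquad_ext B.L (\<alpha> 1) (\<alpha> 2) \<subseteq> E"
    using biquad_ext_minimal[OF tower_BA E_subfield B_L_subset] A_L_subset A.L_mem by blast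
qed

lemma normal_over_A: "normal_over M A.L E"
  by (rule normal_over_biquad_step[OF tower_AB A.M]) (unfold E_def[symmetric], rule normal_over_refl)

lemma normal_over_B: "normal_over M B.L E"
  by (rule normal_over_biquad_step[OF tower_BA A.M]) (unfold E_symmetric[symmetric], rule normal_over_refl)

lemma normal_over_M: "normal_over M M E"
  by (rule normal_over_biquad_step[OF A.two A.M subset_refl A.roots(1,2) A.coeffs A.M])
    (unfold A.L_def[symmetric], rule normal_over_A)

lemma root_at_E: "root_at \<alpha> i \<in> E" "root_at \<beta> i \<in> E"
  using A.root_at_L B.root_at_L A_L_subset B_L_subset by blast+

sublocale E: exponent4_ext R M E
proof (rule exponent4_extI[OF A.M E_subfield M_subset _ E_gen])
  fix h x assume h: "h \<in> homs E" "\<And>y. y \<in> M \<Longrightarrow> h y = y"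
    and "x \<in> range (root_at \<alpha>) \<union> range (root_at \<beta>)"
  then obtain i where "x = root_at \<alpha> i \<or> x = root_at \<beta> i" by blast
  then show "h x \<in> range (root_at \<alpha>) \<union> range (root_at \<beta>) \<and> h (h (h (h x))) = x"
    using A.perm_of(2)[OF E_subfield A_L_subset h] A.hom_fourth_root_at[OF E_subfield A_L_subset h]
      B.perm_of(2)[OF E_subfield B_L_subset h] B.hom_fourth_root_at[OF E_subfield B_L_subset h] by auto
qed (use root_at_E in auto)

abbreviation "GG \<equiv> Gal R E M"

definition perms :: "('a \<Rightarrow> 'a) \<Rightarrow> perm_pair" where
  "perms s = (A.perm_of s, B.perm_of s)"

definition H :: "perm_pair set" where
  "H = perms ` carrier GG"

lemma perms_action:
  assumes "s \<in> carrier GG"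
  shows "s (root_at \<alpha> i) = root_at \<alpha> (perm_app (fst (perms s)) i)"
    "s (root_at \<beta> i) = root_at \<beta> (perm_app (snd (perms s)) i)" "perms s \<in> set d8 \<times> set d8"
  using A.perm_of[OF E_subfield A_L_subset E.GalD(1,3)[OF assms]]
    B.perm_of[OF E_subfield B_L_subset E.GalD(1,3)[OF assms]] by (simp_all add: perms_def)

lemma perms_compose:
  assumes "s \<in> carrier GG" "t \<in> carrier GG"
  shows "perms (compose E s t) = pp_mult (perms s) (perms t)"
  using A.perm_of_compose[OF E.exponent4_ext_axioms A_L_subset assms]
    B.perm_of_compose[OF E.exponent4_ext_axioms B_L_subset assms] by (simp add: perms_def pp_mult_def)

lemma perms_id: "perms (\<lambda>x\<in>E. x) = pp_one"
  using A.perm_of_id[OF A_L_subset] B.perm_of_id[OF B_L_subset] by (simp add: perms_def)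

lemma perms_inj: "inj_on perms (carrier GG)"
proof (rule inj_onI)
  fix s t assume s: "s \<in> carrier GG" and t: "t \<in> carrier GG" and e: "perms s = perms t"
  show "s = t"
  proof (rule E.Gal_eqI[OF s t])
    fix x assume x: "x \<in> E"
    show "s x = t x"
    proof (rule homs_eqI[OF E_subfield E.GalD(1)[OF s] E.GalD(1)[OF t] E_gen M_subset])
      show "s x = t x" if "x \<in> range (root_at \<alpha>) \<union> range (root_at \<beta>)" for x
        using that e perms_action[OF s] perms_action[OF t] by auto
    qed (use root_at_E E.GalD(3)[OF s] E.GalD(3)[OF t] x in auto)
  qed
qed

lemma H_subset: "H \<subseteq> set d8 \<times> set d8"
  using perms_action(3) unfolding H_def by blast

lemma H_one: "pp_one \<in> H"
  unfolding H_def using perms_id E.Gal_id by (metis image_eqI)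

lemma H_mult:
  assumes "x \<in> H" "y \<in> H"
  shows "pp_mult x y \<in> H"
proof -
  obtain s t where s: "s \<in> carrier GG" "x = perms s" and t: "t \<in> carrier GG" "y = perms t"
    using assms unfolding H_def by blast
  have "pp_mult x y = perms (compose E s t)" using perms_compose[OF s(1) t(1)] s t by simp
  then show ?thesis unfolding H_def using E.Gal_compose[OF s(1) t(1)] by blast
qed

lemma finite_Gal: "finite (carrier GG)"
  using finite_imageD[OF _ perms_inj] finite_subset[OF H_subset] by (simp add: H_def)

lemma Gal_iso_H: "GG \<cong> pp_group H"
proof -
  have "perms \<in> iso GG (pp_group H)"
    using perms_inj perms_compose E.Gal_mult
    by (auto simp: iso_def hom_def bij_betw_def pp_group_def H_def)
  then show ?thesis by (auto simp: is_iso_def)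
qed

lemma H_transitive:
  "\<exists>h\<in>H. perm_app (fst h) I1 = i" "\<exists>h\<in>H. perm_app (snd h) I1 = i"
  using A.Gal_transitive[OF irreducible_\<alpha> E.exponent4_ext_axioms A_L_subset normal_over_M]
    B.Gal_transitive[OF irreducible_\<beta> E.exponent4_ext_axioms B_L_subset normal_over_M]
  by (auto simp: H_def perms_def)

lemma fst_H: "fst ` H = A.perm_of ` carrier (Gal R A.L M)"
  using A.perm_of_Gal_restrict[OF E.exponent4_ext_axioms A_L_subset normal_over_A]
  by (simp add: H_def perms_def image_image)

lemma snd_H: "snd ` H = B.perm_of ` carrier (Gal R B.L M)"
  using B.perm_of_Gal_restrict[OF E.exponent4_ext_axioms B_L_subset normal_over_B]
  by (simp add: H_def perms_def image_image)

section \<open>Fixed fields\<close>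

definition Fix_perms :: "perm_pair set \<Rightarrow> 'a set" where
  "Fix_perms T = E.Fix {s \<in> carrier GG. perms s \<in> T}"

lemma Fix_perms_H: "Fix_perms H = M"
proof -
  have "{s \<in> carrier GG. perms s \<in> H} = {s \<in> carrier GG. \<forall>y\<in>M. s y = y}"
    using E.GalD(3) by (auto simp: H_def)
  then show ?thesis using E.Fix_normal_over[OF normal_over_M M_subset subset_refl] by (simp add: Fix_perms_def)
qed

lemma fixes_A_iff: "s \<in> carrier GG \<Longrightarrow> (\<forall>y\<in>A.L. s y = y) \<longleftrightarrow> fst (perms s) = r0"
  and fixes_B_iff: "s \<in> carrier GG \<Longrightarrow> (\<forall>y\<in>B.L. s y = y) \<longleftrightarrow> snd (perms s) = r0"
  using A.fixes_L_iff[OF E.exponent4_ext_axioms A_L_subset] B.fixes_L_iff[OF E.exponent4_ext_axioms B_L_subset]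
  by (simp_all add: perms_def)

lemma A_L_Fix: "A.L = E.Fix {s \<in> carrier GG. fst (perms s) = r0}"
proof -
  have "{s \<in> carrier GG. fst (perms s) = r0} = {s \<in> carrier GG. \<forall>y\<in>A.L. s y = y}"
    using fixes_A_iff by auto
  then show ?thesis using E.Fix_normal_over[OF normal_over_A A_L_subset A.L_mem(1)] by simp
qed

lemma B_L_Fix: "B.L = E.Fix {s \<in> carrier GG. snd (perms s) = r0}"
proof -
  have "{s \<in> carrier GG. snd (perms s) = r0} = {s \<in> carrier GG. \<forall>y\<in>B.L. s y = y}"
    using fixes_B_iff by auto
  then show ?thesis using E.Fix_normal_over[OF normal_over_B B_L_subset B.L_mem(1)] by simp
qed

text \<open>If (1, snd h) is in H, so is (fst h, 1), and h is their product. The subgroup on the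
  right is therefore the product of the two kernels, whose fixed fields are \<open>A.L\<close> and
  \<open>B.L\<close>, and its fixed field is their intersection.\<close>

lemma intersection_Fix: "A.L \<inter> B.L = Fix_perms {h \<in> H. (r0, snd h) \<in> H}"
proof
  show "Fix_perms {h \<in> H. (r0, snd h) \<in> H} \<subseteq> A.L \<inter> B.L"
  proof
    fix x assume x: "x \<in> Fix_perms {h \<in> H. (r0, snd h) \<in> H}"
    have "s x = x" if "s \<in> carrier GG" "fst (perms s) = r0 \<or> snd (perms s) = r0" for s
    proof (rule E.FixD[OF x[unfolded Fix_perms_def]])
      have "perms s \<in> H" using that by (simp add: H_def)
      then have "(r0, snd (perms s)) \<in> H" using that(2) H_one by (metis prod.collapse)
      then show "s \<in> {s \<in> carrier GG. perms s \<in> {h \<in> H. (r0, snd h) \<in> H}}"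
        using that(1) \<open>perms s \<in> H\<close> by simp
    qed
    moreover have "x \<in> E" using x by (simp add: Fix_perms_def E.Fix_def)
    ultimately have "x \<in> E.Fix {s \<in> carrier GG. fst (perms s) = r0}"
      "x \<in> E.Fix {s \<in> carrier GG. snd (perms s) = r0}"
      unfolding E.Fix_def by blast+
    then show "x \<in> A.L \<inter> B.L" using A_L_Fix B_L_Fix by blast
  qed
  show "A.L \<inter> B.L \<subseteq> Fix_perms {h \<in> H. (r0, snd h) \<in> H}"
  proof
    fix x assume x: "x \<in> A.L \<inter> B.L"
    have xE: "x \<in> E" using x A_L_subset by blast
    have "s x = x" if s: "s \<in> carrier GG" "(r0, snd (perms s)) \<in> H" for s
    proof -
      obtain t where t: "t \<in> carrier GG" "perms t = (r0, snd (perms s))"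
        using s(2) unfolding H_def by (metis imageE)
      have "\<forall>y\<in>A.L. t y = y" using fixes_A_iff[OF t(1)] t(2) by (metis fst_conv)
      then have tx: "t x = x" using x by blast
      \<comment> \<open>r is t^-1 s. Here t fixes \<open>A.L\<close>, and r fixes \<open>B.L\<close>
        because s and t act alike on the second set of roots; so both fix x, and hence so does
        s.\<close>
      define r where "r = compose E t (compose E t (compose E t s))"
      have r: "r \<in> carrier GG" unfolding r_def using t(1) s(1) E.Gal_compose by blast
      have "snd (perms t) = snd (perms s)" using t(2) by (metis snd_conv)
      then have "snd (perms r) = perm_mult (snd (perms s)) (perm_mult (snd (perms s)) (perm_mult (snd (perms s)) (snd (perms s))))"
        unfolding r_def using t(1) s(1) E.Gal_compose by (simp add: perms_compose pp_mult_def)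
      also have "\<dots> = r0" using d8_inverse perms_action(3)[OF s(1)] by (auto simp del: perm_app.simps)
      finally have "\<forall>y\<in>B.L. r y = y" using fixes_B_iff[OF r] by blast
      then have "r x = x" using x by blast
      then have "t (t (t (s x))) = x"
        using xE E.GalD(4)[OF s(1)] E.GalD(4)[OF t(1)] by (simp add: r_def compose_eq)
      then have "t (t (t (t (s x)))) = x" using tx by simp
      then show "s x = x" using E.GalD(5)[OF t(1) E.GalD(4)[OF s(1) xE]] by simp
    qed
    then show "x \<in> Fix_perms {h \<in> H. (r0, snd h) \<in> H}"
      using xE unfolding Fix_perms_def E.Fix_def by blast
  qed
qed

lemma Fix_perms_index2:
  assumes T: "T \<subseteq> V" "V \<subseteq> H" "pp_one \<in> T" "\<And>x y. x \<in> T \<Longrightarrow> y \<in> T \<Longrightarrow> pp_mult x y \<in> T"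
    and V: "\<And>x y. x \<in> V \<Longrightarrow> y \<in> V \<Longrightarrow> pp_mult x y \<in> V"
    and a: "a \<in> V" "a \<notin> T" and split: "\<And>y. y \<in> V \<Longrightarrow> y \<in> T \<or> (\<exists>x\<in>T. y = pp_mult a x)"
  shows "dimension 2 (Fix_perms V) (Fix_perms T)"
proof -
  obtain s where s: "s \<in> carrier GG" "perms s = a" using a T(2) unfolding H_def by blast
  show ?thesis
    unfolding Fix_perms_def
  proof (rule E.index2_Fix_dimension[OF A.two, where a = s])
    show "finite {s \<in> carrier GG. perms s \<in> T}" using finite_Gal by simp
    show "(\<lambda>x\<in>E. x) \<in> {s \<in> carrier GG. perms s \<in> T}" using E.Gal_id perms_id T(3) by simp
    fix t assume t: "t \<in> {s \<in> carrier GG. perms s \<in> V}"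
    show "t \<in> {s \<in> carrier GG. perms s \<in> T} \<or> (\<exists>r\<in>{s \<in> carrier GG. perms s \<in> T}. t = compose E s r)"
    proof (cases "perms t \<in> T")
      case False
      then obtain x where x: "x \<in> T" "perms t = pp_mult a x" using split t by blast
      then obtain r where r: "r \<in> carrier GG" "perms r = x" using T unfolding H_def by blast
      have "perms t = perms (compose E s r)" using perms_compose[OF s(1) r(1)] x r s by simp
      then have "t = compose E s r"
        using inj_onD[OF perms_inj] t E.Gal_compose[OF s(1) r(1)] by blast
      then show ?thesis using r x by blast
    qed (use t in simp)
  qed (use T V a s E.Gal_compose perms_compose in auto)
qed

lemma relation_Trivial:
  assumes "relation_check Trivial c N Hl" "set Hl = H" "set N = {q. (r0, q) \<in> H}"
  shows "A.L \<inter> B.L = M"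
proof -
  have "{h \<in> H. (r0, snd h) \<in> H} = H" using assms by (auto simp: list_all_iff)
  then show ?thesis using intersection_Fix Fix_perms_H by simp
qed

lemma kernel_closed:
  defines "K \<equiv> {h \<in> H. (r0, snd h) \<in> H}"
  shows "pp_one \<in> K" "\<And>x y. x \<in> K \<Longrightarrow> y \<in> K \<Longrightarrow> pp_mult x y \<in> K"
proof -
  show "pp_one \<in> K" using H_one by (simp add: K_def)
  fix x y assume xy: "x \<in> K" "y \<in> K"
  then have "pp_mult (r0, snd x) (r0, snd y) \<in> H" by (intro H_mult) (simp_all add: K_def)
  then have "(r0, snd (pp_mult x y)) \<in> H" by (simp add: pp_mult_def)
  then show "pp_mult x y \<in> K" using H_mult xy by (simp add: K_def)
qed

lemma relation_Degree2:
  assumes check: "relation_check Degree2 c N Hl" and "set Hl = H" "set N = {q. (r0, q) \<in> H}"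
  shows "dimension 2 M (A.L \<inter> B.L)"
proof -
  define K where "K = {h \<in> H. (r0, snd h) \<in> H}"
  have Ks: "set (filter (\<lambda>h. snd h \<in> set N) Hl) = K" using assms by (auto simp: K_def)
  have KH: "K \<subseteq> H" by (auto simp: K_def)
  note ck = check[unfolded relation_check.simps Let_def list_all_iff List.member_iff set_map Ks assms(2)]
  have "dimension 2 (Fix_perms H) (Fix_perms K)"
    by (rule Fix_perms_index2[where a = "hd c"])
      (use kernel_closed[folded K_def] KH H_mult ck in blast)+
  then show ?thesis by (simp add: Fix_perms_H intersection_Fix K_def)
qed

text \<open>The two representatives in c give a chain K, K2, H with index 2 in each step; the
  degrees multiply along the fixed fields.\<close>

lemma relation_Degree4:
  assumes check: "relation_check Degree4 c N Hl" and "set Hl = H" "set N = {q. (r0, q) \<in> H}"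
  shows "dimension 4 M (A.L \<inter> B.L)"
proof -
  define K where "K = {h \<in> H. (r0, snd h) \<in> H}"
  define K2 where "K2 = K \<union> pp_mult (hd c) ` K"
  have Ks: "set (filter (\<lambda>h. snd h \<in> set N) Hl) = K" using assms by (auto simp: K_def)
  have K2s: "set (filter (\<lambda>h. snd h \<in> set N) Hl @ map (pp_mult (hd c)) (filter (\<lambda>h. snd h \<in> set N) Hl)) = K2"
    unfolding set_append set_map Ks K2_def ..
  have KH: "K \<subseteq> H" by (auto simp: K_def)
  note ck = check[unfolded relation_check.simps Let_def list_all_iff List.member_iff K2s, unfolded set_map K2s Ks assms(2)]
  note K = kernel_closed[folded K_def]
  have K2H: "K2 \<subseteq> H" unfolding K2_def using ck KH H_mult by blast
  have aK2: "hd c \<in> K2" using K(1) unfolding K2_def by (metis UnI2 image_eqI pp_mult_one(2))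
  have 1: "dimension 2 (Fix_perms H) (Fix_perms K2)"
  proof (rule Fix_perms_index2[where a = "hd (tl c)"])
    show "pp_one \<in> K2" using K(1) by (simp add: K2_def)
  qed (use K2H H_mult ck in blast)+
  have 2: "dimension 2 (Fix_perms K2) (Fix_perms K)"
  proof (rule Fix_perms_index2[OF _ K2H K(1,2) _ aK2])
    show "K \<subseteq> K2" by (simp add: K2_def)
    show "y \<in> K \<or> (\<exists>x\<in>K. y = pp_mult (hd c) x)" if "y \<in> K2" for y using that by (auto simp: K2_def)
  qed (use ck in blast)+
  have sub: "subfield (Fix_perms T) R" for T
    unfolding Fix_perms_def by (rule E.Fix_subfield) auto
  have "dimension (2 * 2) (Fix_perms H) (Fix_perms K)"
    by (rule telescopic_base[OF sub sub 1 2])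
  then show ?thesis by (simp add: Fix_perms_H intersection_Fix K_def)
qed

lemma E_Fix_id: "E.Fix {\<lambda>x\<in>E. x} = E"
  by (auto simp: E.Fix_def)

lemma kernel_trivial:
  "{s \<in> carrier GG. perms s = pp_one} = {\<lambda>x\<in>E. x}"
  using E.Gal_id perms_id inj_onD[OF perms_inj] by auto

lemma relation_Equal:
  assumes check: "relation_check Equal c N Hl" and "set Hl = H"
  shows "A.L = B.L"
proof -
  have "fst (perms s) = r0 \<longleftrightarrow> snd (perms s) = r0" if "s \<in> carrier GG" for s
    using check assms(2) that by (auto simp: list_all_iff H_def)
  then have "{s \<in> carrier GG. fst (perms s) = r0} = {s \<in> carrier GG. snd (perms s) = r0}"
    by blast
  then show ?thesis using A_L_Fix B_L_Fix by simp
qed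

text \<open>The first condition makes the kernel of the first projection trivial, so
  \<open>A.L\<close> is the whole compositum. The second one provides an automorphism that fixes
  \<open>B.L\<close> but moves \<open>A.L\<close>.\<close>

lemma relation_Proper:
  assumes check: "relation_check Proper c N Hl" and "set Hl = H"
  shows "B.L \<subset> A.L"
proof -
  have "snd (perms s) = r0" if "s \<in> carrier GG" "fst (perms s) = r0" for s
    using check assms(2) that by (auto simp: list_all_iff H_def)
  then have "{s \<in> carrier GG. fst (perms s) = r0} = {s \<in> carrier GG. perms s = pp_one}"
    by (auto simp: prod_eq_iff)
  then have AE: "A.L = E" using A_L_Fix kernel_trivial E_Fix_id by simp
  obtain s where s: "s \<in> carrier GG" "snd (perms s) = r0" "fst (perms s) \<noteq> r0"
    using check assms(2) by (auto simp: list_ex_iff H_def)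
  then have "\<not> (\<forall>y\<in>A.L. s y = y)" "\<forall>y\<in>B.L. s y = y" using fixes_A_iff fixes_B_iff by blast+
  then have "A.L \<noteq> B.L" by metis
  then show ?thesis using AE B_L_subset by blast
qed

end

context signed_roots_pair
begin

section \<open>Orbits on bijections of the roots\<close>

definition root_bij :: "perm4 \<Rightarrow> 'a \<Rightarrow> 'a" where
  "root_bij p = (\<lambda>x\<in>range (root_at \<alpha>). root_at \<beta> (perm_app p (inv_into UNIV (root_at \<alpha>) x)))"

lemma root_bij_apply: "root_bij p (root_at \<alpha> i) = root_at \<beta> (perm_app p i)"
  by (simp add: root_bij_def inv_into_f_f[OF A.inj_root_at])

lemma root_bij_extensional: "root_bij p \<in> extensional (range (root_at \<alpha>))"
  by (simp add: root_bij_def)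

lemma root_bij_eqI:
  assumes "f \<in> extensional (range (root_at \<alpha>))" "\<And>i. f (root_at \<alpha> i) = root_at \<beta> (perm_app p i)"
  shows "f = root_bij p"
  using assms root_bij_extensional root_bij_apply by (intro extensionalityI[of f "range (root_at \<alpha>)"]) auto

lemma inj_root_bij: "inj root_bij"
proof (rule injI)
  fix p q assume "root_bij p = root_bij q"
  then have "root_at \<beta> (perm_app p i) = root_at \<beta> (perm_app q i)" for i
    using root_bij_apply by metis
  then show "p = q" by (intro perm_eqI injD[OF B.inj_root_at])
qed

lemma root_bij_ex:
  assumes "f \<in> bijections (\<alpha> ` {1..4}) (\<beta> ` {1..4})"
  obtains p where "f = root_bij p" "p \<in> set s4"
proof -
  have f: "f \<in> range (root_at \<alpha>) \<rightarrow>\<^sub>E range (root_at \<beta>)" "inj_on f (range (root_at \<alpha>))"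
    using assms by (auto simp: bijections_def range_root_at bij_betw_def)
  then have "\<exists>j. f (root_at \<alpha> i) = root_at \<beta> j" for i by auto
  then obtain g where g: "\<And>i. f (root_at \<alpha> i) = root_at \<beta> (g i)" by metis
  define p where "p = Perm4 (g I1) (g I2) (g I3) (g I4)"
  have p: "perm_app p i = g i" for i unfolding p_def by (rule perm_app_lookup)
  have "f = root_bij p" by (rule root_bij_eqI) (use f(1) g p in \<open>auto simp: PiE_def\<close>)
  moreover have "inj (perm_app p)"
  proof (rule injI)
    fix i j assume "perm_app p i = perm_app p j"
    then have "f (root_at \<alpha> i) = f (root_at \<alpha> j)" by (simp add: g p)
    then show "i = j" using f(2) A.inj_root_at by (auto dest: inj_onD injD)
  qed
  ultimately show ?thesis using that by (simp add: set_s4)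
qed

lemma bijections_root_bij: "bijections (\<alpha> ` {1..4}) (\<beta> ` {1..4}) = root_bij ` set s4"
proof
  show "bijections (\<alpha> ` {1..4}) (\<beta> ` {1..4}) \<subseteq> root_bij ` set s4"
  proof
    fix f assume "f \<in> bijections (\<alpha> ` {1..4}) (\<beta> ` {1..4})"
    then obtain p where "f = root_bij p" "p \<in> set s4" by (rule root_bij_ex)
    then show "f \<in> root_bij ` set s4" by blast
  qed
  show "root_bij ` set s4 \<subseteq> bijections (\<alpha> ` {1..4}) (\<beta> ` {1..4})"
  proof
    fix f assume "f \<in> root_bij ` set s4"
    then obtain p where p: "f = root_bij p" "inj (perm_app p)" by (auto simp: set_s4)
    have "finite (UNIV :: ix set)"
    proof (rule finite_subset)
      show "UNIV \<subseteq> {I1, I2, I3, I4}" using ix.exhaust by blast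
    qed simp
    then have s: "surj (perm_app p)" using finite_UNIV_inj_surj[OF _ p(2)] by simp
    have "inj_on f (range (root_at \<alpha>))"
    proof (rule inj_onI)
      fix x y assume "x \<in> range (root_at \<alpha>)" "y \<in> range (root_at \<alpha>)" "f x = f y"
      then obtain i j where "x = root_at \<alpha> i" "y = root_at \<alpha> j" "root_at \<beta> (perm_app p i) = root_at \<beta> (perm_app p j)"
        using p(1) root_bij_apply by auto
      then show "x = y" using injD[OF B.inj_root_at] injD[OF p(2)] by blast
    qed
    moreover have "f ` range (root_at \<alpha>) = range (root_at \<beta>)"
    proof -
      have "f ` range (root_at \<alpha>) = root_at \<beta> ` range (perm_app p)"
        by (auto simp: p(1) root_bij_apply image_image)
      then show ?thesis using s by simp
    qed
    ultimately show "f \<in> bijections (\<alpha> ` {1..4}) (\<beta> ` {1..4})"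
      using root_bij_extensional[of p] p(1) unfolding bijections_def bij_betw_def PiE_iff range_root_at[symmetric]
      by auto
  qed
qed

lemma root_at_ix_nat: "root_at \<gamma> i = \<gamma> (ix_nat i)"
  by (cases i) simp_all

lemma dihedral_bijections_root_bij: "dihedral_bijections \<alpha> \<beta> = root_bij ` set d8"
proof -
  have ixs: "{1..4} = range ix_nat"
  proof -
    have 1: "UNIV = {I1, I2, I3, I4}" using ix.exhaust by blast
    have 2: "{1..4} = {1, 2, 3, 4::nat}" by auto
    show ?thesis unfolding 1 2 by simp
  qed
  have "root_bij p \<in> dihedral_bijections \<alpha> \<beta> \<longleftrightarrow> p \<in> set d8" if p: "p \<in> set s4" for p
  proof -
    have "root_bij p \<in> dihedral_bijections \<alpha> \<beta> \<longleftrightarrow>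
        (\<exists>\<pi>\<in>dihedral_perms. \<forall>i. root_at \<beta> (perm_app p i) = \<beta> (\<pi> (ix_nat i)))"
    proof -
      have "(\<forall>i\<in>{1..4}. root_bij p (\<alpha> i) = \<beta> (\<pi> i)) \<longleftrightarrow>
          (\<forall>i. root_at \<beta> (perm_app p i) = \<beta> (\<pi> (ix_nat i)))" for \<pi>
        unfolding ixs ball_simps(9) by (simp only: root_at_ix_nat[symmetric] root_bij_apply UNIV_I ball_UNIV)
      then show ?thesis
        using p unfolding dihedral_bijections_def bijections_root_bij by blast
    qed
    also have "\<dots> \<longleftrightarrow> p \<in> set d8"
    proof
      assume "\<exists>\<pi>\<in>dihedral_perms. \<forall>i. root_at \<beta> (perm_app p i) = \<beta> (\<pi> (ix_nat i))"
      then obtain \<pi> where \<pi>: "\<pi> \<in> dihedral_perms" "\<And>i. root_at \<beta> (perm_app p i) = \<beta> (\<pi> (ix_nat i))" by blast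
      then obtain q where q: "q \<in> set d8" "\<And>i. \<pi> (ix_nat i) = ix_nat (perm_app q i)"
        using dihedral_perms_d8(1) by blast
      have "root_at \<beta> (perm_app p i) = root_at \<beta> (perm_app q i)" for i
        using \<pi>(2)[of i] q(2)[of i] root_at_ix_nat by metis
      then have "p = q" by (intro perm_eqI injD[OF B.inj_root_at])
      then show "p \<in> set d8" using q by simp
    next
      assume "p \<in> set d8"
      then show "\<exists>\<pi>\<in>dihedral_perms. \<forall>i. root_at \<beta> (perm_app p i) = \<beta> (\<pi> (ix_nat i))"
        using dihedral_perms_d8(2) root_at_ix_nat by metis
    qed
    finally show ?thesis .
  qed
  moreover have "dihedral_bijections \<alpha> \<beta> \<subseteq> root_bij ` set s4"
    unfolding bijections_root_bij[symmetric] dihedral_bijections_def by blast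
  ultimately show ?thesis using d8_subset_s4 by blast
qed

lemma conj_action_root_bij:
  assumes s: "s \<in> carrier GG" and p: "root_bij p \<in> \<Phi>"
  shows "conj_action GG (\<alpha> ` {1..4}) \<Phi> s (root_bij p) = root_bij (pp_conj (perms s) p)"
proof (rule root_bij_eqI)
  show "conj_action GG (\<alpha> ` {1..4}) \<Phi> s (root_bij p) \<in> extensional (range (root_at \<alpha>))"
    using p by (simp add: conj_action_def range_root_at)
  fix i
  have i: "root_at \<alpha> i \<in> \<alpha> ` {1..4}" unfolding range_root_at[symmetric] by blast
  have "(inv\<^bsub>GG\<^esub> s) (root_at \<alpha> i) = s (s (s (root_at \<alpha> i)))"
    by (rule E.Gal_inv_apply(2)[OF s root_at_E(1)])
  also have "\<dots> = root_at \<alpha> (perm_app (perm_mult (fst (perms s)) (perm_mult (fst (perms s)) (fst (perms s)))) i)"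
    by (simp add: perms_action(1)[OF s])
  finally have "s (root_bij p ((inv\<^bsub>GG\<^esub> s) (root_at \<alpha> i))) = root_at \<beta> (perm_app (pp_conj (perms s) p) i)"
    by (simp add: root_bij_apply perms_action(2)[OF s] pp_conj_def)
  then show "conj_action GG (\<alpha> ` {1..4}) \<Phi> s (root_bij p) (root_at \<alpha> i) = root_at \<beta> (perm_app (pp_conj (perms s) p) i)"
    using p i by (simp add: conj_action_def)
qed

text \<open>By \<open>conj_action_root_bij\<close>, the injective encoding \<open>root_bij\<close>
  carries orbits under \<open>pp_conj\<close> to orbits of bijections, and injectivity preserves
  their sizes.\<close>

lemma orbit_type_root_bij:
  assumes Hl: "set Hl = H" and xs: "distinct xs" "\<And>x. x \<in> set xs \<Longrightarrow> orbit_of H x \<subseteq> set xs"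
  shows "orbit_type GG (\<alpha> ` {1..4}) (root_bij ` set xs) = mset (map length (orbit_list Hl xs))"
proof -
  let ?\<Phi> = "root_bij ` set xs"
  have "orbit GG (conj_action GG (\<alpha> ` {1..4}) ?\<Phi>) (root_bij x) = root_bij ` orbit_of H x" if "x \<in> set xs" for x
  proof -
    have "orbit GG (conj_action GG (\<alpha> ` {1..4}) ?\<Phi>) (root_bij x) =
        (\<lambda>s. conj_action GG (\<alpha> ` {1..4}) ?\<Phi> s (root_bij x)) ` carrier GG"
      by (auto simp: orbit_def)
    also have "\<dots> = (\<lambda>s. root_bij (pp_conj (perms s) x)) ` carrier GG"
      by (rule image_cong) (rule refl, rule conj_action_root_bij, use that in auto)
    finally show ?thesis by (simp add: orbit_of_def H_def image_image)
  qed
  then have "orbits GG ?\<Phi> (conj_action GG (\<alpha> ` {1..4}) ?\<Phi>) = (`) root_bij ` orbit_of H ` set xs"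
    unfolding orbits_def by (auto simp: image_iff) 
  moreover have "inj_on ((`) root_bij) (orbit_of H ` set xs)"
    using inj_on_image[of root_bij "orbit_of H ` set xs"] inj_root_bij inj_on_subset by blast
  ultimately have "orbit_type GG (\<alpha> ` {1..4}) ?\<Phi> =
      image_mset card (image_mset ((`) root_bij) (mset_set (orbit_of H ` set xs)))"
    unfolding orbit_type_def by (simp add: image_mset_mset_set)
  also have "\<dots> = image_mset card (mset_set (orbit_of H ` set xs))"
    unfolding image_mset.compositionality comp_def
    by (rule image_mset_cong) (rule card_image[OF inj_on_subset[OF inj_root_bij subset_UNIV]])
  also have "\<dots> = mset (map length (orbit_list Hl xs))"
    by (rule orbit_list_correct[OF H_subset H_one H_mult Hl xs])
  finally show ?thesis .
qed

lemma d8_cube: "p \<in> set d8 \<Longrightarrow> perm_mult p (perm_mult p p) \<in> set d8"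
  using cube_mult_d8(2) by blast

lemma DT_R_orbit_list:
  assumes "set Hl = H"
  shows "DT_R GG \<alpha> \<beta> = mset (map length (orbit_list Hl s4))"
  unfolding DT_R_def bijections_root_bij
proof (rule orbit_type_root_bij[OF assms distinct_s4])
  fix x assume x: "x \<in> set s4"
  have "pp_conj h x \<in> set s4" if "h \<in> H" for h
  proof -
    have "h \<in> set d8 \<times> set d8" using that H_subset by blast
    then have h: "fst h \<in> set s4" "snd h \<in> set s4" using d8_subset_s4 by (auto simp: mem_Times_iff)
    have "inj (perm_app (perm_mult p q))" if "inj (perm_app p)" "inj (perm_app q)" for p q
      by (rule injI) (use that in \<open>simp add: inj_eq\<close>)
    then show ?thesis using h x unfolding set_s4 pp_conj_def by simp
  qed
  then show "orbit_of H x \<subseteq> set s4" by (auto simp: orbit_of_def)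
qed

lemma DT_R1_orbit_list:
  assumes "set Hl = H"
  shows "DT_R1 GG \<alpha> \<beta> = mset (map length (orbit_list Hl d8))"
  unfolding DT_R1_def dihedral_bijections_root_bij
proof (rule orbit_type_root_bij[OF assms distinct_d8])
  fix x assume x: "x \<in> set d8"
  have "pp_conj h x \<in> set d8" if "h \<in> H" for h
  proof -
    have "h \<in> set d8 \<times> set d8" using that H_subset by blast
    then have "fst h \<in> set d8" "snd h \<in> set d8" by (simp_all only: mem_Times_iff)
    then show ?thesis using x cube_mult_d8(2) d8_cube unfolding pp_conj_def by blast
  qed
  then show "orbit_of H x \<subseteq> set d8" by (auto simp: orbit_of_def)
qed

end

section \<open>Isomorphism types and the final table\<close>

text \<open>The same diagonal encoding as in \<open>Gal_iso_perms\<close>.\<close>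

definition type_pairs :: "gal_type \<Rightarrow> perm_pair list" where
  "type_pairs t = map (\<lambda>p. (p, p)) (type_elems t)"

lemma type_pairs_iso:
  "pp_group (set (type_pairs TD)) \<cong> D4" "pp_group (set (type_pairs TC)) \<cong> C4" "pp_group (set (type_pairs TV)) \<cong> V4"
proof -
  have "model_check MD4 (map (\<lambda>p. (p, p)) [r1, s0]) (type_pairs TD)" by code_simp
  then show "pp_group (set (type_pairs TD)) \<cong> D4" by (rule model_check_D4)
  have "model_check MC4 (map (\<lambda>p. (p, p)) [r1]) (type_pairs TC)" by code_simp
  then show "pp_group (set (type_pairs TC)) \<cong> C4" by (rule model_check_C4)
  have "model_check MV4 (map (\<lambda>p. (p, p)) [s3, r2]) (type_pairs TV)" by code_simp
  then show "pp_group (set (type_pairs TV)) \<cong> V4" by (rule model_check_V4)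
qed

text \<open>All squares are trivial in \<open>V4\<close>, whereas 1 + 1 = 2 is not zero in
  \<open>C4\<close>.\<close>

lemma C4_not_iso_V4: "\<not> C4 \<cong> V4"
proof
  assume "C4 \<cong> V4"
  then obtain h where h: "h \<in> iso C4 V4" by (auto simp: is_iso_def)
  have c: "1 \<in> carrier C4" "2 \<in> carrier C4" "0 \<in> carrier C4" by (simp_all add: carrier_integer_mod_group)
  have m: "h (x \<otimes>\<^bsub>C4\<^esub> y) = h x \<otimes>\<^bsub>V4\<^esub> h y" if "x \<in> carrier C4" "y \<in> carrier C4" for x y
    using h that by (auto simp: iso_def hom_def)
  have sq: "h x \<otimes>\<^bsub>V4\<^esub> h x = (0, 0)" for x by (cases "h x") simp
  have "h 2 = (0, 0)" using m[OF c(1) c(1)] sq[of 1] by simp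
  moreover have "h 0 = (0, 0)" using m[OF c(3) c(3)] sq[of 0] by simp
  moreover have "inj_on h (carrier C4)" using h by (auto simp: iso_def bij_betw_def)
  ultimately have "2 = (0::int)" using inj_onD[of h "carrier C4" 2 0] c by simp
  then show False by simp
qed

text \<open>This turns the isomorphisms for G and G' in the theorem into equations between types.
  The order separates \<open>D4\<close> from the other two groups.\<close>

lemma iso_type_iff:
  fixes K :: "'b monoid"
  assumes K: "group K" and iso: "K \<cong> pp_group (set (type_pairs t))"
  shows "K \<cong> D4 \<longleftrightarrow> t = TD" "K \<cong> C4 \<longleftrightarrow> t = TC" "K \<cong> V4 \<longleftrightarrow> t = TV"
proof -
  have D: "t = TD \<Longrightarrow> K \<cong> D4" and C: "t = TC \<Longrightarrow> K \<cong> C4" and V: "t = TV \<Longrightarrow> K \<cong> V4"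
    using iso type_pairs_iso iso_trans by blast+
  have card: "card (carrier D4) = 8" "card (carrier C4) = 4" "card (carrier V4) = 4"
    using model_D4 model_C4 model_V4 by (simp_all add: model_spec_def)
  have DC: "\<not> (K \<cong> D4 \<and> K \<cong> C4)" "\<not> (K \<cong> D4 \<and> K \<cong> V4)" "\<not> (K \<cong> C4 \<and> K \<cong> V4)"
    using iso_same_card[of K D4] iso_same_card[of K C4] iso_same_card[of K V4] card
      C4_not_iso_V4 group.iso_sym[OF K] iso_trans by fastforce+
  show "K \<cong> D4 \<longleftrightarrow> t = TD" "K \<cong> C4 \<longleftrightarrow> t = TC" "K \<cong> V4 \<longleftrightarrow> t = TV"
    using D C V DC by (cases t; blast)+
qed

text \<open>Forgetting the subgroup leaves 38 different rows of the 72 entries, so the last case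
  distinction is shorter.\<close>

definition table_rows :: "row list" where
  "table_rows = [
    (TC, TC, MC4, Equal, [2, 2, 1, 1, 1, 1], [4, 4, 4, 4, 2, 2, 1, 1, 1, 1]),
    (TC, TC, MC4C2, Degree2, [2, 2, 2, 2], [8, 8, 2, 2, 2, 2]),
    (TC, TC, MC4C4, Trivial, [4, 4], [16, 4, 4]),
    (TC, TV, MC4C2, Degree2, [4, 4], [8, 8, 4, 4]),
    (TC, TV, MC4C2, Degree2, [8], [8, 8, 4, 4]),
    (TC, TV, MC4V4, Trivial, [8], [8, 8, 8]),
    (TD, TC, M16_3, Degree2, [4, 4], [8, 8, 4, 4]),
    (TD, TC, M16_3, Degree2, [4, 4], [16, 4, 4]),
    (TD, TC, M16_4, Degree2, [8], [16, 8]),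
    (TD, TC, MD4C4, Trivial, [8], [16, 8]),
    (TD, TD, M16_3, Degree4, [4, 4], [8, 8, 4, 4]),
    (TD, TD, M16_3, Degree4, [4, 4], [16, 4, 4]),
    (TD, TD, M16_3, Degree4, [8], [16, 8]),
    (TD, TD, M32_27, Degree2, [4, 4], [8, 8, 4, 4]),
    (TD, TD, M32_27, Degree2, [4, 4], [16, 4, 4]),
    (TD, TD, M32_27, Degree2, [8], [16, 8]),
    (TD, TD, M32_28, Degree2, [8], [16, 8]),
    (TD, TD, M32_34, Degree2, [4, 4], [16, 4, 4]),
    (TD, TD, MD4, Equal, [2, 2, 2, 1, 1], [8, 4, 4, 2, 2, 2, 1, 1]),
    (TD, TD, MD4, Equal, [4, 2, 2], [8, 8, 4, 2, 2]),
    (TD, TD, MD4C2, Degree4, [2, 2, 2, 2], [8, 8, 2, 2, 2, 2]),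
    (TD, TD, MD4C2, Degree4, [4, 4], [16, 4, 4]),
    (TD, TD, MD4D4, Trivial, [8], [16, 8]),
    (TD, TV, MD4, Proper, [4, 4], [8, 4, 4, 4, 4]),
    (TD, TV, MD4, Proper, [8], [8, 4, 4, 4, 4]),
    (TD, TV, MD4C2, Degree2, [4, 4], [8, 8, 4, 4]),
    (TD, TV, MD4C2, Degree2, [8], [8, 8, 4, 4]),
    (TD, TV, MD4C2, Degree2, [8], [8, 8, 8]),
    (TD, TV, MD4V4, Trivial, [8], [8, 8, 8]),
    (TV, TC, MC2C4, Degree2, [4, 4], [8, 8, 4, 4]),
    (TV, TC, MC2C4, Degree2, [8], [8, 8, 4, 4]),
    (TV, TC, MV4C4, Trivial, [8], [8, 8, 8]),
    (TV, TV, MV4, Equal, [2, 2, 1, 1, 1, 1], [4, 4, 2, 2, 2, 2, 2, 2, 1, 1, 1, 1]),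
    (TV, TV, MV4, Equal, [4, 2, 2], [4, 4, 2, 2, 2, 2, 2, 2, 1, 1, 1, 1]),
    (TV, TV, MV4C2, Degree2, [2, 2, 2, 2], [4, 4, 4, 4, 2, 2, 2, 2]),
    (TV, TV, MV4C2, Degree2, [4, 2, 2], [4, 4, 4, 4, 2, 2, 2, 2]),
    (TV, TV, MV4C2, Degree2, [4, 4], [4, 4, 4, 4, 2, 2, 2, 2]),
    (TV, TV, MV4V4, Trivial, [4, 4], [4, 4, 4, 4, 4, 4])]"

lemma table_rows_complete: "list_all (List.member table_rows) (map (fst \<circ> snd) subgroup_table)"
  by code_simp


context signed_roots_pair
begin

lemma Gal_A_iso: "fst ` H = set (type_elems t) \<Longrightarrow> Gal R A.L M \<cong> pp_group (set (type_pairs t))"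
  using A.Gal_iso_perms by (simp add: fst_H[symmetric] type_pairs_def)

lemma Gal_B_iso: "snd ` H = set (type_elems t) \<Longrightarrow> Gal R B.L M \<cong> pp_group (set (type_pairs t))"
  using B.Gal_iso_perms by (simp add: snd_H[symmetric] type_pairs_def)

lemma classification:
  assumes "order (Gal R B.L M) \<le> order (Gal R A.L M)"
  obtains t t' m rel d1 d Hl ws c N where "(t, t', m, rel, d1, d) \<in> set table_rows"
    "fst ` H = set (type_elems t)" "snd ` H = set (type_elems t')" "set Hl = H" "model_check m ws Hl"
    "set N = {q. (r0, q) \<in> H}" "relation_check rel c N Hl"
    "DT_R1 GG \<alpha> \<beta> = mset d1" "DT_R GG \<alpha> \<beta> = mset d"
proof -
  have "card (snd ` H) \<le> card (fst ` H)" using assms by (simp add: A.order_Gal B.order_Gal fst_H snd_H)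
  then obtain t xs N r ws c where e: "((t, xs, N), r, ws, c) \<in> set subgroup_table"
    "set (lift_group t xs N) = H" "set N = {q. (r0, q) \<in> H}" "fst ` H = set (type_elems t)"
    using subgroup_cover[OF H_subset H_one H_mult H_transitive] by metis
  obtain t1 t' m rel d1 d where r: "r = (t1, t', m, rel, d1, d)" by (cases r)
  define Hl where "Hl = lift_group t xs N"
  have "row_check ((t, xs, N), r, ws, c)" using subgroup_table_rows e(1) by (simp only: list_all_iff)
  then have rc: "t1 = t" "same_elems (map snd Hl) (type_elems t')" "relation_check rel c N Hl"
    "rev (sort (map length (orbit_list Hl d8))) = d1" "rev (sort (map length (orbit_list Hl s4))) = d"
    "model_check m ws Hl"
    unfolding r row_check.simps Let_def Hl_def[symmetric] by blast+
  have Hl: "set Hl = H" using e(2) by (simp add: Hl_def)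
  have "r \<in> set (map (fst \<circ> snd) subgroup_table)" using e(1) by force
  then have 1: "(t, t', m, rel, d1, d) \<in> set table_rows"
    using table_rows_complete rc(1) unfolding r list_all_iff List.member_iff by blast
  have 2: "snd ` H = set (type_elems t')"
    using rc(2) Hl by (auto simp: same_elems_def list_all_iff)
  have 3: "DT_R1 GG \<alpha> \<beta> = mset d1" "DT_R GG \<alpha> \<beta> = mset d"
    using DT_R1_orbit_list[OF Hl] DT_R_orbit_list[OF Hl] rc(4,5) by (metis mset_rev mset_sort)+
  show ?thesis by (rule that[OF 1 e(4) 2 Hl rc(6) e(3) rc(3) 3])
qed

end

section \<open>From quartic polynomials to their roots\<close>

context field
begin

text \<open>A monic irreducible f with root x is the minimal polynomial of x, so it would divide the
  quadratic, whose degree is too small.\<close>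

lemma irreducible_no_quadratic:
  assumes K: "subfield K R" and f: "f \<in> carrier (K[X])" "pirreducible K f" "lead_coeff f = \<one>" "degree f > 2"
    and x: "x \<in> carrier R" "eval f x = \<zero>" and uv: "u \<in> K" "v \<in> K"
  shows "x \<otimes> x \<oplus> u \<otimes> x \<oplus> v \<noteq> \<zero>"
proof
  assume z: "x \<otimes> x \<oplus> u \<otimes> x \<oplus> v = \<zero>"
  note c = subfield_closed[OF K]
  have R: "u \<in> carrier R" "v \<in> carrier R" using uv c(1) by auto
  have q: "[\<one>, u, v] \<in> carrier (K[X])"
    using uv c(3) by (simp add: sym[OF univ_poly_carrier] polynomial_def)
  have "f \<noteq> []" using f(4) by auto
  then have alg: "(algebraic over K) x" by (rule algebraicI[OF f(1) _ x(2)])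
  have "Irr K x = f"
    using minimal_polynomial_is_unique[OF K x(1) alg] IrrE[OF K x(1) alg] f(1-3) x(2) by blast
  moreover have "eval [\<one>, u, v] x = x \<otimes> x \<oplus> u \<otimes> x \<oplus> v"
    using x(1) R by (simp add: numeral_2_eq_2 a_assoc)
  ultimately have "f pdivides [\<one>, u, v]" using Irr_minimal[OF K x(1) alg q] z by simp
  then have "degree f \<le> degree [\<one>, u, v]"
    by (rule pdivides_imp_degree_le[OF subfieldE(1)[OF K] f(1) q, rotated]) simp
  then show False using f(4) by simp
qed

context
  fixes M a b \<alpha>
  assumes M: "subfield M R" and ab: "a \<in> M" "b \<in> M"
    and ord: "root_ordering R (quartic R a b) \<alpha>"
begin

private lemma roots: "\<alpha> ` {1..4} = root_set R (quartic R a b)" "inj_on \<alpha> {1..4}"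
  "\<alpha> 3 = \<ominus> \<alpha> 1" "\<alpha> 4 = \<ominus> \<alpha> 2"
  using ord by (auto simp: root_ordering_def bij_betw_def)

private lemma abR: "a \<in> carrier R" "b \<in> carrier R"
  using ab subfield_closed(1)[OF M] by auto

private lemma root_eq:
  assumes "i \<in> {1..4}"
  shows "\<alpha> i \<in> carrier R" "eval (quartic R a b) (\<alpha> i) = \<zero>"
    "(\<alpha> i \<otimes> \<alpha> i) \<otimes> (\<alpha> i \<otimes> \<alpha> i) \<oplus> a \<otimes> (\<alpha> i \<otimes> \<alpha> i) \<oplus> b = \<zero>"
proof -
  have "\<alpha> i \<in> root_set R (quartic R a b)" using roots(1) assms by blast
  then have r: "\<alpha> i \<in> carrier R" "eval (quartic R a b) (\<alpha> i) = \<zero>"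
    by (auto simp: root_set_def is_root_def)
  have "eval (quartic R a b) (\<alpha> i) = (\<alpha> i \<otimes> \<alpha> i) \<otimes> (\<alpha> i \<otimes> \<alpha> i) \<oplus> a \<otimes> (\<alpha> i \<otimes> \<alpha> i) \<oplus> b"
    using r(1) abR by (simp add: quartic_def numeral_eq_Suc m_assoc a_assoc)
  then show "\<alpha> i \<in> carrier R" "eval (quartic R a b) (\<alpha> i) = \<zero>"
    "(\<alpha> i \<otimes> \<alpha> i) \<otimes> (\<alpha> i \<otimes> \<alpha> i) \<oplus> a \<otimes> (\<alpha> i \<otimes> \<alpha> i) \<oplus> b = \<zero>" using r by simp_all
qed

text \<open>Vieta for T^2 + a T + b: its roots p and q are different because
  \<open>\<alpha> 1\<close> is neither \<open>\<alpha> 2\<close> nor its negative. Subtracting the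
  two equations and cancelling p - q gives p + q = -a, and then p q = b.\<close>

lemma quartic_signed_roots: "signed_roots R M \<alpha>"
proof (rule signed_roots.intro[OF field_axioms], rule signed_roots_axioms.intro)
  define p q where "p = \<alpha> 1 \<otimes> \<alpha> 1" and "q = \<alpha> 2 \<otimes> \<alpha> 2"
  have R: "\<alpha> 1 \<in> carrier R" "\<alpha> 2 \<in> carrier R" by (rule root_eq; simp)+
  then have pq: "p \<in> carrier R" "q \<in> carrier R" by (simp_all add: p_def q_def)
  have e: "p \<otimes> p \<oplus> a \<otimes> p \<oplus> b = \<zero>" "q \<otimes> q \<oplus> a \<otimes> q \<oplus> b = \<zero>"
    unfolding p_def q_def by (rule root_eq; simp)+
  have "p \<noteq> q"
  proof
    assume "p = q"
    then have "\<alpha> 1 = \<alpha> 2 \<or> \<alpha> 1 = \<alpha> 4" using square_eq_square[OF R] roots(4) by (simp add: p_def q_def)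
    then show False using roots(2) by (auto dest: inj_onD)
  qed
  have "(p \<ominus> q) \<otimes> (p \<oplus> q \<oplus> a) = (p \<otimes> p \<oplus> a \<otimes> p \<oplus> b) \<ominus> (q \<otimes> q \<oplus> a \<otimes> q \<oplus> b)"
    using pq abR by algebra
  then have "(p \<ominus> q) \<otimes> (p \<oplus> q \<oplus> a) = \<zero>" unfolding e by simp
  then have "p \<ominus> q = \<zero> \<or> p \<oplus> q \<oplus> a = \<zero>" by (rule integral) (use pq abR in simp_all)
  then have s: "p \<oplus> q \<oplus> a = \<zero>" using \<open>p \<noteq> q\<close> pq by simp
  have "p \<oplus> q = \<ominus> a \<oplus> (p \<oplus> q \<oplus> a)" using pq abR by algebra
  then have "p \<oplus> q = \<ominus> a" unfolding s using abR by simp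
  then show "\<alpha> 1 \<otimes> \<alpha> 1 \<oplus> \<alpha> 2 \<otimes> \<alpha> 2 \<in> M" using subfield_closed(6)[OF M ab(1)] by (simp add: p_def q_def)
  have "p \<otimes> q = b \<oplus> p \<otimes> (p \<oplus> q \<oplus> a) \<ominus> (p \<otimes> p \<oplus> a \<otimes> p \<oplus> b)" using pq abR by algebra
  then have "p \<otimes> q = b" unfolding s e using pq abR by (simp add: minus_eq)
  then show "(\<alpha> 1 \<otimes> \<alpha> 1) \<otimes> (\<alpha> 2 \<otimes> \<alpha> 2) \<in> M" using ab by (simp add: p_def q_def)
qed (use M roots root_eq in simp_all)

lemma quartic_splitting_field: "splitting_field R M (quartic R a b) = signed_roots.L R M \<alpha>"
proof -
  interpret S: signed_roots R M \<alpha> by (rule quartic_signed_roots)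
  have rs: "root_set R (quartic R a b) = range (root_at \<alpha>)" using roots(1) range_root_at by metis
  have "S.L = generate_field R (M \<union> range (root_at \<alpha>))"
  proof (rule generate_fieldI)
    show "M \<union> range (root_at \<alpha>) \<subseteq> carrier R"
      using subfield_closed(1)[OF M] S.root_at_carrier by blast
    show "M \<union> range (root_at \<alpha>) \<subseteq> S.L" using S.L_mem S.root_at_L by blast
    show "S.L \<subseteq> K" if "subfield K R" "M \<union> range (root_at \<alpha>) \<subseteq> K" for K
      using S.L_gen[OF that(1)] that(2) by blast
  qed (rule S.L_subfield)
  then show ?thesis by (simp add: splitting_field_def rs)
qed

lemma quartic_irreducible:
  assumes "pirreducible M (quartic R a b)" "u \<in> M" "v \<in> M"
  shows "\<alpha> 1 \<otimes> \<alpha> 1 \<oplus> u \<otimes> \<alpha> 1 \<oplus> v \<noteq> \<zero>"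
proof (rule irreducible_no_quadratic[OF M _ assms(1) _ _ _ _ assms(2,3)])
  show "quartic R a b \<in> carrier (M[X])"
    using ab subfield_closed(2,3)[OF M] by (simp add: quartic_def sym[OF univ_poly_carrier] polynomial_def)
qed (use root_eq[of 1] in \<open>simp_all add: quartic_def\<close>)

end

end

lemmas model_check_isos =
  model_check_D4D4
  model_check_32_27
  model_check_32_28
  model_check_32_34
  model_check_16_3
  model_check_16_4
  model_check_D4C4
  model_check_D4V4
  model_check_D4C2
  model_check_D4
  model_check_C4C4
  model_check_C4C2
  model_check_C2C4
  model_check_C4
  model_check_C4V4
  model_check_V4C4
  model_check_V4V4
  model_check_V4C2
  model_check_V4

lemma (in signed_roots_pair) compositum_eq: "compositum R A.L B.L = E"
proof -
  have "E = generate_field R (A.L \<union> B.L)"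
  proof (rule generate_fieldI)
    show "A.L \<union> B.L \<subseteq> carrier R"
      using subfield_closed(1)[OF A.L_subfield] subfield_closed(1)[OF B.L_subfield] by blast
    show "A.L \<union> B.L \<subseteq> E" using A_L_subset B_L_subset by blast
    show "E \<subseteq> K" if "subfield K R" "A.L \<union> B.L \<subseteq> K" for K
      using E_minimal[OF that(1)] that(2) by blast
  qed (rule E_subfield)
  then show ?thesis by (simp add: compositum_def)
qed

theorem theorem4p9:
  fixes F :: "('a, 'm) ring_scheme"
    and k M L L' :: "'a set"
    and a b a' b' :: 'a
    and \<alpha> \<beta> :: "nat \<Rightarrow> 'a"
    and G G' GG :: "('a \<Rightarrow> 'a) monoid"
  assumes "field F" and "subfield M F" and "subfield k F" and "k \<subseteq> M"
    and "characteristic (F\<lparr>carrier := k\<rparr>) \<noteq> 2"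
    and "infinite M"
    and "a \<in> M" and "b \<in> M" and "a' \<in> M" and "b' \<in> M"
    and "quartic_disc F a b \<otimes>\<^bsub>F\<^esub> quartic_disc F a' b' \<noteq> \<zero>\<^bsub>F\<^esub>"
    and "pirreducible\<^bsub>F\<^esub> M (quartic F a b)"
    and "pirreducible\<^bsub>F\<^esub> M (quartic F a' b')"
    and "root_ordering F (quartic F a b) \<alpha>"
    and "root_ordering F (quartic F a' b') \<beta>"
    and "L = splitting_field F M (quartic F a b)"
    and "L' = splitting_field F M (quartic F a' b')"
    and "G = Gal F L M"
    and "G' = Gal F L' M"
    and "GG = Gal F (compositum F L L') M"
    and "order G \<ge> order G'"
  shows "(G \<cong> D4 \<longrightarrow>
      (G' \<cong> D4 \<or> G' \<cong> C4 \<or> G' \<cong> V4) \<and>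
      (G' \<cong> D4 \<longrightarrow>
          (GG \<cong> D4 \<times>\<times> D4 \<and> L \<inter> L' = M \<and> DT_R1 GG \<alpha> \<beta> = {#8#} \<and> DT_R GG \<alpha> \<beta> = {#16, 8#}) \<or>
          (GG \<cong> SG_32_27 \<and> ring.dimension F 2 M (L \<inter> L') \<and> DT_R1 GG \<alpha> \<beta> = {#8#} \<and> DT_R GG \<alpha> \<beta> = {#16, 8#}) \<or>
          (GG \<cong> SG_32_27 \<and> ring.dimension F 2 M (L \<inter> L') \<and> DT_R1 GG \<alpha> \<beta> = {#4, 4#} \<and> DT_R GG \<alpha> \<beta> = {#16, 4, 4#}) \<or>
          (GG \<cong> SG_32_27 \<and> ring.dimension F 2 M (L \<inter> L') \<and> DT_R1 GG \<alpha> \<beta> = {#4, 4#} \<and> DT_R GG \<alpha> \<beta> = {#8, 8, 4, 4#}) \<or>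
          (GG \<cong> SG_32_28 \<and> ring.dimension F 2 M (L \<inter> L') \<and> DT_R1 GG \<alpha> \<beta> = {#8#} \<and> DT_R GG \<alpha> \<beta> = {#16, 8#}) \<or>
          (GG \<cong> SG_32_34 \<and> ring.dimension F 2 M (L \<inter> L') \<and> DT_R1 GG \<alpha> \<beta> = {#4, 4#} \<and> DT_R GG \<alpha> \<beta> = {#16, 4, 4#}) \<or>
          (GG \<cong> SG_16_3 \<and> ring.dimension F 4 M (L \<inter> L') \<and> DT_R1 GG \<alpha> \<beta> = {#8#} \<and> DT_R GG \<alpha> \<beta> = {#16, 8#}) \<or>
          (GG \<cong> SG_16_3 \<and> ring.dimension F 4 M (L \<inter> L') \<and> DT_R1 GG \<alpha> \<beta> = {#4, 4#} \<and> DT_R GG \<alpha> \<beta> = {#16, 4, 4#}) \<or>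
          (GG \<cong> SG_16_3 \<and> ring.dimension F 4 M (L \<inter> L') \<and> DT_R1 GG \<alpha> \<beta> = {#4, 4#} \<and> DT_R GG \<alpha> \<beta> = {#8, 8, 4, 4#}) \<or>
          (GG \<cong> D4 \<times>\<times> C2 \<and> ring.dimension F 4 M (L \<inter> L') \<and> DT_R1 GG \<alpha> \<beta> = {#4, 4#} \<and> DT_R GG \<alpha> \<beta> = {#16, 4, 4#}) \<or>
          (GG \<cong> D4 \<times>\<times> C2 \<and> ring.dimension F 4 M (L \<inter> L') \<and> DT_R1 GG \<alpha> \<beta> = {#2, 2, 2, 2#} \<and> DT_R GG \<alpha> \<beta> = {#8, 8, 2, 2, 2, 2#}) \<or>
          (GG \<cong> D4 \<and> L = L' \<and> DT_R1 GG \<alpha> \<beta> = {#4, 2, 2#} \<and> DT_R GG \<alpha> \<beta> = {#8, 8, 4, 2, 2#}) \<or>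
          (GG \<cong> D4 \<and> L = L' \<and> DT_R1 GG \<alpha> \<beta> = {#2, 2, 2, 1, 1#} \<and> DT_R GG \<alpha> \<beta> = {#8, 4, 4, 2, 2, 2, 1, 1#})) \<and>
      (G' \<cong> C4 \<longrightarrow>
          (GG \<cong> D4 \<times>\<times> C4 \<and> L \<inter> L' = M \<and> DT_R1 GG \<alpha> \<beta> = {#8#} \<and> DT_R GG \<alpha> \<beta> = {#16, 8#}) \<or>
          (GG \<cong> SG_16_3 \<and> ring.dimension F 2 M (L \<inter> L') \<and> DT_R1 GG \<alpha> \<beta> = {#4, 4#} \<and> DT_R GG \<alpha> \<beta> = {#16, 4, 4#}) \<or>
          (GG \<cong> SG_16_3 \<and> ring.dimension F 2 M (L \<inter> L') \<and> DT_R1 GG \<alpha> \<beta> = {#4, 4#} \<and> DT_R GG \<alpha> \<beta> = {#8, 8, 4, 4#}) \<or>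
          (GG \<cong> SG_16_4 \<and> ring.dimension F 2 M (L \<inter> L') \<and> DT_R1 GG \<alpha> \<beta> = {#8#} \<and> DT_R GG \<alpha> \<beta> = {#16, 8#})) \<and>
      (G' \<cong> V4 \<longrightarrow>
          (GG \<cong> D4 \<times>\<times> V4 \<and> L \<inter> L' = M \<and> DT_R1 GG \<alpha> \<beta> = {#8#} \<and> DT_R GG \<alpha> \<beta> = {#8, 8, 8#}) \<or>
          (GG \<cong> D4 \<times>\<times> C2 \<and> ring.dimension F 2 M (L \<inter> L') \<and> DT_R1 GG \<alpha> \<beta> = {#8#} \<and> DT_R GG \<alpha> \<beta> = {#8, 8, 8#}) \<or>
          (GG \<cong> D4 \<times>\<times> C2 \<and> ring.dimension F 2 M (L \<inter> L') \<and> DT_R1 GG \<alpha> \<beta> = {#8#} \<and> DT_R GG \<alpha> \<beta> = {#8, 8, 4, 4#}) \<or>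
          (GG \<cong> D4 \<times>\<times> C2 \<and> ring.dimension F 2 M (L \<inter> L') \<and> DT_R1 GG \<alpha> \<beta> = {#4, 4#} \<and> DT_R GG \<alpha> \<beta> = {#8, 8, 4, 4#}) \<or>
          (GG \<cong> D4 \<and> L' \<subset> L \<and> DT_R1 GG \<alpha> \<beta> = {#8#} \<and> DT_R GG \<alpha> \<beta> = {#8, 4, 4, 4, 4#}) \<or>
          (GG \<cong> D4 \<and> L' \<subset> L \<and> DT_R1 GG \<alpha> \<beta> = {#4, 4#} \<and> DT_R GG \<alpha> \<beta> = {#8, 4, 4, 4, 4#}))) \<and>
    (G \<cong> C4 \<longrightarrow>
      (G' \<cong> C4 \<or> G' \<cong> V4) \<and>
      (G' \<cong> C4 \<longrightarrow>
          (GG \<cong> C4 \<times>\<times> C4 \<and> L \<inter> L' = M \<and> DT_R1 GG \<alpha> \<beta> = {#4, 4#} \<and> DT_R GG \<alpha> \<beta> = {#16, 4, 4#}) \<or>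
          (GG \<cong> C4 \<times>\<times> C2 \<and> ring.dimension F 2 M (L \<inter> L') \<and> DT_R1 GG \<alpha> \<beta> = {#2, 2, 2, 2#} \<and> DT_R GG \<alpha> \<beta> = {#8, 8, 2, 2, 2, 2#}) \<or>
          (GG \<cong> C4 \<and> L = L' \<and> DT_R1 GG \<alpha> \<beta> = {#2, 2, 1, 1, 1, 1#} \<and> DT_R GG \<alpha> \<beta> = {#4, 4, 4, 4, 2, 2, 1, 1, 1, 1#})) \<and>
      (G' \<cong> V4 \<longrightarrow>
          (GG \<cong> C4 \<times>\<times> V4 \<and> L \<inter> L' = M \<and> DT_R1 GG \<alpha> \<beta> = {#8#} \<and> DT_R GG \<alpha> \<beta> = {#8, 8, 8#}) \<or>
          (GG \<cong> C4 \<times>\<times> C2 \<and> ring.dimension F 2 M (L \<inter> L') \<and> DT_R1 GG \<alpha> \<beta> = {#8#} \<and> DT_R GG \<alpha> \<beta> = {#8, 8, 4, 4#}) \<or>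
          (GG \<cong> C4 \<times>\<times> C2 \<and> ring.dimension F 2 M (L \<inter> L') \<and> DT_R1 GG \<alpha> \<beta> = {#4, 4#} \<and> DT_R GG \<alpha> \<beta> = {#8, 8, 4, 4#}))) \<and>
    (G \<cong> V4 \<longrightarrow>
      (G' \<cong> C4 \<or> G' \<cong> V4) \<and>
      (G' \<cong> C4 \<longrightarrow>
          (GG \<cong> V4 \<times>\<times> C4 \<and> L \<inter> L' = M \<and> DT_R1 GG \<alpha> \<beta> = {#8#} \<and> DT_R GG \<alpha> \<beta> = {#8, 8, 8#}) \<or>
          (GG \<cong> C2 \<times>\<times> C4 \<and> ring.dimension F 2 M (L \<inter> L') \<and> DT_R1 GG \<alpha> \<beta> = {#8#} \<and> DT_R GG \<alpha> \<beta> = {#8, 8, 4, 4#}) \<or>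
          (GG \<cong> C2 \<times>\<times> C4 \<and> ring.dimension F 2 M (L \<inter> L') \<and> DT_R1 GG \<alpha> \<beta> = {#4, 4#} \<and> DT_R GG \<alpha> \<beta> = {#8, 8, 4, 4#})) \<and>
      (G' \<cong> V4 \<longrightarrow>
          (GG \<cong> V4 \<times>\<times> V4 \<and> L \<inter> L' = M \<and> DT_R1 GG \<alpha> \<beta> = {#4, 4#} \<and> DT_R GG \<alpha> \<beta> = {#4, 4, 4, 4, 4, 4#}) \<or>
          (GG \<cong> V4 \<times>\<times> C2 \<and> ring.dimension F 2 M (L \<inter> L') \<and> DT_R1 GG \<alpha> \<beta> = {#4, 4#} \<and> DT_R GG \<alpha> \<beta> = {#4, 4, 4, 4, 2, 2, 2, 2#}) \<or>
          (GG \<cong> V4 \<times>\<times> C2 \<and> ring.dimension F 2 M (L \<inter> L') \<and> DT_R1 GG \<alpha> \<beta> = {#4, 2, 2#} \<and> DT_R GG \<alpha> \<beta> = {#4, 4, 4, 4, 2, 2, 2, 2#}) \<or>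
          (GG \<cong> V4 \<times>\<times> C2 \<and> ring.dimension F 2 M (L \<inter> L') \<and> DT_R1 GG \<alpha> \<beta> = {#2, 2, 2, 2#} \<and> DT_R GG \<alpha> \<beta> = {#4, 4, 4, 4, 2, 2, 2, 2#}) \<or>
          (GG \<cong> V4 \<and> L = L' \<and> DT_R1 GG \<alpha> \<beta> = {#4, 2, 2#} \<and> DT_R GG \<alpha> \<beta> = {#4, 4, 2, 2, 2, 2, 2, 2, 1, 1, 1, 1#}) \<or>
          (GG \<cong> V4 \<and> L = L' \<and> DT_R1 GG \<alpha> \<beta> = {#2, 2, 1, 1, 1, 1#} \<and> DT_R GG \<alpha> \<beta> = {#4, 4, 2, 2, 2, 2, 2, 2, 1, 1, 1, 1#})))"
proof -
  interpret F: field F by fact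
  note subM = assms(2)
  have A: "signed_roots F M \<alpha>" and B: "signed_roots F M \<beta>"
    by (rule F.quartic_signed_roots[OF subM]; fact)+
  interpret P: signed_roots_pair F M \<alpha> \<beta>
  proof (rule signed_roots_pair.intro[OF F.field_axioms A B], rule signed_roots_pair_axioms.intro)
    show "\<alpha> 1 \<otimes>\<^bsub>F\<^esub> \<alpha> 1 \<oplus>\<^bsub>F\<^esub> u \<otimes>\<^bsub>F\<^esub> \<alpha> 1 \<oplus>\<^bsub>F\<^esub> v \<noteq> \<zero>\<^bsub>F\<^esub>" if "u \<in> M" "v \<in> M" for u v
      by (rule F.quartic_irreducible[OF subM assms(7,8,14,12) that])
    show "\<beta> 1 \<otimes>\<^bsub>F\<^esub> \<beta> 1 \<oplus>\<^bsub>F\<^esub> u \<otimes>\<^bsub>F\<^esub> \<beta> 1 \<oplus>\<^bsub>F\<^esub> v \<noteq> \<zero>\<^bsub>F\<^esub>" if "u \<in> M" "v \<in> M" for u v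
      by (rule F.quartic_irreducible[OF subM assms(9,10,15,13) that])
  qed
  have L: "L = P.A.L" and L': "L' = P.B.L"
    using F.quartic_splitting_field[OF subM assms(7,8,14)] F.quartic_splitting_field[OF subM assms(9,10,15)]
      assms(16,17) by simp_all
  have GG: "GG = Gal F P.E M" and G: "G = Gal F P.A.L M" and G': "G' = Gal F P.B.L M"
    using assms(18-20) L L' P.compositum_eq by simp_all
  obtain t t' m rel d1 d Hl ws c N where row: "(t, t', m, rel, d1, d) \<in> set table_rows"
    and H: "fst ` P.H = set (type_elems t)" "snd ` P.H = set (type_elems t')" "set Hl = P.H"
    and m: "model_check m ws Hl" and N: "set N = {q. (r0, q) \<in> P.H}"
    and rel: "relation_check rel c N Hl"
    and DT: "DT_R1 GG \<alpha> \<beta> = mset d1" "DT_R GG \<alpha> \<beta> = mset d"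
    using assms(21) unfolding GG G G' by (rule P.classification)
  have tG: "G \<cong> D4 \<longleftrightarrow> t = TD" "G \<cong> C4 \<longleftrightarrow> t = TC" "G \<cong> V4 \<longleftrightarrow> t = TV"
    using iso_type_iff[OF P.A.X.Gal_group P.Gal_A_iso[OF H(1)]] by (simp_all add: G)
  have tG': "G' \<cong> D4 \<longleftrightarrow> t' = TD" "G' \<cong> C4 \<longleftrightarrow> t' = TC" "G' \<cong> V4 \<longleftrightarrow> t' = TV"
    using iso_type_iff[OF P.B.X.Gal_group P.Gal_B_iso[OF H(2)]] by (simp_all add: G')
  have GH: "GG \<cong> pp_group (set Hl)" using P.Gal_iso_H by (simp add: GG H(3))
  have iso:
    "m = MD4D4 \<Longrightarrow> GG \<cong> D4 \<times>\<times> D4"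
    "m = M32_27 \<Longrightarrow> GG \<cong> SG_32_27"
    "m = M32_28 \<Longrightarrow> GG \<cong> SG_32_28"
    "m = M32_34 \<Longrightarrow> GG \<cong> SG_32_34"
    "m = M16_3 \<Longrightarrow> GG \<cong> SG_16_3"
    "m = M16_4 \<Longrightarrow> GG \<cong> SG_16_4"
    "m = MD4C4 \<Longrightarrow> GG \<cong> D4 \<times>\<times> C4"
    "m = MD4V4 \<Longrightarrow> GG \<cong> D4 \<times>\<times> V4"
    "m = MD4C2 \<Longrightarrow> GG \<cong> D4 \<times>\<times> C2"
    "m = MD4 \<Longrightarrow> GG \<cong> D4"
    "m = MC4C4 \<Longrightarrow> GG \<cong> C4 \<times>\<times> C4"
    "m = MC4C2 \<Longrightarrow> GG \<cong> C4 \<times>\<times> C2"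
    "m = MC2C4 \<Longrightarrow> GG \<cong> C2 \<times>\<times> C4"
    "m = MC4 \<Longrightarrow> GG \<cong> C4"
    "m = MC4V4 \<Longrightarrow> GG \<cong> C4 \<times>\<times> V4"
    "m = MV4C4 \<Longrightarrow> GG \<cong> V4 \<times>\<times> C4"
    "m = MV4V4 \<Longrightarrow> GG \<cong> V4 \<times>\<times> V4"
    "m = MV4C2 \<Longrightarrow> GG \<cong> V4 \<times>\<times> C2"
    "m = MV4 \<Longrightarrow> GG \<cong> V4"
    using m by - (rule iso_trans[OF GH], simp only:, erule model_check_isos)+
  have rel:
    "rel = Trivial \<Longrightarrow> L \<inter> L' = M"
    "rel = Degree2 \<Longrightarrow> ring.dimension F 2 M (L \<inter> L')"
    "rel = Degree4 \<Longrightarrow> ring.dimension F 4 M (L \<inter> L')"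
    "rel = Proper \<Longrightarrow> L' \<subset> L"
    "rel = Equal \<Longrightarrow> L = L'"
    using P.relation_Trivial[OF _ H(3) N] P.relation_Degree2[OF _ H(3) N] P.relation_Degree4[OF _ H(3) N]
      P.relation_Proper[OF _ H(3)] P.relation_Equal[OF _ H(3)] rel unfolding L L' by blast+
  show ?thesis
    \<comment> \<open>Each row fixes the two types, the model, the relation and the orbit sizes.
      Implications for other types hold vacuously, and the restrictions on G' hold because no row
      violates them.\<close>
    using row unfolding table_rows_def
    by (simp only: list.set insert_iff empty_iff prod.inject)
      (elim disjE conjE; simp add: tG tG' DT iso rel)
qed

end
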